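(* For every $n\ge1$, the affine span (over $\mathbb{Q}$) of the set of cd-indices of all Bruhat intervals of rank $n$ (in arbitrary Coxeter groups) is the entire affine space of monic homogeneous cd-polynomials of degree $n-1$, i.e. the set of all rational linear combinations of cd-monomials of degree $n-1$ in which the coefficient of $c^{n-1}$ is $1$.
   Context: A Bruhat interval of rank $n$ is an interval $[x,y]$ in the Bruhat order of a Coxeter group with $l(y)-l(x)=n$. (Bruhat order: fixing a reduced word for $w$, $v\le w$ iff some subword is a reduced word for $v$.) cd-index. For a finite graded poset $P$ of rank $m+1\ge1$ with minimum $\hat0$ and maximum $\hat1$ and $S\subseteq[m]$, let $\alpha_P(S)$ be the number of chains in $P\setminus\{\hat0,\hat1\}$ whose set of ranks is $S$, and $\beta_P(S)=\sum_{T\subseteq S}(-1)^{|S\setminus T|}\alpha_P(T)$. Let $u_S=u_1\cdots u_m$ be the monomial in non-commuting variables $a,b$ with $u_i=b$ if $i\in S$ and $u_i=a$ otherwise; set $\Psi_P=\sum_{S\subseteq[m]}\beta_P(S)u_S$. Put $c=a+b$, $d=ab+ba$. For a Bruhat interval (more generally an Eulerian poset) $\Psi_P$ is a polynomial in the non-commuting variables $c,d$, called the cd-index; with $\deg c=1$, $\deg d=2$ it is homogeneous of degree $m$, and the coefficient of $c^m$ is $1$ (monic). *)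

theory Defs
  imports
    "HOL-Algebra.Generated_Groups"
    "HOL-Library.Extended_Nat"
    "HOL-Library.Poly_Mapping"
    "HOL-Library.Sublist"
begin

section \<open>Coxeter systems and Bruhat order\<close>

text \<open>
  Entry \<open>\<infinity>\<close> of a Coxeter matrix means that no relation is imposed on the pair.
\<close>

definition coxeter_matrix :: "'g set \<Rightarrow> ('g \<Rightarrow> 'g \<Rightarrow> enat) \<Rightarrow> bool" where
  "coxeter_matrix S m \<longleftrightarrow>
     (\<forall>s\<in>S. m s s = 1) \<and>
     (\<forall>s\<in>S. \<forall>t\<in>S. m s t = m t s) \<and>
     (\<forall>s\<in>S. \<forall>t\<in>S. s \<noteq> t \<longrightarrow> m s t \<ge> 2)"

text \<open>
  The presentation \<open>\<langle>S | (s t)^(m s t) = 1\<rangle>\<close>: the congruence on words over \<open>S\<close> generated by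
  the relators. Words in positive letters suffice, since \<open>m s s = 1\<close> makes
  every generator its own inverse.
\<close>

inductive coxeter_cong :: "'g set \<Rightarrow> ('g \<Rightarrow> 'g \<Rightarrow> enat) \<Rightarrow> 'g list \<Rightarrow> 'g list \<Rightarrow> bool"
  for S :: "'g set" and m :: "'g \<Rightarrow> 'g \<Rightarrow> enat" where
  refl: "w \<in> lists S \<Longrightarrow> coxeter_cong S m w w"
| sym: "coxeter_cong S m v w \<Longrightarrow> coxeter_cong S m w v"
| trans: "coxeter_cong S m u v \<Longrightarrow> coxeter_cong S m v w \<Longrightarrow> coxeter_cong S m u w"
| relator: "s \<in> S \<Longrightarrow> t \<in> S \<Longrightarrow> m s t = enat k \<Longrightarrow> u \<in> lists S \<Longrightarrow> v \<in> lists S \<Longrightarrow>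
    coxeter_cong S m (u @ concat (replicate k [s, t]) @ v) (u @ v)"

definition word_prod :: "('g, 'b) monoid_scheme \<Rightarrow> 'g list \<Rightarrow> 'g" where
  "word_prod G ws = foldr (\<otimes>\<^bsub>G\<^esub>) ws \<one>\<^bsub>G\<^esub>"

definition coxeter_system :: "('g, 'b) monoid_scheme \<Rightarrow> 'g set \<Rightarrow> bool" where
  "coxeter_system G S \<longleftrightarrow>
     group G \<and> S \<subseteq> carrier G \<and> generate G S = carrier G \<and>
     (\<exists>m. coxeter_matrix S m \<and>
       (\<forall>v\<in>lists S. \<forall>w\<in>lists S. word_prod G v = word_prod G w \<longleftrightarrow> coxeter_cong S m v w))"

definition coxeter_length :: "('g, 'b) monoid_scheme \<Rightarrow> 'g set \<Rightarrow> 'g \<Rightarrow> nat" where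
  "coxeter_length G S x = (LEAST k. \<exists>ws\<in>lists S. length ws = k \<and> word_prod G ws = x)"

definition reduced_word :: "('g, 'b) monoid_scheme \<Rightarrow> 'g set \<Rightarrow> 'g \<Rightarrow> 'g list \<Rightarrow> bool" where
  "reduced_word G S x ws \<longleftrightarrow>
     ws \<in> lists S \<and> word_prod G ws = x \<and> length ws = coxeter_length G S x"

text \<open>
  By the subword property the relation does not depend on the reduced word of \<open>w\<close>
  in which the subword is sought.
\<close>

definition bruhat_order :: "('g, 'b) monoid_scheme \<Rightarrow> 'g set \<Rightarrow> 'g rel" where
  "bruhat_order G S =
     {(v, w). v \<in> carrier G \<and> w \<in> carrier G \<and>
        (\<exists>ws vs. reduced_word G S w ws \<and> subseq vs ws \<and> reduced_word G S v vs)}"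

definition bruhat_interval :: "('g, 'b) monoid_scheme \<Rightarrow> 'g set \<Rightarrow> 'g \<Rightarrow> 'g \<Rightarrow> 'g rel" where
  "bruhat_interval G S x y =
     Restr (bruhat_order G S) {z. (x, z) \<in> bruhat_order G S \<and> (z, y) \<in> bruhat_order G S}"

section \<open>The free algebra on two non-commuting variables\<close>

text \<open>
  \<open>\<rat>\<langle>a, b\<rangle>\<close> is the monoid algebra of the free monoid of words. The monoid of
  exponents in \<open>poly_mapping\<close> is written additively, so concatenation becomes \<open>+\<close>.
\<close>

instantiation list :: (type) monoid_add
begin

definition zero_list :: "'a list" where "zero_list = []"

definition plus_list :: "'a list \<Rightarrow> 'a list \<Rightarrow> 'a list" where "plus_list xs ys = xs @ ys"

instance by standard (simp_all add: zero_list_def plus_list_def)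

end

datatype ab_letter = Letter_a | Letter_b

type_synonym ab_poly = "ab_letter list \<Rightarrow>\<^sub>0 rat"

definition scale_ab :: "rat \<Rightarrow> ab_poly \<Rightarrow> ab_poly" where
  "scale_ab q p = Poly_Mapping.map ((*) q) p"

definition var_a :: ab_poly where "var_a = Poly_Mapping.single [Letter_a] 1"

definition var_b :: ab_poly where "var_b = Poly_Mapping.single [Letter_b] 1"

definition rat_affine_span :: "ab_poly set \<Rightarrow> ab_poly set" where
  "rat_affine_span X =
     {(\<Sum>p\<in>F. scale_ab (k p) p) | F k. finite F \<and> F \<subseteq> X \<and> (\<Sum>p\<in>F. k p) = 1}"

section \<open>The cd-index\<close>

text \<open>
  A poset is given by its reflexive order relation \<open>r\<close>, with underlying set \<open>Field r\<close>.
  In a finite graded poset with a minimum, the rank of \<open>z\<close> is the length of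
  a longest chain of elements below or equal to \<open>z\<close>.
\<close>

definition poset_rank :: "'p rel \<Rightarrow> nat" where
  "poset_rank r = Max ((\<lambda>C. card C - 1) ` Chains r)"

definition element_rank :: "'p rel \<Rightarrow> 'p \<Rightarrow> nat" where
  "element_rank r z = poset_rank (Restr r (under r z))"

text \<open>The underlying set without its minimum and its maximum.\<close>

definition proper_part :: "'p rel \<Rightarrow> 'p set" where
  "proper_part r = {z \<in> Field r. (\<exists>y\<in>Field r. (z, y) \<notin> r) \<and> (\<exists>y\<in>Field r. (y, z) \<notin> r)}"

definition flag_f :: "'p rel \<Rightarrow> nat set \<Rightarrow> nat" where
  "flag_f r S = card {C \<in> Chains r. C \<subseteq> proper_part r \<and> element_rank r ` C = S}"

definition flag_h :: "'p rel \<Rightarrow> nat set \<Rightarrow> int" where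
  "flag_h r S = (\<Sum>T\<in>Pow S. (- 1) ^ card (S - T) * int (flag_f r T))"

definition ab_word :: "nat \<Rightarrow> nat set \<Rightarrow> ab_letter list" where
  "ab_word m S = map (\<lambda>i. if i \<in> S then Letter_b else Letter_a) [1..<Suc m]"

text \<open>
  This is \<open>\<Psi>\<close> as an element of \<open>\<rat>\<langle>a, b\<rangle>\<close>. For an Eulerian poset it lies in
  the subalgebra generated by \<open>var_c\<close> and \<open>var_d\<close> below, and is then called the cd-index.
\<close>

definition cd_index :: "'p rel \<Rightarrow> ab_poly" where
  "cd_index r =
     (let m = poset_rank r - 1
      in \<Sum>S\<in>Pow {1..m}. Poly_Mapping.single (ab_word m S) (of_int (flag_h r S)))"

definition var_c :: ab_poly where "var_c = var_a + var_b"

definition var_d :: ab_poly where "var_d = var_a * var_b + var_b * var_a"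

datatype cd_letter = Letter_c | Letter_d

fun cd_value :: "cd_letter \<Rightarrow> ab_poly" where
  "cd_value Letter_c = var_c"
| "cd_value Letter_d = var_d"

fun cd_letter_degree :: "cd_letter \<Rightarrow> nat" where
  "cd_letter_degree Letter_c = 1"
| "cd_letter_degree Letter_d = 2"

definition cd_degree :: "cd_letter list \<Rightarrow> nat" where
  "cd_degree w = sum_list (map cd_letter_degree w)"

definition cd_monomial :: "cd_letter list \<Rightarrow> ab_poly" where
  "cd_monomial w = prod_list (map cd_value w)"

text \<open>
  \<open>k w\<close> is the coefficient of the cd-monomial \<open>w\<close>; it is determined by the element,
  since \<open>var_c\<close> and \<open>var_d\<close> are algebraically free.
\<close>

definition monic_cd_polys :: "nat \<Rightarrow> ab_poly set" where
  "monic_cd_polys m =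
     {(\<Sum>w | cd_degree w = m. scale_ab (k w) (cd_monomial w)) | k.
        k (replicate m Letter_c) = 1}"

end

theory Submission
  imports Defs
begin

text \<open>
  Let \<open>e = a - b\<close>. Expanding every \<open>e\<close> in a word turns flag numbers \<open>\<alpha>\<close> into the alternating
  sums \<open>\<beta>\<close>, so \<open>\<Psi>\<close> of an interval \<open>[x, y]\<close> is the sum, over all chains strictly between \<open>x\<close> and
  \<open>y\<close>, of the word with \<open>b\<close> at the ranks that the chain meets and \<open>e\<close> at the others. This sum is
  \<open>psi\<close> below, and splitting off the least element of a chain gives the recursion \<open>psi_rec\<close>, on
  which everything rests. Write \<open>\<rho>\<close> for differences of rank.

  \<^bold>\<open>Every Bruhat interval lies in the affine space.\<close> Substituting \<open>2 b = c - e\<close> in \<open>psi_rec\<close> gives a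
  relation between the \<open>\<Psi>\<close> of the upper intervals \<open>[z, y]\<close>. In an Eulerian poset, multiplying it by
  \<open>(-e)^\<rho>(x,z)\<close> and summing over \<open>z\<close> collapses the double sums, and the result has \<open>-e\<close> in place of
  \<open>e\<close>. Adding the two relations leaves even powers of \<open>e\<close> only, and \<open>e\<^sup>2 = c\<^sup>2 - 2 d\<close>; by induction \<open>\<Psi>\<close>
  is a cd-polynomial (\<open>psi_in_cd_space\<close>). It is monic because \<open>c^m\<close> is the only cd-monomial that
  involves \<open>a^m\<close>, whose coefficient in \<open>\<Psi>\<close> is \<open>1\<close>. That Bruhat intervals are graded and Eulerian
  (\<open>bruhat_cover\<close>, \<open>bruhat_eulerian\<close>) follows from the lifting property by pairing \<open>z\<close> with \<open>s z\<close>.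
  Lifting comes from the subword property, that from strong exchange, and strong exchange from
  the fact that the defining relations preserve the parity with which a reflection occurs in the
  reflection sequence of a word (\<open>cong_rcount_parity\<close>).

  \<^bold>\<open>The lower intervals of the universal Coxeter group span.\<close> In the group with infinitely many
  generators and no relations besides \<open>s\<^sup>2 = 1\<close>, elements are words without equal neighbours and the
  Bruhat order is the subword order. Let the letter \<open>s\<close> not occur in \<open>w\<close>. Then \<open>[1, s w]\<close> is the
  product of \<open>[1, w]\<close> with a two-element chain, and its \<open>\<Psi>\<close> arises from that of \<open>[1, w]\<close> by a linear
  operator \<open>pyr\<close> with \<open>pyr (c q) = c pyr q + d q\<close> and \<open>pyr (d q) = d pyr q + c d q\<close>
  (\<open>Theta_Cons\<close>). The interval \<open>[1, s w s]\<close> is almost the product of \<open>[1, w]\<close> with a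
  Boolean algebra of rank two, the difference being that the copies \<open>s 1\<close>, \<open>1 s\<close> and \<open>s 1 s\<close> of the
  bottom are merged into the single element \<open>s\<close>; its \<open>\<Psi>\<close> is \<open>pyr (pyr \<Psi>) - d \<Psi>\<close>
  (\<open>Theta_both_ends\<close>). Hence the linear spans of these cd-indices, degree by degree,
  absorb both \<open>pyr\<close> and left multiplication by \<open>d\<close>, and a family of spaces that does so contains
  all cd-polynomials: a word starting with \<open>c^(k+1) d\<close> is the \<open>pyr\<close> of one starting with \<open>c^k d\<close>, up to
  words with fewer leading \<open>c\<close> (\<open>cd_space_absorbed\<close>). Finally, a linear combination of monic
  polynomials that is itself monic has coefficients that add up to \<open>1\<close>, so that the linear span
  determines the affine span (\<open>rat_affine_span_eq_monic\<close>).
\<close>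

section \<open>The free algebra and its cd-subspaces\<close>

lemma lookup_scale_ab [simp]:
  "Poly_Mapping.lookup (scale_ab q p) w = q * Poly_Mapping.lookup p w"
  unfolding scale_ab_def by transfer (simp add: when_def)

lemma scale_ab_conv_mult: "scale_ab q p = Poly_Mapping.single 0 q * p"
  unfolding scale_ab_def by (rule mult_map_scale_conv_mult)

interpretation ab: vector_space scale_ab
  by standard
    (simp_all add: poly_mapping_eq_iff fun_eq_iff lookup_add algebra_simps)

lemma ab_poly_induct [case_names zero step]:
  assumes "P 0" and "\<And>w q p. P p \<Longrightarrow> P (Poly_Mapping.single w q + p)"
  shows "P (p :: ab_poly)"
proof (induction p rule: update_induct)
  case const
  show ?case using assms(1) by simp
next
  case (update f a b)
  have "Poly_Mapping.update a b f = Poly_Mapping.single a b + f"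
    using update(1)
    by (auto simp: poly_mapping_eq_iff fun_eq_iff lookup_update lookup_add lookup_single in_keys_iff when_def)
  then show ?case using assms(2) update by simp
qed

lemma scale_ab_single [simp]:
  "scale_ab r (Poly_Mapping.single w q) = Poly_Mapping.single w (r * q)"
  by (auto simp: poly_mapping_eq_iff fun_eq_iff lookup_single when_def)

lemma scale_ab_mult_left: "scale_ab q (p * r) = scale_ab q p * r"
  by (simp add: scale_ab_conv_mult mult.assoc)

text \<open>
  Scalars are multiples of the empty word, which is central although the algebra is not
  commutative.
\<close>

lemma scale_ab_mult_right: "scale_ab q (p * r) = p * scale_ab q r"
proof -
  have "Poly_Mapping.single 0 q * p = p * Poly_Mapping.single 0 q" for p :: ab_poly
  proof (induction p rule: ab_poly_induct)
    case (step w x p)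
    then show ?case by (simp add: distrib_left distrib_right mult_single mult.commute)
  qed simp
  then show ?thesis by (metis mult.assoc scale_ab_conv_mult)
qed

lemma letter_mult_single:
  "var_a * Poly_Mapping.single w q = Poly_Mapping.single (Letter_a # w) q"
  "var_b * Poly_Mapping.single w q = Poly_Mapping.single (Letter_b # w) q"
  "Poly_Mapping.single w q * var_b = Poly_Mapping.single (w @ [Letter_b]) q"
  by (simp_all add: var_a_def var_b_def mult_single plus_list_def)

lemma lookup_letter_mult [simp]:
  "Poly_Mapping.lookup (var_a * p) (Letter_a # w) = Poly_Mapping.lookup p w"
  "Poly_Mapping.lookup (var_b * p) (Letter_a # w) = 0"
  "Poly_Mapping.lookup (p * var_b) (w @ [Letter_b]) = Poly_Mapping.lookup p w"
  by (induction p rule: ab_poly_induct)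
    (simp_all add: distrib_left distrib_right lookup_add letter_mult_single lookup_single)

lemma mult_var_b_cancel: "p * var_b = q * var_b \<longleftrightarrow> p = q"
  by (metis lookup_letter_mult(3) poly_mapping_eqI)

lemma lookup_one_Nil [simp]: "Poly_Mapping.lookup (1 :: ab_poly) [] = 1"
  by (metis lookup_one_zero zero_list_def)

text \<open>
  The letter that marks ranks missed by a chain: its square is a cd-polynomial, although \<open>e\<close>
  itself is not.
\<close>

definition var_e :: ab_poly where "var_e = var_a - var_b"

lemma var_e_sq: "var_e * var_e = var_c * var_c - scale_ab 2 var_d"
proof -
  have "scale_ab 2 var_d = var_d + var_d"
    by (simp add: poly_mapping_eq_iff fun_eq_iff lookup_add)
  then show ?thesis
    by (simp add: var_e_def var_c_def var_d_def algebra_simps)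
qed

definition cd_space :: "nat \<Rightarrow> ab_poly set" where
  "cd_space m = ab.span (cd_monomial ` {w. cd_degree w = m})"

lemma cd_monomial_simps [simp]:
  "cd_monomial [] = 1" "cd_monomial (x # w) = cd_value x * cd_monomial w"
  "cd_degree [] = 0" "cd_degree (x # w) = cd_letter_degree x + cd_degree w"
  by (simp_all add: cd_monomial_def cd_degree_def)

lemma cd_monomial_append: "cd_monomial (u @ v) = cd_monomial u * cd_monomial v"
  by (induction u) (simp_all add: mult.assoc)

lemma cd_degree_append: "cd_degree (u @ v) = cd_degree u + cd_degree v"
  by (induction u) simp_all

lemma cd_monomial_in_cd_space: "cd_degree w = m \<Longrightarrow> cd_monomial w \<in> cd_space m"
  unfolding cd_space_def by (rule ab.span_base) auto

lemma subspace_cd_space: "ab.subspace (cd_space m)"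
  unfolding cd_space_def by (rule ab.subspace_span)

lemmas cd_space_add = ab.subspace_add[OF subspace_cd_space]
  and cd_space_scale = ab.subspace_scale[OF subspace_cd_space]
  and cd_space_sum = ab.subspace_sum[OF subspace_cd_space]
  and cd_space_diff = ab.subspace_diff[OF subspace_cd_space]
  and cd_space_zero = ab.subspace_0[OF subspace_cd_space]

lemma cd_space_induct [consumes 1, case_names zero add scale monomial]:
  assumes "p \<in> cd_space m" "P 0" "\<And>p q. P p \<Longrightarrow> P q \<Longrightarrow> P (p + q)"
    "\<And>r p. P p \<Longrightarrow> P (scale_ab r p)" "\<And>w. cd_degree w = m \<Longrightarrow> P (cd_monomial w)"
  shows "P p"
  using assms(1) unfolding cd_space_def
proof (induction rule: ab.span_induct_alt)
  case base
  then show ?case using assms(2) by simp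
next
  case (step c x y)
  then show ?case using assms(3-5) by auto
qed

lemma cd_space_mult:
  assumes "p \<in> cd_space i" "q \<in> cd_space j" shows "p * q \<in> cd_space (i + j)"
  using assms(1)
proof (induction rule: cd_space_induct)
  case (monomial u)
  show ?case using assms(2)
  proof (induction rule: cd_space_induct)
    case (monomial v)
    with \<open>cd_degree u = i\<close> show ?case
      by (metis cd_degree_append cd_monomial_append cd_monomial_in_cd_space)
  qed (simp_all add: distrib_left cd_space_add cd_space_scale cd_space_zero
      flip: scale_ab_mult_right)
qed (simp_all add: distrib_right cd_space_add cd_space_scale cd_space_zero
      flip: scale_ab_mult_left)

lemma one_in_cd_space: "1 \<in> cd_space 0"
  using cd_monomial_in_cd_space[of "[]"] by simp

lemma var_c_in_cd_space: "var_c \<in> cd_space 1"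
  using cd_monomial_in_cd_space[of "[Letter_c]"] by simp

lemma var_d_in_cd_space: "var_d \<in> cd_space 2"
  using cd_monomial_in_cd_space[of "[Letter_d]"] by simp

lemma var_e_even_power_in_cd_space: "even k \<Longrightarrow> var_e ^ k \<in> cd_space k"
proof (induction k rule: less_induct)
  case (less k)
  show ?case
  proof (cases "k = 0")
    case True then show ?thesis by (simp add: one_in_cd_space)
  next
    case False
    then obtain j where k: "k = Suc (Suc j)" "even j"
      using less.prems by (cases k; cases "k - 1") auto
    have "var_c * var_c \<in> cd_space 2"
      using cd_space_mult[OF var_c_in_cd_space var_c_in_cd_space] by (simp add: numeral_2_eq_2)
    then have "var_e * var_e \<in> cd_space 2"
      unfolding var_e_sq by (intro cd_space_diff cd_space_scale var_d_in_cd_space)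
    then have "(var_e * var_e) * var_e ^ j \<in> cd_space (2 + j)"
      by (rule cd_space_mult) (use less.IH[of j] k in simp)
    then show ?thesis by (simp add: k mult.assoc)
  qed
qed

subsection \<open>Monic cd-polynomials and affine spans\<close>

abbreviation lead :: "nat \<Rightarrow> ab_poly \<Rightarrow> rat" where
  "lead m p \<equiv> Poly_Mapping.lookup p (replicate m Letter_a)"

lemma finite_cd_degree: "finite {w. cd_degree w = m}"
proof (rule finite_subset)
  have "length w \<le> cd_degree w" for w
  proof (induction w)
    case (Cons x w) then show ?case by (cases x) auto
  qed simp
  then show "{w. cd_degree w = m} \<subseteq> {w. set w \<subseteq> {Letter_c, Letter_d} \<and> length w \<le> m}"
    using cd_letter.exhaust by auto
qed (simp add: finite_lists_length_le)

text \<open>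
  The word \<open>a^m\<close> occurs in a product of factors \<open>c = a + b\<close> exactly once, and any factor
  \<open>d = a b + b a\<close> forces a \<open>b\<close>.
\<close>

lemma lead_cd_monomial:
  "cd_degree w = m \<Longrightarrow> lead m (cd_monomial w) = (if w = replicate m Letter_c then 1 else 0)"
proof (induction w arbitrary: m)
  case (Cons x w)
  show ?case
  proof (cases x)
    case Letter_c
    with Cons.prems obtain k where m: "m = Suc k" "cd_degree w = k" by auto
    show ?thesis using Cons.IH[OF m(2)] Letter_c m(1)
      by (simp add: var_c_def distrib_right lookup_add)
  next
    case Letter_d
    with Cons.prems obtain k where m: "m = Suc (Suc k)" by auto
    show ?thesis using Letter_d m
      by (simp add: var_d_def distrib_right lookup_add mult.assoc)
  qed
qed auto

text \<open>
  In a linear combination of cd-monomials, the coefficient of \<open>c^m\<close> is the coefficient of the word \<open>a^m\<close>.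
\<close>

lemma monic_cd_polys_conv: "monic_cd_polys m = {p \<in> cd_space m. lead m p = 1}"
proof -
  let ?W = "{w. cd_degree w = m}"
  let ?f = "\<lambda>k. \<Sum>w\<in>?W. scale_ab (k w) (cd_monomial w)"
  have repl: "cd_degree (replicate m Letter_c) = m"
    by (induction m) auto
  have lead: "lead m (?f k) = k (replicate m Letter_c)" for k
  proof -
    have "lead m (?f k) = (\<Sum>w\<in>?W. if w = replicate m Letter_c then k w else 0)"
      unfolding lookup_sum by (rule sum.cong) (simp_all add: lead_cd_monomial)
    also have "\<dots> = k (replicate m Letter_c)"
      using repl by (simp add: finite_cd_degree)
    finally show ?thesis .
  qed
  have mem: "?f k \<in> cd_space m" for k
    by (intro cd_space_sum cd_space_scale cd_monomial_in_cd_space) simp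
  have ex: "\<exists>k. p = ?f k" if "p \<in> cd_space m" for p
    using that
  proof (induction rule: cd_space_induct)
    case zero
    show ?case by (rule exI[of _ "\<lambda>_. 0"]) simp
  next
    case (add p q)
    then obtain k l where "p = ?f k" "q = ?f l" by blast
    then have "p + q = ?f (\<lambda>w. k w + l w)"
      by (simp add: ab.scale_left_distrib sum.distrib)
    then show ?case by (intro exI[of _ "\<lambda>w. k w + l w"])
  next
    case (scale r p)
    then obtain k where "p = ?f k" by blast
    then have "scale_ab r p = ?f (\<lambda>w. r * k w)"
      by (simp add: ab.scale_sum_right)
    then show ?case by (intro exI[of _ "\<lambda>w. r * k w"])
  next
    case (monomial w)
    then have "cd_monomial w = ?f (\<lambda>v. if v = w then 1 else 0)"
      by (simp add: if_distrib[of "\<lambda>x. scale_ab x _"] finite_cd_degree cong: if_cong)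
    then show ?case by (intro exI[of _ "\<lambda>v. if v = w then 1 else 0"])
  qed
  show ?thesis
  proof (intro equalityI subsetI)
    fix p assume "p \<in> monic_cd_polys m"
    then obtain k where "p = ?f k" "k (replicate m Letter_c) = 1"
      unfolding monic_cd_polys_def by auto
    then show "p \<in> {p \<in> cd_space m. lead m p = 1}" using lead[of k] mem[of k] by simp
  next
    fix p assume p: "p \<in> {p \<in> cd_space m. lead m p = 1}"
    then obtain k where k: "p = ?f k" using ex by blast
    then have "k (replicate m Letter_c) = 1" using lead[of k] p by simp
    then show "p \<in> monic_cd_polys m" unfolding monic_cd_polys_def k by blast
  qed
qed

text \<open>
  The coefficient of \<open>a^m\<close> is a linear functional that is constantly \<open>1\<close> on monic polynomials;
  applied to a linear combination it returns the sum of the coefficients.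
\<close>

lemma rat_affine_span_eq_monic:
  assumes "X \<subseteq> monic_cd_polys m" "cd_space m \<subseteq> ab.span X"
  shows "rat_affine_span X = monic_cd_polys m"
proof (intro equalityI subsetI)
  fix p assume "p \<in> rat_affine_span X"
  then obtain F k where F: "p = (\<Sum>x\<in>F. scale_ab (k x) x)" "finite F" "F \<subseteq> X" "sum k F = 1"
    unfolding rat_affine_span_def by auto
  have "x \<in> cd_space m" "lead m x = 1" if "x \<in> F" for x
    using that F(3) assms(1) by (auto simp: monic_cd_polys_conv)
  then show "p \<in> monic_cd_polys m"
    by (auto simp: monic_cd_polys_conv F(1,4) lookup_sum intro!: cd_space_sum cd_space_scale)
next
  fix p assume p: "p \<in> monic_cd_polys m"
  then have "p \<in> ab.span X" using assms(2) by (auto simp: monic_cd_polys_conv)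
  then obtain F k where F: "finite F" "F \<subseteq> X" "p = (\<Sum>x\<in>F. scale_ab (k x) x)"
    unfolding ab.span_explicit by auto
  have "lead m x = 1" if "x \<in> F" for x
    using that F(2) assms(1) by (auto simp: monic_cd_polys_conv)
  then have "sum k F = lead m p" by (simp add: F(3) lookup_sum)
  then show "p \<in> rat_affine_span X"
    using p F unfolding rat_affine_span_def by (auto simp: monic_cd_polys_conv)
qed

section \<open>The pyramid operator\<close>

text \<open>
  The linear operator by which the product with a two-element chain acts on \<open>\<Psi>\<close>. It is defined on
  the polynomials \<open>\<Psi> b\<close> instead of \<open>\<Psi>\<close>, where the top of an interval needs no separate treatment; this is
  why the empty word is sent to \<open>b\<close>, and then \<open>pyr b = c b\<close>. On a letter in front of a
  word it acts like the derivation with \<open>a \<mapsto> b a\<close> and \<open>b \<mapsto> a b\<close>.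
\<close>

fun pyr_word :: "ab_letter list \<Rightarrow> ab_poly" where
  "pyr_word [] = var_b"
| "pyr_word (Letter_a # w) = Poly_Mapping.single (Letter_b # Letter_a # w) 1 + var_a * pyr_word w"
| "pyr_word (Letter_b # w) = Poly_Mapping.single (Letter_a # Letter_b # w) 1 + var_b * pyr_word w"

definition pyr :: "ab_poly \<Rightarrow> ab_poly" where
  "pyr p = (\<Sum>w\<in>Poly_Mapping.keys p. scale_ab (Poly_Mapping.lookup p w) (pyr_word w))"

lemma pyr_superset:
  assumes "finite A" "Poly_Mapping.keys p \<subseteq> A"
  shows "pyr p = (\<Sum>w\<in>A. scale_ab (Poly_Mapping.lookup p w) (pyr_word w))"
  unfolding pyr_def using assms by (intro sum.mono_neutral_left) (auto simp: in_keys_iff)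

lemma pyr_add: "pyr (p + q) = pyr p + pyr q"
proof -
  let ?A = "Poly_Mapping.keys p \<union> Poly_Mapping.keys q"
  have "Poly_Mapping.keys (p + q) \<subseteq> ?A" by (rule keys_add)
  then show ?thesis
    by (simp add: pyr_superset[of ?A] lookup_add ab.scale_left_distrib sum.distrib)
qed

lemma pyr_single: "pyr (Poly_Mapping.single w q) = scale_ab q (pyr_word w)"
  by (subst pyr_superset[of "{w}"]) auto

lemma pyr_zero [simp]: "pyr 0 = 0"
  by (simp add: pyr_def)

lemma pyr_scale: "pyr (scale_ab r p) = scale_ab r (pyr p)"
  by (induction p rule: ab_poly_induct)
    (simp_all add: ab.scale_right_distrib pyr_add pyr_single)

lemma pyr_minus: "pyr (p - q) = pyr p - pyr q"
  by (metis pyr_add add_diff_cancel_right' diff_add_cancel)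

lemma pyr_sum: "pyr (sum f A) = (\<Sum>x\<in>A. pyr (f x))"
  by (induction A rule: infinite_finite_induct) (simp_all add: pyr_add)

lemma pyr_one: "pyr 1 = var_b"
proof -
  have "pyr 1 = pyr (Poly_Mapping.single [] 1)"
    by (metis single_one zero_list_def)
  then show ?thesis by (simp add: pyr_single)
qed

lemma pyr_var_a: "pyr (var_a * p) = var_b * var_a * p + var_a * pyr p"
  by (induction p rule: ab_poly_induct)
    (simp_all add: distrib_left letter_mult_single pyr_add pyr_single ab.scale_right_distrib
      scale_ab_mult_right mult.assoc)

lemma pyr_var_b: "pyr (var_b * p) = var_a * var_b * p + var_b * pyr p"
  by (induction p rule: ab_poly_induct)
    (simp_all add: distrib_left letter_mult_single pyr_add pyr_single ab.scale_right_distrib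
      scale_ab_mult_right mult.assoc)

lemma pyr_var_c: "pyr (var_c * p) = var_d * p + var_c * pyr p"
  by (simp add: var_c_def var_d_def distrib_right pyr_add pyr_var_a pyr_var_b)

lemma pyr_var_d: "pyr (var_d * p) = var_c * var_d * p + var_d * pyr p"
  by (simp add: var_c_def var_d_def algebra_simps pyr_add pyr_var_a pyr_var_b)

text \<open>
  The computation that makes \<open>pyr\<close> compatible with the recursion for \<open>\<Psi>\<close>: the summands of that
  recursion have the form \<open>e^j b p\<close>, and \<open>pyr\<close> reproduces them up to left multiplication by \<open>a\<close>.
\<close>

lemma pyr_e_power_b:
  "pyr (var_e ^ j * var_b * p) = var_a * (var_e ^ j * var_b * p) + var_e ^ j * var_b * pyr p"
proof (induction j)
  case 0
  show ?case by (simp add: pyr_var_b mult.assoc)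
next
  case (Suc j)
  let ?X = "var_e ^ j * var_b * p"
  have "pyr (var_e ^ Suc j * var_b * p) = pyr (var_a * ?X) - pyr (var_b * ?X)"
    by (simp add: var_e_def left_diff_distrib pyr_minus mult.assoc)
  also have "\<dots> = (var_b * var_a - var_a * var_b) * ?X + var_e * pyr ?X"
    by (simp add: pyr_var_a pyr_var_b var_e_def algebra_simps)
  also have "\<dots> = var_a * (var_e * ?X) + var_e * (var_e ^ j * var_b * pyr p)"
    unfolding Suc by (simp add: var_e_def algebra_simps)
  finally show ?case by (simp add: mult.assoc)
qed

lemma pyr_c_power:
  "pyr (var_c ^ k * p) = var_c ^ k * pyr p + (\<Sum>i<k. var_c ^ i * (var_d * (var_c ^ (k - Suc i) * p)))"
proof (induction k)
  case (Suc k)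
  have "pyr (var_c ^ Suc k * p) = var_d * (var_c ^ k * p) + var_c * pyr (var_c ^ k * p)"
    by (simp add: pyr_var_c mult.assoc)
  also have "var_c * pyr (var_c ^ k * p) = var_c ^ Suc k * pyr p
      + (\<Sum>i<k. var_c ^ Suc i * (var_d * (var_c ^ (k - Suc i) * p)))"
    unfolding Suc by (simp add: distrib_left sum_distrib_left mult.assoc)
  also have "var_d * (var_c ^ k * p) + (var_c ^ Suc k * pyr p
      + (\<Sum>i<k. var_c ^ Suc i * (var_d * (var_c ^ (k - Suc i) * p))))
    = var_c ^ Suc k * pyr p + (\<Sum>i<Suc k. var_c ^ i * (var_d * (var_c ^ (Suc k - Suc i) * p)))"
    unfolding sum.lessThan_Suc_shift by (simp add: algebra_simps)
  finally show ?case .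
qed simp

text \<open>
  Right multiplication by \<open>b\<close> in the statement reflects that \<open>pyr\<close> acts on polynomials \<open>\<Psi> b\<close>.
\<close>

lemma pyr_cd_space:
  assumes "p \<in> cd_space m"
  shows "\<exists>q\<in>cd_space (Suc m). pyr (p * var_b) = q * var_b"
  using assms
proof (induction rule: cd_space_induct)
  case zero
  show ?case by (rule bexI[of _ 0]) (simp_all add: cd_space_zero)
next
  case (add p q)
  then obtain p' q' where "p' \<in> cd_space (Suc m)" "pyr (p * var_b) = p' * var_b"
    "q' \<in> cd_space (Suc m)" "pyr (q * var_b) = q' * var_b" by blast
  then show ?case
    by (intro bexI[of _ "p' + q'"]) (simp_all add: distrib_right pyr_add cd_space_add)
next
  case (scale r p)
  then obtain p' where "p' \<in> cd_space (Suc m)" "pyr (p * var_b) = p' * var_b" by blast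
  then show ?case
    by (intro bexI[of _ "scale_ab r p'"]) (simp_all add: pyr_scale cd_space_scale flip: scale_ab_mult_left)
next
  case (monomial w)
  then show ?case
  proof (induction w arbitrary: m)
    case Nil
    then show ?case using pyr_var_b[of 1] var_c_in_cd_space
      by (intro bexI[of _ var_c]) (simp_all add: pyr_one var_c_def distrib_right)
  next
    case (Cons x w)
    then obtain q where q: "q \<in> cd_space (Suc (cd_degree w))" "pyr (cd_monomial w * var_b) = q * var_b"
      by blast
    have w: "cd_monomial w \<in> cd_space (cd_degree w)" by (simp add: cd_monomial_in_cd_space)
    show ?case
    proof (cases x)
      case Letter_c
      have "var_d * cd_monomial w + var_c * q \<in> cd_space (Suc m)"
        using cd_space_mult[OF var_d_in_cd_space w] cd_space_mult[OF var_c_in_cd_space q(1)] Cons.prems Letter_c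
        by (intro cd_space_add) auto
      then show ?thesis using Letter_c q(2)
        by (intro bexI) (auto simp: pyr_var_c mult.assoc distrib_right)
    next
      case Letter_d
      have "var_c * (var_d * cd_monomial w) + var_d * q \<in> cd_space (Suc m)"
        using cd_space_mult[OF var_c_in_cd_space cd_space_mult[OF var_d_in_cd_space w]]
          cd_space_mult[OF var_d_in_cd_space q(1)] Cons.prems Letter_d
        by (intro cd_space_add) auto
      then show ?thesis using Letter_d q(2)
        by (intro bexI) (auto simp: pyr_var_d mult.assoc distrib_right)
    qed
  qed
qed

lemma cd_monomial_leading_c:
  obtains k where "w = replicate k Letter_c"
  | k u where "w = replicate k Letter_c @ Letter_d # u"
proof (induction w arbitrary: thesis)
  case Nil
  then show ?case using Nil(1)[of 0] by simp
next
  case (Cons x w)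
  show ?case
  proof (cases x)
    case Letter_d
    then show ?thesis using Cons.prems(2)[of 0 w] by simp
  next
    case Letter_c
    show ?thesis
    proof (rule Cons.IH)
      fix k assume "w = replicate k Letter_c"
      then show thesis using Cons.prems(1)[of "Suc k"] Letter_c by simp
    next
      fix k u assume "w = replicate k Letter_c @ Letter_d # u"
      then show thesis using Cons.prems(2)[of "Suc k" u] Letter_c by simp
    qed
  qed
qed

lemma cd_monomial_replicate: "cd_monomial (replicate k Letter_c) = var_c ^ k"
  "cd_degree (replicate k Letter_c) = k"
  by (induction k) simp_all

lemma c_power_in_cd_space: "var_c ^ k \<in> cd_space k"
  by (metis cd_monomial_replicate cd_monomial_in_cd_space)

text \<open>
  Triangularity in the number of leading factors \<open>c\<close>. Monomials that start with \<open>d\<close> are covered by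
  the hypothesis on \<open>d\<close>. By \<open>pyr_c_power\<close>, \<open>pyr\<close> maps \<open>c^l d q b\<close> to \<open>c^(l+1) d q b\<close> plus terms that
  have at most \<open>l\<close> leading factors \<open>c\<close> followed by \<open>d\<close>, and it maps \<open>c^l b\<close> to \<open>c^(l+1) b\<close> plus such
  terms.
\<close>

lemma cd_space_absorbed:
  assumes sub: "\<And>m. ab.subspace (U m)"
    and base: "var_b \<in> U 0"
    and pyrU: "\<And>m p. p \<in> U m \<Longrightarrow> pyr p \<in> U (Suc m)"
    and dU: "\<And>m p. p \<in> U m \<Longrightarrow> var_d * p \<in> U (Suc (Suc m))"
  shows "p \<in> cd_space m \<Longrightarrow> p * var_b \<in> U m"
proof (induction m arbitrary: p rule: less_induct)
  case (less m)
  note IH = less.IH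
  have cd: "var_c ^ k * (var_d * (q * var_b)) \<in> U m"
    if "m = k + Suc (Suc j)" "q \<in> cd_space j" for k j q
    using that
  proof (induction k arbitrary: j q rule: less_induct)
    case (less k)
    note inner = less.IH and k = less.prems
    show ?case
    proof (cases k)
      case 0
      then show ?thesis using dU[OF IH[of j q]] k by simp
    next
      case (Suc l)
      obtain q' where q': "q' \<in> cd_space (Suc j)" "pyr (q * var_b) = q' * var_b"
        using pyr_cd_space k(2) by blast
      have dq: "var_d * q \<in> cd_space (Suc (Suc j))"
        using cd_space_mult[OF var_d_in_cd_space k(2)] by simp
      have mem: "var_c ^ l * (var_d * q) \<in> cd_space (l + Suc (Suc j))"
        by (rule cd_space_mult[OF c_power_in_cd_space dq])
      have "pyr ((var_c ^ l * (var_d * q)) * var_b) \<in> U (Suc (l + Suc (Suc j)))"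
        by (rule pyrU, rule IH) (use k Suc mem in auto)
      then have 1: "pyr (var_c ^ l * (var_d * (q * var_b))) \<in> U m"
        using k Suc by (simp add: mult.assoc)
      have 2: "var_c ^ l * (var_d * (q' * var_b)) \<in> U m"
        by (rule inner[of l "Suc j"]) (use k Suc q' in auto)
      have 3: "var_c ^ i * (var_d * (var_c ^ (l - Suc i) * (var_d * (q * var_b)))) \<in> U m"
        if "i < l" for i
      proof -
        have "var_c ^ i * (var_d * ((var_c ^ (l - Suc i) * (var_d * q)) * var_b)) \<in> U m"
          by (rule inner[OF _ _ cd_space_mult[OF c_power_in_cd_space dq]])
            (use that k Suc in auto)
        then show ?thesis by (simp add: mult.assoc)
      qed
      \<comment> \<open>solve \<open>pyr (c^l d q b) = c^l (c d q + d q') b + \<dots>\<close> for the term with \<open>k = l + 1\<close> factors \<open>c\<close>\<close>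
      have "var_c ^ k * (var_d * (q * var_b)) = pyr (var_c ^ l * (var_d * (q * var_b)))
          - var_c ^ l * (var_d * (q' * var_b))
          - (\<Sum>i<l. var_c ^ i * (var_d * (var_c ^ (l - Suc i) * (var_d * (q * var_b)))))"
        unfolding pyr_c_power pyr_var_d q'(2) Suc
        by (simp add: distrib_left mult.assoc power_Suc2 del: power_Suc)
      then show ?thesis
        using 1 2 3 ab.subspace_diff[OF sub] ab.subspace_sum[OF sub] by (metis (no_types, lifting) lessThan_iff)
    qed
  qed
  have cpow: "var_c ^ m * var_b \<in> U m"
  proof (cases m)
    case 0
    then show ?thesis using base by simp
  next
    case (Suc l)
    have 1: "pyr (var_c ^ l * var_b) \<in> U m"
      unfolding Suc by (rule pyrU, rule less.IH) (simp_all add: Suc c_power_in_cd_space)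
    have 2: "var_c ^ i * (var_d * (var_c ^ (l - Suc i) * var_b)) \<in> U m" if "i < l" for i
      by (rule cd[of i "l - Suc i"]) (use that Suc c_power_in_cd_space in auto)
    have "pyr var_b = var_c * var_b"
      using pyr_var_b[of 1] by (simp add: pyr_one var_c_def distrib_right)
    then have "var_c ^ m * var_b = pyr (var_c ^ l * var_b)
        - (\<Sum>i<l. var_c ^ i * (var_d * (var_c ^ (l - Suc i) * var_b)))"
      unfolding pyr_c_power Suc by (simp add: mult.assoc power_Suc2 del: power_Suc)
    then show ?thesis
      using 1 2 ab.subspace_diff[OF sub] ab.subspace_sum[OF sub] by (metis (no_types, lifting) lessThan_iff)
  qed
  show ?case using less.prems
  proof (induction rule: cd_space_induct)
    case (monomial w)
    show ?case
    proof (rule cd_monomial_leading_c[of w])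
      fix k assume "w = replicate k Letter_c"
      then show ?thesis using cpow monomial by (simp add: cd_monomial_replicate)
    next
      fix k u assume w: "w = replicate k Letter_c @ Letter_d # u"
      then have "m = k + Suc (Suc (cd_degree u))"
        using monomial by (simp add: cd_degree_append cd_monomial_replicate)
      from cd[OF this, of "cd_monomial u"] show ?thesis
        by (simp add: w cd_monomial_append cd_monomial_replicate cd_monomial_in_cd_space mult.assoc)
    qed
  qed (simp_all add: distrib_right ab.subspace_add[OF sub] ab.subspace_scale[OF sub]
      ab.subspace_0[OF sub] flip: scale_ab_mult_left)
qed

section \<open>Chain polynomials of ranked posets\<close>

text \<open>
  The weight of a chain that meets the set \<open>T\<close> of ranks; only the ranks strictly between \<open>i\<close> and \<open>j\<close>
  contribute a letter.
\<close>

definition rank_word :: "nat \<Rightarrow> nat \<Rightarrow> nat set \<Rightarrow> ab_poly" where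
  "rank_word i j T = prod_list (map (\<lambda>k. if k \<in> T then var_b else var_e) [Suc i..<j])"

definition between :: "'p rel \<Rightarrow> 'p \<Rightarrow> 'p \<Rightarrow> 'p set" where
  "between r x y = {z. (x, z) \<in> r \<and> (z, y) \<in> r \<and> z \<noteq> x \<and> z \<noteq> y}"

definition chains_between :: "'p rel \<Rightarrow> 'p \<Rightarrow> 'p \<Rightarrow> 'p set set" where
  "chains_between r x y = {C \<in> Chains r. C \<subseteq> between r x y}"

definition psi :: "'p rel \<Rightarrow> ('p \<Rightarrow> nat) \<Rightarrow> 'p \<Rightarrow> 'p \<Rightarrow> ab_poly" where
  "psi r rk x y = (\<Sum>C\<in>chains_between r x y. rank_word (rk x) (rk y) (rk ` C))"

lemma rank_word_empty: "rank_word i j {} = var_e ^ (j - Suc i)"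
proof -
  have "prod_list (map (\<lambda>k. var_e) xs) = var_e ^ length xs" for xs :: "nat list"
    by (induction xs) simp_all
  then show ?thesis by (simp add: rank_word_def)
qed

lemma rank_word_insert:
  assumes "i < k" "k < j" "\<And>t. t \<in> T \<Longrightarrow> k < t"
  shows "rank_word i j (insert k T) = var_e ^ (k - Suc i) * var_b * rank_word k j T"
proof -
  let ?f = "\<lambda>l. if l \<in> insert k T then var_b else var_e"
  have split: "[Suc i..<j] = [Suc i..<k] @ k # [Suc k..<j]"
    using assms(1,2) by (metis Suc_leI le_add_diff_inverse less_imp_le_nat upt_add_eq_append upt_conv_Cons)
  have low: "map ?f [Suc i..<k] = map (\<lambda>l. if l \<in> {} then var_b else var_e) [Suc i..<k]"
    using assms(3) by (intro map_cong) (auto dest: assms(3))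
  have high: "map ?f [Suc k..<j] = map (\<lambda>l. if l \<in> T then var_b else var_e) [Suc k..<j]"
    by (intro map_cong) auto
  have "rank_word i j (insert k T)
      = prod_list (map ?f [Suc i..<k]) * (?f k * prod_list (map ?f [Suc k..<j]))"
    unfolding rank_word_def split map_append list.map prod_list.append prod_list.Cons ..
  also have "\<dots> = rank_word i k {} * (var_b * rank_word k j T)"
    unfolding low high rank_word_def by simp
  finally have "rank_word i j (insert k T) = rank_word i k {} * (var_b * rank_word k j T)" .
  then show ?thesis by (simp add: rank_word_empty mult.assoc)
qed

locale ranked_poset =
  fixes r :: "'p rel" and rk :: "'p \<Rightarrow> nat"
  assumes trans_r: "trans r"
    and refl_left: "(x, y) \<in> r \<Longrightarrow> (x, x) \<in> r"
    and refl_right: "(x, y) \<in> r \<Longrightarrow> (y, y) \<in> r"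
    and rank_less: "(x, y) \<in> r \<Longrightarrow> x \<noteq> y \<Longrightarrow> rk x < rk y"
    and finite_interval: "finite {z. (x, z) \<in> r \<and> (z, y) \<in> r}"
begin

lemma r_trans: "(x, y) \<in> r \<Longrightarrow> (y, z) \<in> r \<Longrightarrow> (x, z) \<in> r"
  using trans_r by (rule transD)

lemma rank_le: "(x, y) \<in> r \<Longrightarrow> rk x \<le> rk y"
  using rank_less by (cases "x = y") (auto intro: less_imp_le)

lemma r_antisym: "(x, y) \<in> r \<Longrightarrow> (y, x) \<in> r \<Longrightarrow> x = y"
  using rank_less by (metis not_less_iff_gr_or_eq)

lemma finite_between: "finite (between r x y)"
  by (rule finite_subset[OF _ finite_interval[of x y]]) (auto simp: between_def)

lemma between_rank: "z \<in> between r x y \<Longrightarrow> rk x < rk z \<and> rk z < rk y"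
  unfolding between_def using rank_less by auto

lemma finite_chains_between: "finite (chains_between r x y)"
  by (rule finite_subset[of _ "Pow (between r x y)"]) (auto simp: chains_between_def finite_between)

text \<open>
  A nonempty chain is its element of least rank together with a chain above that element.
\<close>

lemma chains_between_decomp:
  "bij_betw (\<lambda>(z, C). insert z C) (SIGMA z : between r x y. chains_between r z y)
     (chains_between r x y - {{}})"
  unfolding bij_betw_def
proof (intro conjI)
  show "inj_on (\<lambda>(z, C). insert z C) (SIGMA z : between r x y. chains_between r z y)"
  proof (rule inj_onI, clarsimp)
    fix z C w D
    assume C: "C \<in> chains_between r z y" and D: "D \<in> chains_between r w y"
      and eq: "insert z C = insert w D"
    have rC: "rk z < rk u" if "u \<in> C" for u
      using that C between_rank unfolding chains_between_def by blast
    have rD: "rk w < rk u" if "u \<in> D" for u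
      using that D between_rank unfolding chains_between_def by blast
    have "z = w"
    proof (rule ccontr)
      assume "z \<noteq> w"
      then have "z \<in> D" "w \<in> C" using eq by auto
      then show False using rC rD less_asym by blast
    qed
    moreover have "z \<notin> C" "w \<notin> D" using rC rD by auto
    ultimately show "z = w \<and> C = D" using eq by (metis insert_ident)
  qed
  show "(\<lambda>(z, C). insert z C) ` (SIGMA z : between r x y. chains_between r z y)
      = chains_between r x y - {{}}"
  proof (intro equalityI subsetI)
    fix D assume "D \<in> (\<lambda>(z, C). insert z C) ` (SIGMA z : between r x y. chains_between r z y)"
    then obtain z C where D: "D = insert z C" and z: "z \<in> between r x y"
      and C: "C \<in> Chains r" "C \<subseteq> between r z y"
      by (auto simp: chains_between_def)
    have "C \<subseteq> between r x y"
    proof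
      fix u assume "u \<in> C"
      then have "u \<in> between r z y" using C by auto
      then show "u \<in> between r x y"
        using z r_trans[of x z u] between_rank[of z x y] between_rank[of u z y]
        by (auto simp: between_def)
    qed
    moreover have "insert z C \<in> Chains r"
      using C z refl_right[of x z] unfolding Chains_def between_def by blast
    ultimately show "D \<in> chains_between r x y - {{}}"
      using z by (auto simp: D chains_between_def)
  next
    fix D assume "D \<in> chains_between r x y - {{}}"
    then have D: "D \<in> Chains r" "D \<subseteq> between r x y" "D \<noteq> {}" by (auto simp: chains_between_def)
    then obtain z where z: "z \<in> D" "\<And>u. u \<in> D \<Longrightarrow> rk z \<le> rk u"
      using ex_has_least_nat[of "\<lambda>z. z \<in> D" _ rk] by blast
    have "D - {z} \<subseteq> between r z y"
    proof
      fix u assume u: "u \<in> D - {z}"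
      then have "(z, u) \<in> r \<or> (u, z) \<in> r" using D(1) z(1) unfolding Chains_def by blast
      then have "(z, u) \<in> r" using rank_less[of u z] z(2)[of u] u by auto
      then show "u \<in> between r z y" using u D(2) by (auto simp: between_def)
    qed
    then have "D - {z} \<in> chains_between r z y"
      using D(1) unfolding chains_between_def Chains_def by blast
    moreover have "D = insert z (D - {z})" using z(1) by auto
    ultimately show "D \<in> (\<lambda>(z, C). insert z C) ` (SIGMA z : between r x y. chains_between r z y)"
      using z(1) D(2) by (intro image_eqI[where x = "(z, D - {z})"]) auto
  qed
qed

lemma psi_rec:
  "psi r rk x y = var_e ^ (rk y - Suc (rk x))
     + (\<Sum>z\<in>between r x y. var_e ^ (rk z - Suc (rk x)) * var_b * psi r rk z y)"
proof -
  have "{} \<in> chains_between r x y" by (simp add: chains_between_def Chains_def)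
  then have "psi r rk x y = rank_word (rk x) (rk y) {}
      + (\<Sum>C\<in>chains_between r x y - {{}}. rank_word (rk x) (rk y) (rk ` C))"
    unfolding psi_def using finite_chains_between[of x y] by (simp add: sum.remove)
  also have "(\<Sum>C\<in>chains_between r x y - {{}}. rank_word (rk x) (rk y) (rk ` C))
      = (\<Sum>(z, C)\<in>(SIGMA z : between r x y. chains_between r z y).
          rank_word (rk x) (rk y) (insert (rk z) (rk ` C)))"
    using sum.reindex_bij_betw[OF chains_between_decomp, of "\<lambda>C. rank_word (rk x) (rk y) (rk ` C)" x y]
    by (simp add: case_prod_beta)
  also have "\<dots> = (\<Sum>z\<in>between r x y. \<Sum>C\<in>chains_between r z y.
          rank_word (rk x) (rk y) (insert (rk z) (rk ` C)))"
    by (rule sum.Sigma[symmetric]) (simp_all add: finite_between finite_chains_between)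
  also have "\<dots> = (\<Sum>z\<in>between r x y. var_e ^ (rk z - Suc (rk x)) * var_b * psi r rk z y)"
  proof (rule sum.cong[OF HOL.refl])
    fix z assume z: "z \<in> between r x y"
    have "rank_word (rk x) (rk y) (insert (rk z) (rk ` C))
        = var_e ^ (rk z - Suc (rk x)) * var_b * rank_word (rk z) (rk y) (rk ` C)"
      if "C \<in> chains_between r z y" for C
    proof (rule rank_word_insert)
      fix t assume "t \<in> rk ` C"
      then obtain u where u: "u \<in> C" "t = rk u" by auto
      then have "u \<in> between r z y" using that by (auto simp: chains_between_def)
      with u(2) show "rk z < t" using between_rank[of u z y] by simp
    qed (use between_rank[OF z] in auto)
    then show "(\<Sum>C\<in>chains_between r z y. rank_word (rk x) (rk y) (insert (rk z) (rk ` C)))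
        = var_e ^ (rk z - Suc (rk x)) * var_b * psi r rk z y"
      by (simp add: psi_def sum_distrib_left)
  qed
  finally show ?thesis by (simp add: rank_word_empty)
qed

lemma lead_psi:
  assumes "rk x < rk y"
  shows "lead (rk y - Suc (rk x)) (psi r rk x y) = 1"
proof -
  have e: "Poly_Mapping.lookup (var_e ^ j * q) (replicate j Letter_a @ w) = Poly_Mapping.lookup q w"
    for j q w
    by (induction j) (simp_all add: var_e_def left_diff_distrib lookup_minus mult.assoc)
  have 1: "lead k (var_e ^ k) = 1" for k
    using e[of k 1 "[]"] by simp
  have 2: "lead (rk y - Suc (rk x)) (var_e ^ (rk z - Suc (rk x)) * var_b * psi r rk z y) = 0"
    if z: "z \<in> between r x y" for z
  proof -
    have "rk y - Suc (rk x) = (rk z - Suc (rk x)) + Suc (rk y - Suc (rk z))"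
      using between_rank[OF z] by linarith
    then show ?thesis by (simp only: replicate_add e mult.assoc) simp
  qed
  show ?thesis
    unfolding psi_rec[of x y] lookup_add lookup_sum by (simp add: 1 2)
qed

end

subsection \<open>The cd-index as a chain polynomial\<close>

text \<open>
  Distributing a product of linear forms: choosing \<open>b\<close> exactly at the positions in \<open>S\<close> yields one
  word for each \<open>S\<close>.
\<close>

lemma prod_list_two_letters:
  "prod_list (map (\<lambda>i. Poly_Mapping.single [Letter_a] (x i) + Poly_Mapping.single [Letter_b] (y i)) [1..<Suc m])
   = (\<Sum>S\<in>Pow {1..m}. Poly_Mapping.single (ab_word m S) (\<Prod>i=1..m. if i \<in> S then y i else x i :: rat))"
proof (induction m)
  case 0
  have "(1 :: ab_poly) = Poly_Mapping.single [] 1" by (metis single_one zero_list_def)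
  then show ?case by (simp add: ab_word_def)
next
  case (Suc m)
  let ?c = "\<lambda>m S. \<Prod>i=1..m. if i \<in> S then y i else x i"
  have w: "ab_word (Suc m) S = ab_word m S @ [Letter_a]" "?c (Suc m) S = ?c m S * x (Suc m)"
    "ab_word (Suc m) (insert (Suc m) S) = ab_word m S @ [Letter_b]"
    "?c (Suc m) (insert (Suc m) S) = ?c m S * y (Suc m)"
    if "S \<in> Pow {1..m}" for S
  proof -
    have n: "Suc m \<notin> S" using that by auto
    show "ab_word (Suc m) S = ab_word m S @ [Letter_a]" using n by (simp add: ab_word_def)
    show "?c (Suc m) S = ?c m S * x (Suc m)" using n by simp
    show "ab_word (Suc m) (insert (Suc m) S) = ab_word m S @ [Letter_b]"
      by (auto simp: ab_word_def intro!: map_cong)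
    have "?c m (insert (Suc m) S) = ?c m S" by (rule prod.cong) auto
    then show "?c (Suc m) (insert (Suc m) S) = ?c m S * y (Suc m)" by simp
  qed
  have "Pow {1..Suc m} = Pow {1..m} \<union> insert (Suc m) ` Pow {1..m}"
    by (simp add: atLeastAtMostSuc_conv Pow_insert)
  moreover have "Pow {1..m} \<inter> insert (Suc m) ` Pow {1..m} = {}" by auto
  moreover have "inj_on (insert (Suc m)) (Pow {1..m})"
    by (rule inj_onI) (auto simp: insert_ident dest!: insert_ident[THEN iffD1, rotated 2])
  ultimately have "(\<Sum>S\<in>Pow {1..Suc m}. Poly_Mapping.single (ab_word (Suc m) S) (?c (Suc m) S))
    = (\<Sum>S\<in>Pow {1..m}. Poly_Mapping.single (ab_word (Suc m) S) (?c (Suc m) S))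
    + (\<Sum>S\<in>Pow {1..m}. Poly_Mapping.single (ab_word (Suc m) (insert (Suc m) S)) (?c (Suc m) (insert (Suc m) S)))"
    by (simp only: sum.union_disjoint sum.reindex finite_Pow_iff finite_imageI finite_atLeastAtMost o_def)
  also have "\<dots> = (\<Sum>S\<in>Pow {1..m}. Poly_Mapping.single (ab_word m S @ [Letter_a]) (?c m S * x (Suc m)))
    + (\<Sum>S\<in>Pow {1..m}. Poly_Mapping.single (ab_word m S @ [Letter_b]) (?c m S * y (Suc m)))"
    by (intro arg_cong2[where f = "(+)"] sum.cong HOL.refl) (simp_all only: w)
  also have "\<dots> = (\<Sum>S\<in>Pow {1..m}. Poly_Mapping.single (ab_word m S) (?c m S))
     * (Poly_Mapping.single [Letter_a] (x (Suc m)) + Poly_Mapping.single [Letter_b] (y (Suc m)))"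
    by (simp add: distrib_left sum_distrib_right mult_single plus_list_def)
  finally show ?case using Suc.IH by simp
qed

lemma single_sum: "Poly_Mapping.single w (sum f A) = (\<Sum>x\<in>A. Poly_Mapping.single w (f x))"
  by (induction A rule: infinite_finite_induct) (simp_all add: single_add)

text \<open>
  The passage from \<open>\<beta>\<close> to \<open>\<alpha>\<close>: expanding \<open>e = a - b\<close> at the positions outside \<open>T\<close> produces the
  words of all \<open>S \<supseteq> T\<close>, with sign \<open>(-1)^|S - T|\<close>.
\<close>

lemma alternating_sum_expansion:
  "(\<Sum>S\<in>Pow {1..m}. Poly_Mapping.single (ab_word m S) (\<Sum>T\<in>Pow S. (- 1) ^ card (S - T) * f T))
   = (\<Sum>T\<in>Pow {1..m}. scale_ab (f T) (rank_word 0 (Suc m) T))"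
proof -
  have W: "rank_word 0 (Suc m) T = (\<Sum>S\<in>Pow {1..m}. Poly_Mapping.single (ab_word m S)
      (if T \<subseteq> S then (- 1) ^ card (S - T) else 0))" if T: "T \<subseteq> {1..m}" for T
  proof -
    let ?x = "\<lambda>i. if i \<in> T then 0 else 1 :: rat" and ?y = "\<lambda>i. if i \<in> T then 1 else - 1 :: rat"
    have "(if i \<in> T then var_b else var_e)
        = Poly_Mapping.single [Letter_a] (?x i) + Poly_Mapping.single [Letter_b] (?y i)" for i
      by (simp add: var_b_def var_e_def var_a_def single_uminus)
    then have "rank_word 0 (Suc m) T
        = prod_list (map (\<lambda>i. Poly_Mapping.single [Letter_a] (?x i) + Poly_Mapping.single [Letter_b] (?y i)) [1..<Suc m])"
      by (simp only: rank_word_def One_nat_def)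
    also have "\<dots> = (\<Sum>S\<in>Pow {1..m}. Poly_Mapping.single (ab_word m S)
        (\<Prod>i=1..m. if i \<in> S then ?y i else ?x i))"
      by (rule prod_list_two_letters)
    also have "\<dots> = (\<Sum>S\<in>Pow {1..m}. Poly_Mapping.single (ab_word m S)
        (if T \<subseteq> S then (- 1) ^ card (S - T) else 0))"
    proof (rule sum.cong[OF HOL.refl])
      fix S assume S: "S \<in> Pow {1..m}"
      have "(\<Prod>i=1..m. if i \<in> S then ?y i else ?x i) = (if T \<subseteq> S then (- 1) ^ card (S - T) else 0)"
      proof (cases "T \<subseteq> S")
        case True
        have "(\<Prod>i=1..m. if i \<in> S then ?y i else ?x i) = (\<Prod>i=1..m. if i \<in> S - T then - 1 else 1)"
          by (rule prod.cong) (use True in auto)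
        also have "\<dots> = (\<Prod>i\<in>S - T. - 1)"
          using S prod.inter_restrict[of "{1..m}" "\<lambda>_. - 1 :: rat" "S - T"] by (simp add: Int_absorb1 subset_iff)
        finally show ?thesis using True by simp
      next
        case False
        then obtain t where "t \<in> T" "t \<notin> S" by auto
        then have "\<exists>i\<in>{1..m}. (if i \<in> S then ?y i else ?x i) = 0"
          using T by (intro bexI[of _ t]) auto
        then show ?thesis using False prod_zero[of "{1..m}"] by auto
      qed
      then show "Poly_Mapping.single (ab_word m S) (\<Prod>i=1..m. if i \<in> S then ?y i else ?x i)
          = Poly_Mapping.single (ab_word m S) (if T \<subseteq> S then (- 1) ^ card (S - T) else 0)" by simp
    qed
    finally show ?thesis .
  qed
  have "(\<Sum>S\<in>Pow {1..m}. Poly_Mapping.single (ab_word m S) (\<Sum>T\<in>Pow S. (- 1) ^ card (S - T) * f T))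
    = (\<Sum>S\<in>Pow {1..m}. \<Sum>T\<in>Pow {1..m}. Poly_Mapping.single (ab_word m S)
        (f T * (if T \<subseteq> S then (- 1) ^ card (S - T) else 0)))"
  proof (rule sum.cong[OF HOL.refl])
    fix S assume S: "S \<in> Pow {1..m}"
    then have fin: "finite S" by (auto intro: finite_subset)
    have "(\<Sum>T\<in>Pow S. (- 1) ^ card (S - T) * f T)
        = (\<Sum>T\<in>Pow {1..m}. f T * (if T \<subseteq> S then (- 1) ^ card (S - T) else 0))"
      by (rule sum.mono_neutral_cong_left) (use S in auto)
    then show "Poly_Mapping.single (ab_word m S) (\<Sum>T\<in>Pow S. (- 1) ^ card (S - T) * f T)
        = (\<Sum>T\<in>Pow {1..m}. Poly_Mapping.single (ab_word m S)
            (f T * (if T \<subseteq> S then (- 1) ^ card (S - T) else 0)))"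
      by (simp only: single_sum)
  qed
  also have "\<dots> = (\<Sum>T\<in>Pow {1..m}. \<Sum>S\<in>Pow {1..m}. Poly_Mapping.single (ab_word m S)
        (f T * (if T \<subseteq> S then (- 1) ^ card (S - T) else 0)))"
    by (rule sum.swap)
  also have "\<dots> = (\<Sum>T\<in>Pow {1..m}. scale_ab (f T) (rank_word 0 (Suc m) T))"
    by (rule sum.cong[OF HOL.refl]) (simp add: W ab.scale_sum_right)
  finally show ?thesis .
qed

locale graded_poset = ranked_poset +
  assumes cover: "(x, y) \<in> r \<Longrightarrow> x \<noteq> y \<Longrightarrow> \<exists>z. (x, z) \<in> r \<and> (z, y) \<in> r \<and> rk z = Suc (rk x)"
begin

abbreviation closed_interval :: "'a \<Rightarrow> 'a \<Rightarrow> 'a set" where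
  "closed_interval x y \<equiv> {z. (x, z) \<in> r \<and> (z, y) \<in> r}"

lemma saturated_chain:
  assumes "(x, y) \<in> r"
  shows "\<exists>C\<in>Chains r. C \<subseteq> closed_interval x y \<and> card C = Suc (rk y - rk x)"
  using assms
proof (induction "rk y - rk x" arbitrary: x rule: less_induct)
  case less
  show ?case
  proof (cases "x = y")
    case True
    then show ?thesis using less.prems by (intro bexI[of _ "{x}"]) (auto simp: Chains_def)
  next
    case False
    then obtain z where z: "(x, z) \<in> r" "(z, y) \<in> r" "rk z = Suc (rk x)"
      using cover less.prems by blast
    have lt: "rk x < rk y" using False less.prems rank_less by blast
    have "rk y - rk z < rk y - rk x" using z(3) lt by simp
    from less.hyps[OF this z(2)]
    obtain C where C: "C \<in> Chains r" "C \<subseteq> closed_interval z y" "card C = Suc (rk y - rk z)"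
      by blast
    have xz: "(x, u) \<in> r" if "u \<in> C" for u using that C(2) z(1) r_trans by blast
    have "x \<notin> C" using C(2) z(1,3) rank_le[of z x] by auto
    moreover have "finite C" using C(3) by (metis card.infinite nat.distinct(1))
    ultimately have "card (insert x C) = Suc (rk y - rk x)"
      using C(3) z(3) lt by simp
    moreover have "insert x C \<in> Chains r"
      using C(1) xz refl_left[OF less.prems] unfolding Chains_def by blast
    moreover have "insert x C \<subseteq> closed_interval x y"
      using C(2) xz less.prems refl_left by blast
    ultimately show ?thesis by blast
  qed
qed

text \<open>
  Ranks are injective on a chain, so a chain has at most one element in each rank; saturated chains
  attain the bound.
\<close>

lemma poset_rank_interval:
  assumes "(x, y) \<in> r"
  shows "poset_rank (Restr r (closed_interval x y)) = rk y - rk x"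
proof -
  let ?I = "closed_interval x y" and ?R = "Restr r (closed_interval x y)"
  have sub: "C \<subseteq> ?I" if "C \<in> Chains ?R" for C
    using that unfolding Chains_def by blast
  have fin: "finite (Chains ?R)"
    by (rule finite_subset[of _ "Pow ?I"]) (use sub finite_interval in auto)
  show ?thesis unfolding poset_rank_def
  proof (rule Max_eqI)
    show "finite ((\<lambda>C. card C - 1) ` Chains ?R)" using fin by simp
  next
    fix n assume "n \<in> (\<lambda>C. card C - 1) ` Chains ?R"
    then obtain C where C: "C \<in> Chains ?R" "n = card C - 1" by auto
    have "inj_on rk C"
    proof (rule inj_onI)
      fix u v assume uv: "u \<in> C" "v \<in> C" "rk u = rk v"
      then have "(u, v) \<in> r \<or> (v, u) \<in> r" using C(1) unfolding Chains_def by blast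
      then show "u = v" using uv(3) rank_less by fastforce
    qed
    moreover have "rk ` C \<subseteq> {rk x..rk y}" using sub[OF C(1)] rank_le by auto
    ultimately have "card C \<le> card {rk x..rk y}"
      by (metis card_image card_mono finite_atLeastAtMost)
    then show "n \<le> rk y - rk x" using C(2) by simp
  next
    obtain C where C: "C \<in> Chains r" "C \<subseteq> ?I" "card C = Suc (rk y - rk x)"
      using saturated_chain[OF assms] by blast
    have "C \<in> Chains ?R" using C(1,2) unfolding Chains_def by blast
    then show "rk y - rk x \<in> (\<lambda>C. card C - 1) ` Chains ?R"
      using C(3) by (intro image_eqI[of _ _ C]) simp_all
  qed
qed

lemma element_rank_interval:
  assumes "(x, z) \<in> r" "(z, y) \<in> r"
  shows "element_rank (Restr r (closed_interval x y)) z = rk z - rk x"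
proof -
  have "Restr (Restr r (closed_interval x y)) (under (Restr r (closed_interval x y)) z)
      = Restr r (closed_interval x z)"
    using assms r_trans refl_left refl_right unfolding under_def by blast
  then show ?thesis unfolding element_rank_def using poset_rank_interval[OF assms(1)] by simp
qed

lemma proper_part_interval:
  assumes "(x, y) \<in> r"
  shows "proper_part (Restr r (closed_interval x y)) = between r x y"
proof -
  have "Field (Restr r (closed_interval x y)) = closed_interval x y"
    using refl_left refl_right by (auto simp: Field_def)
  then show ?thesis
    unfolding proper_part_def between_def using assms r_antisym refl_left refl_right by blast
qed

lemma cd_index_interval:
  assumes "(x, y) \<in> r" "x \<noteq> y"
  shows "cd_index (Restr r (closed_interval x y)) = psi r rk x y"
proof -
  let ?R = "Restr r (closed_interval x y)" and ?A = "chains_between r x y"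
  define m where "m = rk y - Suc (rk x)"
  have lt: "rk x < rk y" using assms rank_less by blast
  define g where "g C = (\<lambda>z. rk z - rk x) ` C" for C
  have chains: "{C \<in> Chains ?R. C \<subseteq> proper_part ?R \<and> element_rank ?R ` C = S} = {C \<in> ?A. g C = S}" for S
  proof -
    have "element_rank ?R ` C = g C" if "C \<subseteq> between r x y" for C
      unfolding g_def using that
      by (intro image_cong) (auto simp: between_def intro!: element_rank_interval)
    moreover have "C \<in> Chains ?R \<longleftrightarrow> C \<in> Chains r" if "C \<subseteq> between r x y" for C
      using that unfolding Chains_def between_def by blast
    ultimately show ?thesis
      unfolding proper_part_interval[OF assms(1)] chains_between_def by blast
  qed
  have "cd_index ?R = (\<Sum>S\<in>Pow {1..m}. Poly_Mapping.single (ab_word m S)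
      (\<Sum>T\<in>Pow S. (- 1) ^ card (S - T) * of_nat (card {C \<in> ?A. g C = T})))"
    unfolding cd_index_def poset_rank_interval[OF assms(1)] flag_h_def flag_f_def chains
    by (simp add: m_def Let_def)
  also have "\<dots> = (\<Sum>T\<in>Pow {1..m}. scale_ab (of_nat (card {C \<in> ?A. g C = T})) (rank_word 0 (Suc m) T))"
    by (rule alternating_sum_expansion)
  also have "\<dots> = (\<Sum>T\<in>Pow {1..m}. \<Sum>C | C \<in> ?A \<and> g C = T. rank_word 0 (Suc m) (g C))"
  proof (rule sum.cong[OF HOL.refl])
    fix T
    have const: "scale_ab (of_nat n) p = of_nat n * p" for n p
      by (induction n) (simp_all add: ab.scale_left_distrib distrib_right)
    show "scale_ab (of_nat (card {C \<in> ?A. g C = T})) (rank_word 0 (Suc m) T)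
        = (\<Sum>C | C \<in> ?A \<and> g C = T. rank_word 0 (Suc m) (g C))"
      by (simp add: const)
  qed
  also have "\<dots> = (\<Sum>C\<in>?A. rank_word 0 (Suc m) (g C))"
  proof (rule sum.group)
    show "g ` ?A \<subseteq> Pow {1..m}"
      using between_rank[of _ x y] by (fastforce simp: g_def chains_between_def m_def)
  qed (simp_all add: finite_chains_between)
  also have "\<dots> = psi r rk x y"
    unfolding psi_def
  proof (rule sum.cong[OF HOL.refl])
    fix C assume C: "C \<in> ?A"
    have shift: "map (\<lambda>k. k + i) [a..<b] = [a + i..<b + i]" for i a b :: nat
      by (induction b) auto
    have 1: "[Suc (rk x)..<rk y] = map (\<lambda>k. k + rk x) [Suc 0..<Suc m]"
      unfolding shift using lt by (simp add: m_def)
    have mem: "k \<in> g C \<longleftrightarrow> k + rk x \<in> rk ` C" for k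
    proof
      assume "k \<in> g C"
      then obtain z where z: "z \<in> C" "k = rk z - rk x" by (auto simp: g_def)
      then have "z \<in> between r x y" using C by (auto simp: chains_between_def)
      then show "k + rk x \<in> rk ` C" using z between_rank[of z x y] by auto
    next
      assume "k + rk x \<in> rk ` C"
      then obtain z where z: "z \<in> C" "k + rk x = rk z" by auto
      then show "k \<in> g C" unfolding g_def by (intro image_eqI[of _ _ z]) auto
    qed
    show "rank_word 0 (Suc m) (g C) = rank_word (rk x) (rk y) (rk ` C)"
      unfolding rank_word_def 1 map_map by (simp add: mem o_def del: upt_Suc)
  qed
  finally show ?thesis .
qed

end

section \<open>Eulerian posets\<close>

locale eulerian_poset = ranked_poset +
  assumes eulerian: "(x, y) \<in> r \<Longrightarrow> x \<noteq> y \<Longrightarrow>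
    (\<Sum>z | (x, z) \<in> r \<and> (z, y) \<in> r. (- 1) ^ rk z) = (0 :: int)"
begin

text \<open>
  The relation that eliminates odd powers of \<open>e\<close>. Since \<open>2 b = c - e\<close>, the recursion for \<open>\<Psi>\<close> can be
  written with \<open>c\<close> and \<open>e\<close> alone (\<open>step\<close>). Weighting the instance at \<open>z\<close> with \<open>(-e)^\<rho>(x,z)\<close> and
  summing over \<open>z\<close>, the inner sums are alternating sums over intervals \<open>[x, u]\<close>, with or without \<open>u\<close>,
  and these are known (\<open>total\<close>). The factors \<open>1 - sg\<close> and \<open>1 + sg\<close> in the sum of both relations kill
  the terms with an odd power of \<open>e\<close>.
\<close>

lemma psi_eulerian_rec:
  assumes xy: "(x, y) \<in> r" "x \<noteq> y"
  defines "sg \<equiv> \<lambda>z. (- 1) ^ (rk z + rk x) :: ab_poly"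
  shows "4 * psi r rk x y = 2 * (1 - sg y) * var_e ^ (rk y - Suc (rk x))
    + (\<Sum>u\<in>between r x y. (1 - sg u) * var_e ^ (rk u - Suc (rk x)) * var_c * psi r rk u y)
    - (\<Sum>z\<in>between r x y. (1 + sg z) * var_e ^ (rk z - rk x) * psi r rk z y)"
proof -
  define Z where "Z = {z. (x, z) \<in> r \<and> (z, y) \<in> r \<and> z \<noteq> y}"
  let ?h = "\<lambda>z. psi r rk z y"
  have finZ: "finite Z"
    by (rule finite_subset[OF _ finite_interval[of x y]]) (auto simp: Z_def)
  have Z: "Z = insert x (between r x y)" "x \<notin> between r x y"
    using xy refl_left by (auto simp: Z_def between_def)
  have two_b: "2 * var_b = var_c - var_e"
    by (simp add: var_c_def var_e_def mult_2)
  have sgx: "sg x = 1" by (simp add: sg_def)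
  have signs: "(\<Sum>z | (x, z) \<in> r \<and> (z, u) \<in> r. sg z) = (if u = x then 1 else 0)" if "(x, u) \<in> r" for u
  proof (cases "u = x")
    case True
    then have "{z. (x, z) \<in> r \<and> (z, u) \<in> r} = {x}"
      using r_antisym refl_left[OF xy(1)] by blast
    then show ?thesis using True by (simp add: sgx)
  next
    case False
    have "of_int (\<Sum>z | (x, z) \<in> r \<and> (z, u) \<in> r. (- 1) ^ rk z) = (0 :: ab_poly)"
      using eulerian[OF that] False by simp
    then have "(\<Sum>z | (x, z) \<in> r \<and> (z, u) \<in> r. (- 1) ^ rk z) = (0 :: ab_poly)" by simp
    then show ?thesis using False by (simp add: sg_def power_add flip: sum_distrib_right)
  qed
  have step: "?h z + (\<Sum>u | u \<in> Z \<and> (z, u) \<in> r. var_e ^ (rk u - rk z) * ?h u)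
      = 2 * var_e ^ (rk y - Suc (rk z))
        + (\<Sum>u | u \<in> Z \<and> (z, u) \<in> r \<and> u \<noteq> z. var_e ^ (rk u - Suc (rk z)) * var_c * ?h u)"
    if z: "z \<in> Z" for z
  proof -
    have bet: "between r z y = {u. u \<in> Z \<and> (z, u) \<in> r \<and> u \<noteq> z}"
      using z r_trans unfolding between_def Z_def by blast
    have ins: "{u. u \<in> Z \<and> (z, u) \<in> r} = insert z (between r z y)"
      using z refl_left unfolding bet by (auto simp: Z_def)
    have zn: "z \<notin> between r z y" by (simp add: between_def)
    have "2 * (var_e ^ (rk u - Suc (rk z)) * var_b * ?h u)
        = var_e ^ (rk u - Suc (rk z)) * var_c * ?h u - var_e ^ (rk u - rk z) * ?h u"
      if "u \<in> between r z y" for u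
    proof -
      have "rk u - rk z = Suc (rk u - Suc (rk z))" using between_rank[OF that] by linarith
      then have e: "var_e ^ (rk u - rk z) = var_e ^ (rk u - Suc (rk z)) * var_e"
        by (simp only: power_Suc2)
      have "2 * (var_e ^ (rk u - Suc (rk z)) * var_b * ?h u)
          = var_e ^ (rk u - Suc (rk z)) * (2 * var_b) * ?h u"
        by (simp add: mult_2 distrib_left distrib_right)
      then show ?thesis unfolding two_b e by (simp add: algebra_simps)
    qed
    then have "2 * ?h z = 2 * var_e ^ (rk y - Suc (rk z))
        + (\<Sum>u\<in>between r z y. var_e ^ (rk u - Suc (rk z)) * var_c * ?h u - var_e ^ (rk u - rk z) * ?h u)"
      unfolding psi_rec[of z y] distrib_left sum_distrib_left by simp
    then show ?thesis
      unfolding ins bet[symmetric] using finite_between zn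
      by (simp add: sum_subtractf mult_2 algebra_simps)
  qed
  have total: "(\<Sum>z\<in>Z. sg z * var_e ^ (rk z - rk x) * ?h z) + ?h x
      = - 2 * sg y * var_e ^ (rk y - Suc (rk x))
        - (\<Sum>u\<in>between r x y. sg u * var_e ^ (rk u - Suc (rk x)) * var_c * ?h u)"
  proof -
    have ee: "sg z * var_e ^ (rk z - rk x) * (var_e ^ k * p) = sg z * (var_e ^ (rk z - rk x + k) * p)"
      for z k p by (simp add: power_add mult.assoc)
    \<comment> \<open>after exchanging the sums, only \<open>u = x\<close> survives\<close>
    have 1: "(\<Sum>z\<in>Z. \<Sum>u | u \<in> Z \<and> (z, u) \<in> r. sg z * var_e ^ (rk z - rk x) * (var_e ^ (rk u - rk z) * ?h u))
        = ?h x"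
    proof -
      have "(\<Sum>z\<in>Z. \<Sum>u | u \<in> Z \<and> (z, u) \<in> r. sg z * var_e ^ (rk z - rk x) * (var_e ^ (rk u - rk z) * ?h u))
        = (\<Sum>z\<in>Z. \<Sum>u | u \<in> Z \<and> (z, u) \<in> r. sg z * (var_e ^ (rk u - rk x) * ?h u))"
      proof (intro sum.cong HOL.refl)
        fix z u assume "z \<in> Z" "u \<in> {u. u \<in> Z \<and> (z, u) \<in> r}"
        then have "rk x \<le> rk z" "rk z \<le> rk u" using rank_le by (auto simp: Z_def)
        then show "sg z * var_e ^ (rk z - rk x) * (var_e ^ (rk u - rk z) * ?h u)
            = sg z * (var_e ^ (rk u - rk x) * ?h u)" unfolding ee by simp
      qed
      also have "\<dots> = (\<Sum>u\<in>Z. \<Sum>z | z \<in> Z \<and> (z, u) \<in> r. sg z * (var_e ^ (rk u - rk x) * ?h u))"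
        by (rule sum.swap_restrict[OF finZ finZ])
      also have "\<dots> = (\<Sum>u\<in>Z. if u = x then ?h u else 0)"
      proof (rule sum.cong[OF HOL.refl])
        fix u assume u: "u \<in> Z"
        then have "{z. z \<in> Z \<and> (z, u) \<in> r} = {z. (x, z) \<in> r \<and> (z, u) \<in> r}"
          using r_trans r_antisym unfolding Z_def by blast
        then have "(\<Sum>z | z \<in> Z \<and> (z, u) \<in> r. sg z) = (if u = x then 1 else 0)"
          using signs[of u] u by (simp add: Z_def)
        then show "(\<Sum>z | z \<in> Z \<and> (z, u) \<in> r. sg z * (var_e ^ (rk u - rk x) * ?h u)) = (if u = x then ?h u else 0)"
          by (simp flip: sum_distrib_right)
      qed
      also have "\<dots> = ?h x" using finZ Z by simp
      finally show ?thesis .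
    qed
    have 2: "(\<Sum>z\<in>Z. sg z * var_e ^ (rk z - rk x) * (2 * var_e ^ (rk y - Suc (rk z))))
        = - 2 * sg y * var_e ^ (rk y - Suc (rk x))"
    proof -
      have "(\<Sum>z\<in>Z. sg z * var_e ^ (rk z - rk x) * (2 * var_e ^ (rk y - Suc (rk z))))
          = (\<Sum>z\<in>Z. sg z * (2 * var_e ^ (rk y - Suc (rk x))))"
      proof (intro sum.cong HOL.refl)
        fix z assume "z \<in> Z"
        then have "rk x \<le> rk z" "rk z < rk y" using rank_le rank_less by (auto simp: Z_def)
        then have "rk y - Suc (rk x) = (rk z - rk x) + (rk y - Suc (rk z))" by linarith
        then show "sg z * var_e ^ (rk z - rk x) * (2 * var_e ^ (rk y - Suc (rk z)))
            = sg z * (2 * var_e ^ (rk y - Suc (rk x)))"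
          by (simp add: power_add mult_2 distrib_left mult.assoc)
      qed
      also have "\<dots> = (\<Sum>z\<in>Z. sg z) * (2 * var_e ^ (rk y - Suc (rk x)))"
        by (rule sum_distrib_right[symmetric])
      also have "(\<Sum>z\<in>Z. sg z) = - sg y"
      proof -
        have "{z. (x, z) \<in> r \<and> (z, y) \<in> r} = insert y Z" "y \<notin> Z"
          using xy refl_right by (auto simp: Z_def)
        then have "sg y + (\<Sum>z\<in>Z. sg z) = 0" using signs[OF xy(1)] xy(2) finZ by simp
        then show ?thesis by (simp add: eq_neg_iff_add_eq_0 add.commute)
      qed
      finally show ?thesis by (simp add: mult_2 distrib_left distrib_right left_diff_distrib)
    qed
    \<comment> \<open>here \<open>z = u\<close> is missing from the inner alternating sum, which is therefore minus the sign of \<open>u\<close>\<close>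
    have 3: "(\<Sum>z\<in>Z. \<Sum>u | u \<in> Z \<and> (z, u) \<in> r \<and> u \<noteq> z.
          sg z * var_e ^ (rk z - rk x) * (var_e ^ (rk u - Suc (rk z)) * var_c * ?h u))
        = - (\<Sum>u\<in>between r x y. sg u * var_e ^ (rk u - Suc (rk x)) * var_c * ?h u)"
    proof -
      have "(\<Sum>z\<in>Z. \<Sum>u | u \<in> Z \<and> (z, u) \<in> r \<and> u \<noteq> z.
          sg z * var_e ^ (rk z - rk x) * (var_e ^ (rk u - Suc (rk z)) * var_c * ?h u))
        = (\<Sum>z\<in>Z. \<Sum>u | u \<in> Z \<and> (z, u) \<in> r \<and> u \<noteq> z. sg z * (var_e ^ (rk u - Suc (rk x)) * var_c * ?h u))"
      proof (intro sum.cong HOL.refl)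
        fix z u assume "z \<in> Z" "u \<in> {u. u \<in> Z \<and> (z, u) \<in> r \<and> u \<noteq> z}"
        then have "rk x \<le> rk z" "rk z < rk u" using rank_le rank_less by (auto simp: Z_def)
        then have "rk u - Suc (rk x) = (rk z - rk x) + (rk u - Suc (rk z))" by linarith
        then show "sg z * var_e ^ (rk z - rk x) * (var_e ^ (rk u - Suc (rk z)) * var_c * ?h u)
            = sg z * (var_e ^ (rk u - Suc (rk x)) * var_c * ?h u)"
          by (simp add: power_add mult.assoc)
      qed
      also have "\<dots> = (\<Sum>u\<in>Z. \<Sum>z | z \<in> Z \<and> ((z, u) \<in> r \<and> u \<noteq> z). sg z * (var_e ^ (rk u - Suc (rk x)) * var_c * ?h u))"
        by (rule sum.swap_restrict[OF finZ finZ])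
      also have "\<dots> = (\<Sum>u\<in>Z. if u = x then 0 else - (sg u * var_e ^ (rk u - Suc (rk x)) * var_c * ?h u))"
      proof (rule sum.cong[OF HOL.refl])
        fix u assume u: "u \<in> Z"
        have fin: "finite {z. z \<in> Z \<and> (z, u) \<in> r \<and> u \<noteq> z}" using finZ by simp
        have u': "(x, u) \<in> r" "(u, y) \<in> r" "u \<noteq> y" using u by (auto simp: Z_def)
        have ins: "{z. (x, z) \<in> r \<and> (z, u) \<in> r} = insert u {z. z \<in> Z \<and> (z, u) \<in> r \<and> u \<noteq> z}"
        proof (intro equalityI subsetI)
          fix z assume "z \<in> {z. (x, z) \<in> r \<and> (z, u) \<in> r}"
          then show "z \<in> insert u {z. z \<in> Z \<and> (z, u) \<in> r \<and> u \<noteq> z}"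
            using r_trans[of z u y] r_antisym[of u y] u' by (auto simp: Z_def)
        next
          fix z assume "z \<in> insert u {z. z \<in> Z \<and> (z, u) \<in> r \<and> u \<noteq> z}"
          then show "z \<in> {z. (x, z) \<in> r \<and> (z, u) \<in> r}"
            using u' refl_right[of x u] by (auto simp: Z_def)
        qed
        have "sg u + (\<Sum>z | z \<in> Z \<and> (z, u) \<in> r \<and> u \<noteq> z. sg z) = (if u = x then 1 else 0)"
          using signs[of u] u fin unfolding ins by (simp add: Z_def)
        then have "(\<Sum>z | z \<in> Z \<and> (z, u) \<in> r \<and> u \<noteq> z. sg z) = (if u = x then 0 else - sg u)"
          using sgx by (auto simp: eq_neg_iff_add_eq_0 add.commute)
        then show "(\<Sum>z | z \<in> Z \<and> ((z, u) \<in> r \<and> u \<noteq> z). sg z * (var_e ^ (rk u - Suc (rk x)) * var_c * ?h u))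
            = (if u = x then 0 else - (sg u * var_e ^ (rk u - Suc (rk x)) * var_c * ?h u))"
          by (simp add: mult.assoc flip: sum_distrib_right)
      qed
      also have "\<dots> = - (\<Sum>u\<in>between r x y. sg u * var_e ^ (rk u - Suc (rk x)) * var_c * ?h u)"
      proof -
        have "(\<Sum>u\<in>between r x y. if u = x then 0 else - (sg u * var_e ^ (rk u - Suc (rk x)) * var_c * ?h u))
            = (\<Sum>u\<in>between r x y. - (sg u * var_e ^ (rk u - Suc (rk x)) * var_c * ?h u))"
          by (rule sum.cong) (use Z(2) in auto)
        then show ?thesis unfolding Z(1) using Z(2) finite_between by (simp add: sum_negf)
      qed
      finally show ?thesis .
    qed
    have "(\<Sum>z\<in>Z. sg z * var_e ^ (rk z - rk x) * (?h z
          + (\<Sum>u | u \<in> Z \<and> (z, u) \<in> r. var_e ^ (rk u - rk z) * ?h u)))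
        = (\<Sum>z\<in>Z. sg z * var_e ^ (rk z - rk x) * (2 * var_e ^ (rk y - Suc (rk z))
          + (\<Sum>u | u \<in> Z \<and> (z, u) \<in> r \<and> u \<noteq> z. var_e ^ (rk u - Suc (rk z)) * var_c * ?h u)))"
      by (intro sum.cong HOL.refl arg_cong2[where f = "(*)"] step)
    then show ?thesis
      unfolding distrib_left sum.distrib sum_distrib_left 1 2 3 by simp
  qed
  have first: "?h x + (\<Sum>u\<in>Z. var_e ^ (rk u - rk x) * ?h u) = 2 * var_e ^ (rk y - Suc (rk x))
        + (\<Sum>u\<in>between r x y. var_e ^ (rk u - Suc (rk x)) * var_c * ?h u)"
  proof -
    have "{u. u \<in> Z \<and> (x, u) \<in> r} = Z" "{u. u \<in> Z \<and> (x, u) \<in> r \<and> u \<noteq> x} = between r x y"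
      by (auto simp: Z_def between_def)
    then show ?thesis using step[of x] Z by simp
  qed
  have "4 * ?h x = ?h x + ?h x + (?h x + ?h x)"
    using distrib_right[of 2 2 "?h x"] by (simp add: mult_2)
  then show ?thesis
    using first total unfolding Z(1) using Z(2) finite_between[of x y] sgx
    by (simp add: distrib_right left_diff_distrib sum.distrib sum_subtractf algebra_simps)
qed

text \<open>
  Induction along \<open>psi_eulerian_rec\<close>; the factor \<open>4\<close> is where rational coefficients enter.
\<close>

lemma psi_in_cd_space:
  assumes "(x, y) \<in> r" "x \<noteq> y"
  shows "psi r rk x y \<in> cd_space (rk y - Suc (rk x))"
  using assms
proof (induction "rk y - rk x" arbitrary: x rule: less_induct)
  case less
  let ?m = "rk y - Suc (rk x)" and ?sg = "\<lambda>z. (- 1) ^ (rk z + rk x) :: ab_poly"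
  have sg: "?sg z = (if even (rk z - rk x) then 1 else - 1)" if "rk x \<le> rk z" for z
  proof -
    have "rk z + rk x = (rk z - rk x) + 2 * rk x" using that by simp
    then have "even (rk z + rk x) \<longleftrightarrow> even (rk z - rk x)" by simp
    then show ?thesis by simp
  qed
  have dbl: "2 * p \<in> cd_space m" if "p \<in> cd_space m" for p m
    using cd_space_add[OF that that] by (simp add: mult_2)
  have IH: "psi r rk z y \<in> cd_space (rk y - Suc (rk z))" if "z \<in> between r x y" for z
    using that between_rank[OF that] by (intro less.hyps) (auto simp: between_def)
  have lt: "rk x < rk y" using less.prems rank_less by blast
  have 1: "2 * (1 - ?sg y) * var_e ^ ?m \<in> cd_space ?m"
  proof (cases "even (rk y - rk x)")
    case False
    then have "even ?m" using lt by (simp add: Suc_diff_Suc[symmetric] del: Suc_diff_Suc)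
    moreover have "2 * (1 - ?sg y) * var_e ^ ?m = 2 * (2 * var_e ^ ?m)"
      using sg[of y] lt False by (simp add: mult.assoc)
    ultimately show ?thesis using var_e_even_power_in_cd_space dbl by metis
  qed (use sg[of y] lt cd_space_zero in simp)
  have 2: "(1 - ?sg u) * var_e ^ (rk u - Suc (rk x)) * var_c * psi r rk u y \<in> cd_space ?m"
    if u: "u \<in> between r x y" for u
  proof (cases "even (rk u - rk x)")
    case False
    let ?j = "rk u - Suc (rk x)"
    have d: "rk u - rk x = Suc ?j" "?m = ?j + 1 + (rk y - Suc (rk u))"
      using between_rank[OF u] by linarith+
    have "even ?j" using False unfolding d(1) by simp
    then have "(var_e ^ ?j * var_c) * psi r rk u y \<in> cd_space ?m"
      unfolding d(2) by (intro cd_space_mult var_e_even_power_in_cd_space var_c_in_cd_space IH u)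
    then have "2 * ((var_e ^ ?j * var_c) * psi r rk u y) \<in> cd_space ?m" by (rule dbl)
    then show ?thesis using sg[of u] between_rank[OF u] False by (simp add: mult.assoc)
  qed (use sg[of u] between_rank[OF u] cd_space_zero in simp)
  have 3: "(1 + ?sg z) * var_e ^ (rk z - rk x) * psi r rk z y \<in> cd_space ?m"
    if z: "z \<in> between r x y" for z
  proof (cases "even (rk z - rk x)")
    case True
    have d: "?m = (rk z - rk x) + (rk y - Suc (rk z))"
      using between_rank[OF z] by linarith
    have "var_e ^ (rk z - rk x) * psi r rk z y \<in> cd_space ?m"
      unfolding d by (intro cd_space_mult var_e_even_power_in_cd_space IH z True)
    then have "2 * (var_e ^ (rk z - rk x) * psi r rk z y) \<in> cd_space ?m" by (rule dbl)
    then show ?thesis using sg[of z] between_rank[OF z] True by (simp add: mult.assoc)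
  qed (use sg[of z] between_rank[OF z] cd_space_zero in simp)
  have "4 * psi r rk x y \<in> cd_space ?m"
    unfolding psi_eulerian_rec[OF less.prems]
    by (intro cd_space_add cd_space_diff cd_space_sum 1 2 3)
  then have "scale_ab (1/4) (4 * psi r rk x y) \<in> cd_space ?m" by (rule cd_space_scale)
  moreover have "scale_ab (1/4) (4 * p) = p" for p
  proof -
    have "4 * p = scale_ab 4 p"
      using ab.scale_left_distrib[of 2 2 p] ab.scale_left_distrib[of 1 1 p]
        distrib_right[of 2 2 p] by (simp add: mult_2)
    then show ?thesis by simp
  qed
  ultimately show ?case by simp
qed

end

subsection \<open>Isomorphic intervals\<close>

lemma psi_iso:
  assumes "ranked_poset r rk" "ranked_poset r' rk'"
    and xy: "(x, y) \<in> r"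
    and inj: "inj_on f {z. (x, z) \<in> r \<and> (z, y) \<in> r}"
    and im: "f ` {z. (x, z) \<in> r \<and> (z, y) \<in> r} = {z. (f x, z) \<in> r' \<and> (z, f y) \<in> r'}"
    and ord: "\<And>u v. (x, u) \<in> r \<Longrightarrow> (u, y) \<in> r \<Longrightarrow> (x, v) \<in> r \<Longrightarrow> (v, y) \<in> r \<Longrightarrow>
      (f u, f v) \<in> r' \<longleftrightarrow> (u, v) \<in> r"
    and rank: "\<And>u. (x, u) \<in> r \<Longrightarrow> (u, y) \<in> r \<Longrightarrow> rk' (f u) - rk' (f x) = rk u - rk x"
  shows "psi r rk x y = psi r' rk' (f x) (f y)"
proof -
  interpret A: ranked_poset r rk by fact
  interpret B: ranked_poset r' rk' by fact
  let ?I = "{z. (x, z) \<in> r \<and> (z, y) \<in> r}"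
  have xI: "x \<in> ?I" "y \<in> ?I" using xy A.refl_left A.refl_right by auto
  have rank_add: "rk' (f u) = rk' (f x) + (rk u - rk x)" if "u \<in> ?I" for u
    using that rank[of u] B.rank_le[of "f x" "f u"] ord[of x u] xI by auto
  have "psi r rk z y = psi r' rk' (f z) (f y)" if "z \<in> ?I" for z
    using that
  proof (induction "rk y - rk z" arbitrary: z rule: less_induct)
    case less
    have z: "(x, z) \<in> r" "(z, y) \<in> r" using less.prems by auto
    have sub: "between r z y \<subseteq> ?I" using z A.r_trans by (auto simp: between_def)
    have im': "f ` between r z y = between r' (f z) (f y)"
    proof (intro equalityI subsetI)
      fix v assume "v \<in> f ` between r z y"
      then obtain u where u: "v = f u" "u \<in> between r z y" by auto
      then have "u \<in> ?I" using sub by blast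
      then show "v \<in> between r' (f z) (f y)"
        using u z xI ord[of z u] ord[of u y] inj_onD[OF inj, of u z] inj_onD[OF inj, of u y]
        unfolding between_def by auto
    next
      fix v assume v: "v \<in> between r' (f z) (f y)"
      then have "(f x, v) \<in> r'" using ord[of x z] z xI B.r_trans[of "f x" "f z" v] by (auto simp: between_def)
      then have "v \<in> f ` ?I" unfolding im using v by (auto simp: between_def)
      then obtain u where u: "v = f u" "u \<in> ?I" by auto
      then have "u \<in> between r z y"
        using v z xI ord[of z u] ord[of u y] unfolding between_def by auto
      then show "v \<in> f ` between r z y" using u by auto
    qed
    have rk_diff: "rk' (f v) - Suc (rk' (f u)) = rk v - Suc (rk u)" if "(u, v) \<in> r" "u \<in> ?I" "v \<in> ?I" for u v
      using rank_add[OF that(2)] rank_add[OF that(3)] A.rank_le[OF that(1)] that(2,3) A.rank_le[of x u] by auto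
    have "psi r' rk' (f z) (f y) = var_e ^ (rk' (f y) - Suc (rk' (f z)))
       + (\<Sum>v\<in>f ` between r z y. var_e ^ (rk' v - Suc (rk' (f z))) * var_b * psi r' rk' v (f y))"
      unfolding im' by (rule B.psi_rec)
    also have "\<dots> = var_e ^ (rk y - Suc (rk z))
       + (\<Sum>u\<in>between r z y. var_e ^ (rk' (f u) - Suc (rk' (f z))) * var_b * psi r' rk' (f u) (f y))"
      using sub inj_on_subset[OF inj sub] rk_diff[of z y] z xI by (simp add: sum.reindex)
    also have "\<dots> = psi r rk z y"
      unfolding A.psi_rec[of z y]
    proof (intro arg_cong2[where f = "(+)"] HOL.refl sum.cong)
      fix u assume u: "u \<in> between r z y"
      then have uI: "u \<in> ?I" using sub by blast
      have "(z, u) \<in> r" using u by (simp add: between_def)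
      moreover have "psi r rk u y = psi r' rk' (f u) (f y)"
        using A.between_rank[OF u] by (intro less.hyps uI) linarith
      ultimately show "var_e ^ (rk' (f u) - Suc (rk' (f z))) * var_b * psi r' rk' (f u) (f y)
          = var_e ^ (rk u - Suc (rk z)) * var_b * psi r rk u y"
        using rk_diff[of z u] less.prems uI by simp
    qed
    finally show ?case by simp
  qed
  then show ?thesis using xI by blast
qed

section \<open>Coxeter systems and the Bruhat order\<close>

lemma subseq_Cons_cases:
  "subseq vs (s # ws) \<Longrightarrow> subseq vs ws \<or> (\<exists>vs'. vs = s # vs' \<and> subseq vs' ws)"
  by (erule list_emb.cases) auto

locale coxeter = group G for G (structure) +
  fixes S :: "'a set" and m :: "'a \<Rightarrow> 'a \<Rightarrow> enat"
  assumes gens: "S \<subseteq> carrier G"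
    and generates: "generate G S = carrier G"
    and matrix: "coxeter_matrix S m"
    and presentation: "\<And>v w. v \<in> lists S \<Longrightarrow> w \<in> lists S \<Longrightarrow>
      word_prod G v = word_prod G w \<longleftrightarrow> coxeter_cong S m v w"
begin

abbreviation wp :: "'a list \<Rightarrow> 'a" where "wp \<equiv> word_prod G"
abbreviation len :: "'a \<Rightarrow> nat" where "len \<equiv> coxeter_length G S"
abbreviation bruhat :: "'a rel" where "bruhat \<equiv> bruhat_order G S"

subsection \<open>Words and length\<close>

lemma gen_closed [simp]: "s \<in> S \<Longrightarrow> s \<in> carrier G"
  using gens by blast

lemma wp_simps [simp]: "wp [] = \<one>" "wp (s # ws) = s \<otimes> wp ws"
  by (simp_all add: word_prod_def)

lemma wp_closed [simp]: "ws \<in> lists S \<Longrightarrow> wp ws \<in> carrier G"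
  by (induction ws) auto

lemma wp_append: "u \<in> lists S \<Longrightarrow> v \<in> lists S \<Longrightarrow> wp (u @ v) = wp u \<otimes> wp v"
  by (induction u) (auto simp: m_assoc)

lemma gen_sq: assumes "s \<in> S" shows "s \<otimes> s = \<one>"
proof -
  have "m s s = enat 1" using assms matrix by (simp add: coxeter_matrix_def one_enat_def)
  from coxeter_cong.relator[where S = S and m = m and s = s and t = s and u = "[]" and v = "[]" and k = 1, OF assms assms this]
  have "coxeter_cong S m [s, s] []" by simp
  then have "wp [s, s] = wp []" using presentation[of "[s, s]" "[]"] assms by simp
  then show ?thesis using assms by simp
qed

lemma gen_cancel [simp]: "s \<in> S \<Longrightarrow> x \<in> carrier G \<Longrightarrow> s \<otimes> (s \<otimes> x) = x"
  by (simp add: gen_sq flip: m_assoc)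

lemma inv_gen: "s \<in> S \<Longrightarrow> inv s = s"
  by (simp add: gen_sq inv_equality)

lemma wp_rev: "ws \<in> lists S \<Longrightarrow> wp (rev ws) = inv (wp ws)"
proof (induction ws)
  case (Cons s ws)
  then have "rev ws \<in> lists S" "[s] \<in> lists S" by auto
  then show ?case using Cons wp_append[of "rev ws" "[s]"] by (simp add: inv_mult_group inv_gen)
qed simp

lemma cong_length_parity: "coxeter_cong S m v w \<Longrightarrow> even (length v) \<longleftrightarrow> even (length w)"
proof (induction rule: coxeter_cong.induct)
  case (relator s t k u v)
  have "length (concat (replicate k [s, t])) = 2 * k" by (induction k) auto
  then show ?case by simp
qed auto

lemma word_exists: "x \<in> carrier G \<Longrightarrow> \<exists>ws\<in>lists S. wp ws = x"
  unfolding generates[symmetric]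
proof (induction rule: generate.induct)
  case one
  show ?case by (rule bexI[of _ "[]"]) auto
next
  case (incl h)
  then show ?case by (intro bexI[of _ "[h]"]) auto
next
  case (inv h)
  then show ?case by (intro bexI[of _ "[h]"]) (auto simp: inv_gen)
next
  case (eng h1 h2)
  then obtain u v where "u \<in> lists S" "wp u = h1" "v \<in> lists S" "wp v = h2" by blast
  then show ?case by (intro bexI[of _ "u @ v"]) (auto simp: wp_append)
qed

lemma len_le: "ws \<in> lists S \<Longrightarrow> len (wp ws) \<le> length ws"
  unfolding coxeter_length_def by (rule Least_le) blast

lemma reduced_exists:
  assumes "x \<in> carrier G" obtains ws where "reduced_word G S x ws"
proof -
  have "\<exists>k. \<exists>ws\<in>lists S. length ws = k \<and> wp ws = x" using word_exists[OF assms] by blast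
  from LeastI_ex[OF this] show ?thesis
    using that unfolding reduced_word_def coxeter_length_def by blast
qed

lemma reducedD:
  assumes "reduced_word G S x ws"
  shows "ws \<in> lists S" "wp ws = x" "length ws = len x"
  using assms by (auto simp: reduced_word_def)

lemma reduced_iff: "ws \<in> lists S \<Longrightarrow> reduced_word G S (wp ws) ws \<longleftrightarrow> length ws \<le> len (wp ws)"
  using len_le by (force simp: reduced_word_def)

lemma word_length_parity: "ws \<in> lists S \<Longrightarrow> even (length ws) \<longleftrightarrow> even (len (wp ws))"
  by (metis cong_length_parity presentation reducedD reduced_exists wp_closed)

lemma len_gen_mult:
  assumes "s \<in> S" "x \<in> carrier G"
  shows "len (s \<otimes> x) = Suc (len x) \<or> Suc (len (s \<otimes> x)) = len x"
proof -
  have le: "len (s \<otimes> x) \<le> Suc (len x)" if "x \<in> carrier G" for x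
  proof -
    obtain ws where "reduced_word G S x ws" using reduced_exists \<open>x \<in> carrier G\<close> by blast
    then show ?thesis using len_le[of "s # ws"] assms(1) reducedD by fastforce
  qed
  obtain ws where ws: "reduced_word G S x ws" using reduced_exists assms by blast
  then have "even (Suc (len x)) \<longleftrightarrow> even (len (s \<otimes> x))"
    using word_length_parity[of "s # ws"] assms(1) reducedD[OF ws] by simp
  then show ?thesis using le[of x] le[of "s \<otimes> x"] assms by (auto simp: le_Suc_eq)
qed

subsection \<open>Reflections and the strong exchange condition\<close>

text \<open>
  The number of occurrences of \<open>t\<close> in the reflection sequence \<open>s\<^sub>1, s\<^sub>1 s\<^sub>2 s\<^sub>1, \<dots>\<close> of a word
  \<open>s\<^sub>1 \<dots> s\<^sub>n\<close>. Deleting the letter \<open>s\<^sub>i\<close> amounts to multiplying the word by the \<open>i\<close>-th reflection from the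
  left.
\<close>

fun rcount :: "'a list \<Rightarrow> 'a \<Rightarrow> nat" where
  "rcount [] t = 0"
| "rcount (s # ws) t = (if t = s then 1 else 0) + rcount ws (s \<otimes> t \<otimes> s)"

lemma rcount_append:
  "u \<in> lists S \<Longrightarrow> t \<in> carrier G \<Longrightarrow>
     rcount (u @ v) t = rcount u t + rcount v (inv (wp u) \<otimes> t \<otimes> wp u)"
proof (induction u arbitrary: t)
  case (Cons s u)
  then have "inv (wp u) \<otimes> (s \<otimes> t \<otimes> s) \<otimes> wp u = inv (s \<otimes> wp u) \<otimes> t \<otimes> (s \<otimes> wp u)"
    by (simp add: inv_mult_group inv_gen m_assoc)
  then show ?case using Cons by simp
qed simp

lemma wp_alternating:
  "s \<in> S \<Longrightarrow> t \<in> S \<Longrightarrow> wp (concat (replicate k [s, t])) = (s \<otimes> t) [^] k"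
proof (induction k)
  case (Suc k)
  have "(s \<otimes> t) [^] Suc k = (s \<otimes> t) \<otimes> (s \<otimes> t) [^] k"
    using Suc.prems by (simp only: nat_pow_Suc2 m_closed gen_closed)
  then show ?case using Suc by (simp add: m_assoc)
qed simp

lemma rcount_alternating:
  assumes "s \<in> S" "t \<in> S"
  shows "r \<in> carrier G \<Longrightarrow>
    rcount (concat (replicate k [s, t])) r = (\<Sum>j<2 * k. if r = (s \<otimes> t) [^] j \<otimes> s then 1 else 0)"
proof (induction k arbitrary: r)
  case (Suc k)
  define p where "p = s \<otimes> t"
  have p: "p \<in> carrier G" using assms by (simp add: p_def)
  have ip: "inv p = t \<otimes> s" using assms by (simp add: p_def inv_mult_group inv_gen)
  \<comment> \<open>conjugation by \<open>s t\<close> shifts the sequence \<open>(s t)^j s\<close> by two places\<close>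
  have iff1: "s \<otimes> r \<otimes> s = t \<longleftrightarrow> r = p [^] (1::nat) \<otimes> s"
  proof
    assume "s \<otimes> r \<otimes> s = t"
    then have "r = s \<otimes> t \<otimes> s" using assms Suc.prems by (auto simp: m_assoc gen_sq)
    then show "r = p [^] (1::nat) \<otimes> s" using p by (simp add: p_def)
  next
    assume "r = p [^] (1::nat) \<otimes> s"
    then have "r = s \<otimes> t \<otimes> s" using p by (simp add: p_def)
    then show "s \<otimes> r \<otimes> s = t" using assms by (simp add: m_assoc gen_sq)
  qed
  have shift: "p [^] j \<otimes> s \<otimes> (t \<otimes> s) = p [^] Suc j \<otimes> s" for j
    using assms p by (simp add: p_def m_assoc)
  have iff2: "t \<otimes> (s \<otimes> r \<otimes> s) \<otimes> t = p [^] j \<otimes> s \<longleftrightarrow> r = p [^] Suc (Suc j) \<otimes> s" for j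
  proof -
    have "t \<otimes> (s \<otimes> r \<otimes> s) \<otimes> t = inv p \<otimes> r \<otimes> p"
      using assms Suc.prems unfolding ip by (simp add: p_def m_assoc)
    moreover have "inv p \<otimes> r \<otimes> p = q \<longleftrightarrow> r = p \<otimes> q \<otimes> inv p" if "q \<in> carrier G" for q
      using p Suc.prems that by (metis inv_closed inv_inv inv_solve_left inv_solve_right m_assoc m_closed)
    moreover have "p \<otimes> (p [^] j \<otimes> s) \<otimes> inv p = p [^] Suc (Suc j) \<otimes> s"
    proof -
      have "p \<otimes> (p [^] j \<otimes> s) \<otimes> inv p = (p \<otimes> p [^] j) \<otimes> s \<otimes> (t \<otimes> s)"
        unfolding ip using p assms by (simp add: m_assoc)
      also have "p \<otimes> p [^] j = p [^] Suc j" using p by (simp only: nat_pow_Suc2)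
      finally show ?thesis by (simp only: shift)
    qed
    ultimately show ?thesis using p assms by auto
  qed
  have "rcount (concat (replicate (Suc k) [s, t])) r
      = (if r = s then 1 else 0) + ((if s \<otimes> r \<otimes> s = t then 1 else 0)
        + rcount (concat (replicate k [s, t])) (t \<otimes> (s \<otimes> r \<otimes> s) \<otimes> t))"
    by simp
  also have "rcount (concat (replicate k [s, t])) (t \<otimes> (s \<otimes> r \<otimes> s) \<otimes> t)
      = (\<Sum>j<2 * k. if t \<otimes> (s \<otimes> r \<otimes> s) \<otimes> t = p [^] j \<otimes> s then 1 else 0)"
    unfolding p_def by (rule Suc.IH) (use Suc.prems assms in simp)
  also have "(if r = s then 1 else 0) + ((if s \<otimes> r \<otimes> s = t then 1 else 0)
        + (\<Sum>j<2 * k. if t \<otimes> (s \<otimes> r \<otimes> s) \<otimes> t = p [^] j \<otimes> s then 1 else 0))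
      = (if r = s then 1 else 0) + ((if r = p [^] (1::nat) \<otimes> s then 1 else 0)
        + (\<Sum>j<2 * k. if r = p [^] Suc (Suc j) \<otimes> s then 1 else 0))"
    unfolding iff1 iff2 ..
  also have "\<dots> = (\<Sum>j<Suc (Suc (2 * k)). if r = p [^] j \<otimes> s then 1 else 0)"
    using assms by (simp only: sum.lessThan_Suc_shift) simp
  finally show ?case by (simp add: p_def)
qed simp

text \<open>
  The reflection sequence of \<open>(s t)^k\<close> has the entries \<open>(s t)^j s\<close> for \<open>j < 2 k\<close>. If \<open>(s t)^k = 1\<close>, its
  second half repeats the first.
\<close>

lemma rcount_relator_even:
  assumes "s \<in> S" "t \<in> S" "(s \<otimes> t) [^] k = \<one>" "r \<in> carrier G"
  shows "even (rcount (concat (replicate k [s, t])) r)"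
proof -
  let ?f = "\<lambda>j. if r = (s \<otimes> t) [^] j \<otimes> s then 1 else 0 :: nat"
  have split: "(\<Sum>j<a + b. f j) = (\<Sum>j<a. f j) + (\<Sum>j<b. f (a + j))" for f :: "nat \<Rightarrow> nat" and a b
    by (induction b) auto
  have "(s \<otimes> t) [^] (k + j) = (s \<otimes> t) [^] j" for j
    using assms by (simp flip: nat_pow_mult)
  then have "(\<Sum>j<k + k. ?f j) = 2 * (\<Sum>j<k. ?f j)"
    unfolding split by simp
  then show ?thesis using rcount_alternating[OF assms(1,2,4), of k] by (simp add: mult_2)
qed

text \<open>
  The letters behind an inserted relator contribute the same reflections as before, because the relator is
  trivial in the group, and its own contribution is even. So the parity is an invariant of the group element.
\<close>

lemma cong_rcount_parity:
  "coxeter_cong S m v w \<Longrightarrow> t \<in> carrier G \<Longrightarrow> even (rcount v t) \<longleftrightarrow> even (rcount w t)"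
proof (induction arbitrary: t rule: coxeter_cong.induct)
  case (relator s t' k u v)
  let ?R = "concat (replicate k [s, t'])"
  have R: "?R \<in> lists S" using relator(1,2) by (auto simp: in_lists_conv_set)
  have "coxeter_cong S m ?R []"
    using coxeter_cong.relator[where S = S and m = m and s = s and t = t' and k = k and u = "[]" and v = "[]", OF relator(1-3)] by simp
  then have R1: "wp ?R = \<one>" using presentation[OF R, of "[]"] by simp
  let ?c = "inv (wp u) \<otimes> t \<otimes> wp u"
  have c: "?c \<in> carrier G" using relator by simp
  have "even (rcount ?R ?c)"
    using rcount_relator_even[OF relator(1,2) _ c, of k] R1 wp_alternating[OF relator(1,2)] by simp
  moreover have "rcount (?R @ v) ?c = rcount ?R ?c + rcount v ?c"
    using rcount_append[OF R c, of v] c by (simp add: R1)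
  ultimately show ?case
    using rcount_append[OF relator(4) relator(6), of "?R @ v"] rcount_append[OF relator(4) relator(6), of v]
    by simp
qed auto

lemma rcount_parity:
  "v \<in> lists S \<Longrightarrow> w \<in> lists S \<Longrightarrow> wp v = wp w \<Longrightarrow> t \<in> carrier G \<Longrightarrow>
     even (rcount v t) \<longleftrightarrow> even (rcount w t)"
  using cong_rcount_parity presentation by blast

definition reflections :: "'a set" where
  "reflections = {x \<otimes> s \<otimes> inv x | x s. x \<in> carrier G \<and> s \<in> S}"

lemma gen_reflection: "s \<in> S \<Longrightarrow> s \<in> reflections"
  unfolding reflections_def by (rule CollectI, intro exI[of _ \<one>] exI[of _ s]) auto

lemma reflection_closed [simp]: "t \<in> reflections \<Longrightarrow> t \<in> carrier G"
  unfolding reflections_def by auto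

lemma reflection_conj:
  assumes "t \<in> reflections" "s \<in> S" shows "s \<otimes> t \<otimes> s \<in> reflections"
proof -
  obtain x u where x: "t = x \<otimes> u \<otimes> inv x" "x \<in> carrier G" "u \<in> S"
    using assms(1) unfolding reflections_def by blast
  then have "s \<otimes> t \<otimes> s = (s \<otimes> x) \<otimes> u \<otimes> inv (s \<otimes> x)"
    using assms(2) by (simp add: inv_mult_group inv_gen m_assoc)
  moreover have "s \<otimes> x \<in> carrier G" using x assms(2) by simp
  ultimately show ?thesis using x(3) unfolding reflections_def mem_Collect_eq by blast
qed

lemma reflection_sq: "t \<in> reflections \<Longrightarrow> t \<otimes> t = \<one>"
proof -
  assume "t \<in> reflections"
  then obtain x s where x: "t = x \<otimes> s \<otimes> inv x" "x \<in> carrier G" "s \<in> S"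
    unfolding reflections_def by blast
  have "inv x \<otimes> (x \<otimes> y) = y" if "y \<in> carrier G" for y
    using x(2) that by (simp flip: m_assoc)
  then show ?thesis using x by (simp add: m_assoc)
qed

lemma reflection_cancel: "t \<in> reflections \<Longrightarrow> x \<in> carrier G \<Longrightarrow> t \<otimes> (t \<otimes> x) = x"
  by (simp add: reflection_sq flip: m_assoc)

text \<open>
  Writing \<open>t = x s x\<inverse>\<close> as a palindrome, the occurrences of \<open>t\<close> in the two halves cancel modulo two, since
  the word for \<open>x x\<inverse>\<close> represents the identity; the middle letter contributes one more.
\<close>

lemma reflection_word:
  assumes "t \<in> reflections"
  obtains w where "w \<in> lists S" "wp w = t" "odd (length w)" "odd (rcount w t)"
proof -
  obtain x s where x: "t = x \<otimes> s \<otimes> inv x" "x \<in> carrier G" "s \<in> S"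
    using assms unfolding reflections_def by blast
  obtain ws where ws: "ws \<in> lists S" "wp ws = x" using word_exists x(2) by blast
  have t: "t \<in> carrier G" using assms by simp
  have canc: "inv x \<otimes> (x \<otimes> y) = y" if "y \<in> carrier G" for y
    using x(2) that by (simp flip: m_assoc)
  have c: "inv x \<otimes> t \<otimes> x = s" unfolding x(1) using x(2,3) by (simp add: m_assoc canc)
  have rev: "rev ws \<in> lists S" using ws by auto
  have "rcount (ws @ s # rev ws) t = rcount ws t + Suc (rcount (rev ws) s)"
    using rcount_append[OF ws(1) t, of "s # rev ws"] ws c x(3) by (simp add: gen_sq)
  moreover have "rcount (ws @ rev ws) t = rcount ws t + rcount (rev ws) s"
    using rcount_append[OF ws(1) t, of "rev ws"] ws c by simp
  moreover have "even (rcount (ws @ rev ws) t)"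
    using rcount_parity[of "ws @ rev ws" "[]" t] ws rev t x(2) by (simp add: wp_append wp_rev)
  moreover have "wp (ws @ s # rev ws) = t"
    using ws rev x by (simp add: wp_append wp_rev m_assoc)
  ultimately show ?thesis
    using that[of "ws @ s # rev ws"] ws rev x(3) by simp
qed

lemma rcount_flip:
  assumes "t \<in> reflections" "v \<in> lists S" "w \<in> lists S" "wp v = t \<otimes> wp w"
  shows "odd (rcount v t) \<longleftrightarrow> even (rcount w t)"
proof -
  obtain u where u: "u \<in> lists S" "wp u = t" "odd (rcount u t)"
    using reflection_word[OF assms(1)] by blast
  have t: "t \<in> carrier G" using assms(1) by simp
  have "rcount (u @ w) t = rcount u t + rcount w t"
    using rcount_append[OF u(1) t, of w] u t by simp
  moreover have "even (rcount (u @ w) t) \<longleftrightarrow> even (rcount v t)"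
    using rcount_parity[of "u @ w" v t] u assms t by (simp add: wp_append)
  ultimately show ?thesis using u(3) by auto
qed

lemma rcount_delete:
  assumes "ws \<in> lists S" "t \<in> carrier G" "rcount ws t > 0"
  shows "\<exists>u s v. ws = u @ s # v \<and> t \<otimes> wp ws = wp (u @ v)"
  using assms
proof (induction ws arbitrary: t)
  case (Cons s ws)
  have s: "s \<in> S" "ws \<in> lists S" using Cons by auto
  show ?case
  proof (cases "t = s")
    case True
    then have "s # ws = [] @ s # ws \<and> t \<otimes> wp (s # ws) = wp ([] @ ws)" using s by simp
    then show ?thesis by blast
  next
    case False
    then have "rcount ws (s \<otimes> t \<otimes> s) > 0" using Cons.prems by simp
    then obtain u a v where uv: "ws = u @ a # v" "s \<otimes> t \<otimes> s \<otimes> wp ws = wp (u @ v)"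
      using Cons.IH[of "s \<otimes> t \<otimes> s"] Cons.prems s by (metis gen_closed m_closed)
    have "t \<otimes> wp (s # ws) = s \<otimes> (s \<otimes> t \<otimes> s \<otimes> wp ws)"
      using Cons.prems s by (simp add: m_assoc)
    then have "s # ws = (s # u) @ a # v \<and> t \<otimes> wp (s # ws) = wp ((s # u) @ v)"
      unfolding uv(2) using uv(1) by simp
    then show ?thesis by blast
  qed
qed simp

text \<open>
  Exactly one of \<open>x\<close> and \<open>t x\<close> has an odd number of occurrences of \<open>t\<close> (\<open>rcount_flip\<close>), and an odd
  number means that multiplication by \<open>t\<close> deletes a letter. If it were odd for \<open>t x\<close>, a reduced word of
  \<open>t x\<close> would give a shorter word for \<open>x\<close>, against the assumption on lengths.
\<close>

lemma strong_exchange: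
  assumes "ws \<in> lists S" "t \<in> reflections" "len (t \<otimes> wp ws) < len (wp ws)"
  obtains u s v where "ws = u @ s # v" "t \<otimes> wp ws = wp (u @ v)"
proof -
  have "odd (rcount ws t)"
  proof (rule ccontr)
    assume even: "\<not> odd (rcount ws t)"
    have "t \<otimes> wp ws \<in> carrier G" using assms by simp
    then obtain w where w: "reduced_word G S (t \<otimes> wp ws) w" by (rule reduced_exists)
    note w' = reducedD[OF w]
    have "odd (rcount w t)" using rcount_flip[OF assms(2) w'(1) assms(1) w'(2)] even by simp
    then obtain u s v where uv: "w = u @ s # v" "t \<otimes> wp w = wp (u @ v)"
      using rcount_delete[OF w'(1)] assms(2) odd_pos by (metis reflection_closed)
    have "wp ws = wp (u @ v)" using uv(2) w'(2) reflection_cancel[OF assms(2)] assms(1) by simp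
    then have "len (wp ws) \<le> length (u @ v)" using len_le[of "u @ v"] w'(1) uv(1) by simp
    then show False using uv(1) w'(3) assms(3) by simp
  qed
  then show ?thesis using rcount_delete[OF assms(1)] assms(2) odd_pos that by (metis reflection_closed)
qed

lemma subseq_lists: "subseq vs ws \<Longrightarrow> ws \<in> lists S \<Longrightarrow> vs \<in> lists S"
  by (metis in_lists_conv_set subseq_order.order_trans notin_set_nthsI set_nths_subset subseq_conv_nths subsetD)

lemma reduced_subword_exists:
  assumes "ws \<in> lists S"
  shows "\<exists>vs. subseq vs ws \<and> reduced_word G S (wp ws) vs"
  using assms
proof (induction "length ws" arbitrary: ws rule: less_induct)
  case less
  show ?case
  proof (cases ws)
    case Nil
    then show ?thesis using reduced_iff[of "[]"] by auto
  next
    case (Cons s us)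
    then have s: "s \<in> S" "us \<in> lists S" using less.prems by auto
    obtain us' where us': "subseq us' us" "reduced_word G S (wp us) us'"
      using less.hyps[of us] Cons s by auto
    note r = reducedD[OF us'(2)]
    show ?thesis
    proof (cases "len (wp ws) < len (wp us)")
      case False
      then have "len (wp ws) = Suc (len (wp us))" using len_gen_mult[of s "wp us"] s Cons by auto
      then have "reduced_word G S (wp ws) (s # us')" using r s Cons by (simp add: reduced_word_def)
      then show ?thesis using us'(1) Cons by (metis subseq_Cons2)
    next
      case True
      then obtain u a v where uv: "us' = u @ a # v" "s \<otimes> wp us' = wp (u @ v)"
        using strong_exchange[OF r(1) gen_reflection[OF s(1)]] r(2) Cons by auto
      have sub: "subseq (u @ v) ws"
        using us'(1) uv(1) Cons by (metis list_emb_Cons list_emb_append_mono subseq_Cons' subseq_order.order_trans subseq_order.order_refl)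
      have "length (u @ v) < length ws"
        using uv(1) us'(1) Cons list_emb_length[OF us'(1)] by simp
      then obtain vs where "subseq vs (u @ v)" "reduced_word G S (wp (u @ v)) vs"
        using less.hyps[of "u @ v"] uv(1) r(1) by auto
      then show ?thesis using sub uv(2) r(2) Cons by (metis wp_simps(2) subseq_order.order_trans)
    qed
  qed
qed

subsection \<open>The subword property\<close>

text \<open>
  The edges of the Bruhat graph. Their reflexive transitive closure is visibly
  transitive, and it is shown to be the order defined by subwords.
\<close>

definition bruhat_step :: "'a rel" where
  "bruhat_step = {(x, y). x \<in> carrier G \<and> len x < len y \<and> (\<exists>t\<in>reflections. y = t \<otimes> x)}"

lemma len_reflection_parity:
  assumes "t \<in> reflections" "x \<in> carrier G"
  shows "even (len (t \<otimes> x)) \<longleftrightarrow> odd (len x)"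
proof -
  obtain w where w: "w \<in> lists S" "wp w = t" "odd (length w)" using reflection_word[OF assms(1)] by blast
  obtain ws where ws: "ws \<in> lists S" "wp ws = x" using word_exists assms(2) by blast
  show ?thesis
    using word_length_parity[of "w @ ws"] word_length_parity[of ws] w ws by (simp add: wp_append)
qed

lemma gen_step:
  assumes "s \<in> S" "x \<in> carrier G" "len x < len (s \<otimes> x)"
  shows "(x, s \<otimes> x) \<in> bruhat_step"
  using assms gen_reflection by (auto simp: bruhat_step_def)

lemma subword_of_steps:
  assumes "(x, y) \<in> bruhat_step\<^sup>*" "ws \<in> lists S" "wp ws = y"
  shows "\<exists>vs. subseq vs ws \<and> wp vs = x"
  using assms(1)
proof (induction rule: converse_rtrancl_induct)
  case base
  then show ?case using assms by blast
next
  case (step x z)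
  then obtain vs where vs: "subseq vs ws" "wp vs = z" by blast
  obtain t where t: "t \<in> reflections" "z = t \<otimes> x" "len x < len z" "x \<in> carrier G"
    using step(1) by (auto simp: bruhat_step_def)
  have x: "x = t \<otimes> wp vs" using t vs(2) by (simp add: reflection_cancel)
  have "vs \<in> lists S" using subseq_lists vs(1) assms(2) by blast
  then obtain u s v where uv: "vs = u @ s # v" "t \<otimes> wp vs = wp (u @ v)"
    using strong_exchange[OF _ t(1)] t(3) x vs(2) by metis
  have "subseq (u @ v) vs" unfolding uv(1) by (simp add: list_emb_append_mono subseq_Cons')
  then show ?case using uv(2) x vs(1) by (metis subseq_order.order_trans)
qed

text \<open>
  In the main case \<open>s x\<close> is longer than \<open>x\<close>, and the step from \<open>s x\<close> to \<open>s y\<close> along the reflection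
  \<open>s t s\<close> goes up. Otherwise strong exchange would delete a letter of the reduced word of \<open>s x\<close>
  that starts with \<open>s\<close>: deleting \<open>s\<close> forces \<open>t = s\<close>, and deleting another letter makes \<open>y\<close> shorter
  than \<open>x\<close>.
\<close>

lemma gen_mult_step:
  assumes s: "s \<in> S" and xy: "(x, y) \<in> bruhat_step"
  shows "(s \<otimes> x, y) \<in> bruhat_step\<^sup>* \<or> (s \<otimes> x, s \<otimes> y) \<in> bruhat_step\<^sup>*"
proof -
  obtain t where t: "t \<in> reflections" "y = t \<otimes> x" "len x < len y" and x: "x \<in> carrier G"
    using xy by (auto simp: bruhat_step_def)
  have y: "y \<in> carrier G" using t x by simp
  consider "t = s" | "t \<noteq> s" "len (s \<otimes> x) < len x" | "t \<noteq> s" "len (s \<otimes> x) = Suc (len x)"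
    using len_gen_mult[OF s x] by fastforce
  then show ?thesis
  proof cases
    case 1
    then show ?thesis using t by simp
  next
    case 2
    then have "(s \<otimes> x, x) \<in> bruhat_step" using gen_step[OF s, of "s \<otimes> x"] s x by simp
    then show ?thesis using xy by (meson converse_rtrancl_into_rtrancl r_into_rtrancl)
  next
    case 3
    let ?t = "s \<otimes> t \<otimes> s"
    have t': "?t \<in> reflections" using reflection_conj t(1) s by blast
    have sy: "s \<otimes> y = ?t \<otimes> (s \<otimes> x)" using t s x by (simp add: m_assoc)
    have "len (s \<otimes> x) < len (s \<otimes> y)"
    proof (rule ccontr)
      assume "\<not> len (s \<otimes> x) < len (s \<otimes> y)"
      moreover have "len (s \<otimes> x) \<noteq> len (s \<otimes> y)"
        using len_reflection_parity[OF t', of "s \<otimes> x"] s x unfolding sy by auto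
      ultimately have lt: "len (s \<otimes> y) < len (s \<otimes> x)" by simp
      obtain us where us: "reduced_word G S x us" using reduced_exists x by blast
      note r = reducedD[OF us]
      have "s # us \<in> lists S" "wp (s # us) = s \<otimes> x" using s r by simp_all
      then obtain u a v where uv: "s # us = u @ a # v" "s \<otimes> y = wp (u @ v)"
        using strong_exchange[of "s # us", OF _ t'] lt sy by metis
      show False
      proof (cases u)
        case Nil
        then have "s \<otimes> y = x" using uv r by simp
        then have "t \<otimes> x = s \<otimes> x" using s y t(2) by (metis gen_cancel)
        then show False using 3(1) t(1) s x by (simp add: right_cancel)
      next
        case (Cons b u')
        then have b: "b = s" "us = u' @ a # v" using uv(1) by auto
        then have l: "u' @ v \<in> lists S" using r(1) by simp
        have "y = wp (u' @ v)"
          using uv(2) Cons b l s y by (metis append_Cons gen_cancel wp_closed wp_simps(2))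
        then have "len y < len x" using len_le[OF l] r(3) b(2) by simp
        then show False using t(3) by simp
      qed
    qed
    then have "(s \<otimes> x, s \<otimes> y) \<in> bruhat_step"
      using t' sy s x by (auto simp: bruhat_step_def)
    then show ?thesis by blast
  qed
qed

lemma gen_mult_steps:
  assumes s: "s \<in> S" and "(x, y) \<in> bruhat_step\<^sup>*"
  shows "(s \<otimes> x, y) \<in> bruhat_step\<^sup>* \<or> (s \<otimes> x, s \<otimes> y) \<in> bruhat_step\<^sup>*"
  using assms(2)
proof (induction rule: rtrancl_induct)
  case (step y z)
  then show ?case using gen_mult_step[OF s step(2)] by (meson rtrancl.rtrancl_into_rtrancl rtrancl_trans)
qed simp

lemma steps_of_subword:
  assumes "reduced_word G S (wp ws) ws" "subseq vs ws"
  shows "(wp vs, wp ws) \<in> bruhat_step\<^sup>*"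
  using assms
proof (induction ws arbitrary: vs)
  case (Cons s ws)
  have s: "s \<in> S" "ws \<in> lists S" using Cons.prems(1) by (auto simp: reduced_word_def)
  have l: "Suc (length ws) = len (s \<otimes> wp ws)" using Cons.prems(1) by (simp add: reduced_word_def)
  then have red: "reduced_word G S (wp ws) ws" and lt: "len (wp ws) < len (s \<otimes> wp ws)"
    using s len_gen_mult[of s "wp ws"] len_le[of ws] reduced_iff[of ws] by auto
  have st: "(wp ws, s \<otimes> wp ws) \<in> bruhat_step" using gen_step s lt by simp
  show ?case
  proof (cases "subseq vs ws")
    case True
    then show ?thesis using rtrancl_into_rtrancl[OF Cons.IH[OF red] st] by simp
  next
    case False
    then obtain vs' where vs': "vs = s # vs'" "subseq vs' ws"
      using subseq_Cons_cases[OF Cons.prems(2)] by blast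
    then show ?thesis using gen_mult_steps[OF s(1) Cons.IH[OF red vs'(2)]] rtrancl_into_rtrancl[OF _ st]
      by auto
  qed
qed (auto dest: list_emb_Nil2)

lemma bruhat_iff_steps: "(x, y) \<in> bruhat \<longleftrightarrow> y \<in> carrier G \<and> (x, y) \<in> bruhat_step\<^sup>*"
proof
  assume "(x, y) \<in> bruhat"
  then obtain ws vs where *: "reduced_word G S y ws" "subseq vs ws" "reduced_word G S x vs" "y \<in> carrier G"
    unfolding bruhat_order_def by blast
  then show "y \<in> carrier G \<and> (x, y) \<in> bruhat_step\<^sup>*"
    using steps_of_subword[of ws vs] reducedD(2) by metis
next
  assume *: "y \<in> carrier G \<and> (x, y) \<in> bruhat_step\<^sup>*"
  obtain ws where ws: "reduced_word G S y ws" using reduced_exists * by blast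
  obtain us where us: "subseq us ws" "wp us = x" using subword_of_steps * reducedD[OF ws] by blast
  then have l: "us \<in> lists S" using subseq_lists reducedD[OF ws] by blast
  then obtain vs where vs: "subseq vs us" "reduced_word G S x vs" using reduced_subword_exists us(2) by blast
  have "subseq vs ws" using vs(1) us(1) by (rule subseq_order.order_trans)
  then show "(x, y) \<in> bruhat"
    unfolding bruhat_order_def using ws vs(2) * us(2) wp_closed[OF l] by auto
qed

lemma bruhat_subword:
  assumes "(x, y) \<in> bruhat" "reduced_word G S y ws"
  obtains vs where "subseq vs ws" "reduced_word G S x vs"
proof -
  have "(x, y) \<in> bruhat_step\<^sup>*" using assms(1) bruhat_iff_steps by blast
  then obtain us where us: "subseq us ws" "wp us = x" using subword_of_steps reducedD[OF assms(2)] by blast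
  then have "us \<in> lists S" using subseq_lists reducedD[OF assms(2)] by blast
  then obtain vs where "subseq vs us" "reduced_word G S x vs" using reduced_subword_exists us(2) by blast
  then show ?thesis using that us(1) subseq_order.order_trans by blast
qed

lemma bruhat_of_subword:
  assumes "reduced_word G S y ws" "subseq vs ws"
  shows "(wp vs, y) \<in> bruhat"
  using steps_of_subword[of ws vs] assms reducedD[OF assms(1)] wp_closed[of ws] bruhat_iff_steps by auto

lemma bruhat_closed: "(x, y) \<in> bruhat \<Longrightarrow> x \<in> carrier G \<and> y \<in> carrier G"
  by (auto simp: bruhat_order_def)

lemma bruhat_refl: "x \<in> carrier G \<Longrightarrow> (x, x) \<in> bruhat"
  by (simp add: bruhat_iff_steps)

lemma bruhat_trans: "(x, y) \<in> bruhat \<Longrightarrow> (y, z) \<in> bruhat \<Longrightarrow> (x, z) \<in> bruhat"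
  unfolding bruhat_iff_steps by auto

lemma bruhat_len_less: "(x, y) \<in> bruhat \<Longrightarrow> x \<noteq> y \<Longrightarrow> len x < len y"
proof -
  assume "(x, y) \<in> bruhat" "x \<noteq> y"
  then have "(x, y) \<in> bruhat_step\<^sup>+" by (auto simp: bruhat_iff_steps rtrancl_eq_or_trancl)
  then show ?thesis by (induction rule: trancl_induct) (auto simp: bruhat_step_def)
qed

lemma finite_bruhat_interval: "finite {z. (x, z) \<in> bruhat \<and> (z, y) \<in> bruhat}"
proof (cases "y \<in> carrier G")
  case True
  then obtain ws where ws: "reduced_word G S y ws" using reduced_exists by blast
  have "{z. (x, z) \<in> bruhat \<and> (z, y) \<in> bruhat} \<subseteq> wp ` set (subseqs ws)"
    using bruhat_subword[OF _ ws] by (force simp: reduced_word_def)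
  then show ?thesis by (rule finite_subset) simp
next
  case False
  then have "{z. (x, z) \<in> bruhat \<and> (z, y) \<in> bruhat} = {}" using bruhat_closed by blast
  then show ?thesis by (simp only: finite.emptyI)
qed

sublocale ranked_poset bruhat len
proof
  show "trans bruhat" using bruhat_trans by (auto intro: transI)
qed (use bruhat_refl bruhat_closed bruhat_len_less finite_bruhat_interval in blast)+

subsection \<open>The lifting property\<close>

definition descent :: "'a \<Rightarrow> 'a \<Rightarrow> bool" where
  "descent s x \<longleftrightarrow> s \<in> S \<and> x \<in> carrier G \<and> len (s \<otimes> x) < len x"

lemma descent_gen_mult:
  assumes "s \<in> S" "x \<in> carrier G" shows "descent s (s \<otimes> x) \<longleftrightarrow> \<not> descent s x"
  using assms len_gen_mult[OF assms] by (auto simp: descent_def)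

lemma descent_len: "descent s x \<Longrightarrow> len x = Suc (len (s \<otimes> x))"
  using len_gen_mult[of s x] by (auto simp: descent_def)

lemma descent_le: "descent s x \<Longrightarrow> (s \<otimes> x, x) \<in> bruhat"
  using gen_step[of s "s \<otimes> x"] by (auto simp: bruhat_iff_steps descent_def)

lemma ascent_le: "s \<in> S \<Longrightarrow> x \<in> carrier G \<Longrightarrow> \<not> descent s x \<Longrightarrow> (x, s \<otimes> x) \<in> bruhat"
  using descent_le[of s "s \<otimes> x"] descent_gen_mult by simp

lemma descent_subword:
  assumes y: "descent s y" and xy: "(x, y) \<in> bruhat"
  obtains us vs where "reduced_word G S (s \<otimes> y) us" "reduced_word G S y (s # us)"
    "reduced_word G S x vs" "subseq vs us \<or> (\<exists>vs'. vs = s # vs' \<and> subseq vs' us)"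
proof -
  have s: "s \<in> S" "y \<in> carrier G" using y by (auto simp: descent_def)
  obtain us where us: "reduced_word G S (s \<otimes> y) us"
    using reduced_exists[of "s \<otimes> y"] s m_closed gen_closed by blast
  have r: "reduced_word G S y (s # us)"
    using reducedD[OF us] s descent_len[OF y] by (simp add: reduced_word_def)
  then obtain vs where vs: "subseq vs (s # us)" "reduced_word G S x vs"
    using bruhat_subword[OF xy] by blast
  then have "subseq vs us \<or> (\<exists>vs'. vs = s # vs' \<and> subseq vs' us)"
    by (intro subseq_Cons_cases)
  then show ?thesis using that us r vs(2) by blast
qed

text \<open>
  Take a reduced word of \<open>y\<close> that starts with \<open>s\<close>. A reduced subword for \<open>x\<close> cannot use this first
  letter, as \<open>s\<close> is not a descent of \<open>x\<close>; so it lies in a word for \<open>s y\<close>, and \<open>s\<close> can be put in front of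
  it.
\<close>

lemma lifting:
  assumes y: "descent s y" and x: "\<not> descent s x" and xy: "(x, y) \<in> bruhat"
  shows "(s \<otimes> x, y) \<in> bruhat" "(x, s \<otimes> y) \<in> bruhat"
proof -
  obtain us vs where us: "reduced_word G S (s \<otimes> y) us" "reduced_word G S y (s # us)"
    "reduced_word G S x vs" "subseq vs us \<or> (\<exists>vs'. vs = s # vs' \<and> subseq vs' us)"
    using descent_subword[OF y xy] by metis
  have s: "s \<in> S" using y by (auto simp: descent_def)
  have "subseq vs us"
  proof (rule ccontr)
    assume "\<not> subseq vs us"
    then obtain vs' where vs': "vs = s # vs'" using us(4) by blast
    then have "vs' \<in> lists S" "x = s \<otimes> wp vs'" "Suc (length vs') = len x" using reducedD[OF us(3)] by auto
    then have "descent s x" using s len_le[of vs'] by (auto simp: descent_def)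
    then show False using x by simp
  qed
  then show "(s \<otimes> x, y) \<in> bruhat" "(x, s \<otimes> y) \<in> bruhat"
    using bruhat_of_subword[OF us(2), of "s # vs"] bruhat_of_subword[OF us(1), of vs] reducedD(2)[OF us(3)]
    by auto
qed

lemma lifting_descents:
  assumes y: "descent s y" and x: "descent s x" and xy: "(x, y) \<in> bruhat"
  shows "(s \<otimes> x, s \<otimes> y) \<in> bruhat"
proof -
  obtain us vs where us: "reduced_word G S (s \<otimes> y) us" "reduced_word G S y (s # us)"
    "reduced_word G S x vs" "subseq vs us \<or> (\<exists>vs'. vs = s # vs' \<and> subseq vs' us)"
    using descent_subword[OF y xy] by metis
  have s: "s \<in> S" using y by (auto simp: descent_def)
  from us(4) show ?thesis
  proof (elim disjE exE conjE)
    assume "subseq vs us"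
    then have "(x, s \<otimes> y) \<in> bruhat" using bruhat_of_subword[OF us(1)] reducedD(2)[OF us(3)] by blast
    then show ?thesis using descent_le[OF x] bruhat_trans by blast
  next
    fix vs' assume vs': "vs = s # vs'" "subseq vs' us"
    then have "vs' \<in> lists S" "x = s \<otimes> wp vs'" using reducedD[OF us(3)] by auto
    then have "s \<otimes> x = wp vs'" using s by simp
    then show ?thesis using bruhat_of_subword[OF us(1) vs'(2)] by simp
  qed
qed

lemma exists_descent:
  assumes "(x, y) \<in> bruhat" "x \<noteq> y"
  obtains s where "descent s y"
proof -
  have y: "y \<in> carrier G" and pos: "len y > 0" using assms bruhat_closed bruhat_len_less by fastforce+
  obtain ws where ws: "reduced_word G S y ws" using reduced_exists y by blast
  then obtain s us where su: "ws = s # us" using pos reducedD(3)[OF ws] by (cases ws) auto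
  have "s \<in> S" "us \<in> lists S" "y = s \<otimes> wp us" "Suc (length us) = len y"
    using reducedD[OF ws] su by auto
  then have "descent s y" using len_le[of us] y by (auto simp: descent_def)
  then show ?thesis by (rule that)
qed

lemma gen_mult_le:
  assumes "descent s y" "(z, y) \<in> bruhat" shows "(s \<otimes> z, y) \<in> bruhat"
  using assms lifting(1) descent_le bruhat_trans by blast

lemma ascent_mult_le:
  assumes "descent s x" "(s \<otimes> x, v) \<in> bruhat" "\<not> descent s v"
  shows "(x, s \<otimes> v) \<in> bruhat"
proof -
  have s: "s \<in> S" "x \<in> carrier G" "v \<in> carrier G"
    using assms bruhat_closed by (auto simp: descent_def)
  have "\<not> descent s (s \<otimes> x)" using assms(1) s descent_gen_mult by blast
  moreover have "descent s (s \<otimes> v)" using s assms(3) descent_gen_mult by blast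
  moreover have "(s \<otimes> x, s \<otimes> v) \<in> bruhat" using assms(2,3) s ascent_le bruhat_trans by blast
  ultimately show ?thesis using lifting(1)[of s "s \<otimes> v" "s \<otimes> x"] s by simp
qed

subsection \<open>Bruhat intervals are graded and Eulerian\<close>

text \<open>
  Induction on the length of \<open>y\<close>, with a descent \<open>s\<close> of \<open>y\<close>. If \<open>s\<close> is not a descent of \<open>x\<close>, the
  element \<open>s x\<close> covers \<open>x\<close>. Otherwise take \<open>z\<close> covering \<open>s x\<close> below \<open>s y\<close>: either \<open>s z\<close> covers
  \<open>x\<close>, or lifting gives \<open>x \<le> z\<close>, thus \<open>x = z \<le> s y\<close>, and the induction hypothesis applies to
  \<open>[x, s y]\<close> unless \<open>y\<close> itself covers \<open>x\<close>.
\<close>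

lemma bruhat_cover:
  assumes "(x, y) \<in> bruhat" "x \<noteq> y"
  shows "\<exists>z. (x, z) \<in> bruhat \<and> (z, y) \<in> bruhat \<and> len z = Suc (len x)"
  using assms
proof (induction "len y" arbitrary: x y rule: less_induct)
  case less
  obtain s where y: "descent s y" using exists_descent less.prems by blast
  have s: "s \<in> S" "x \<in> carrier G" "y \<in> carrier G" using y bruhat_closed less.prems by (auto simp: descent_def)
  have lt: "len (s \<otimes> y) < len y" using y by (simp add: descent_def)
  show ?case
  proof (cases "descent s x")
    case False
    then have "len (s \<otimes> x) = Suc (len x)" using s descent_gen_mult descent_len[of s "s \<otimes> x"] by simp
    then show ?thesis using ascent_le[OF s(1,2) False] lifting(1)[OF y False less.prems(1)] by blast
  next
    case True
    have "s \<otimes> x \<noteq> s \<otimes> y" using less.prems(2) s by simp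
    then obtain z where z: "(s \<otimes> x, z) \<in> bruhat" "(z, s \<otimes> y) \<in> bruhat" "len z = Suc (len (s \<otimes> x))"
      using less.hyps[OF lt lifting_descents[OF y True less.prems(1)]] by blast
    have zy: "(z, y) \<in> bruhat" using z(2) descent_le[OF y] bruhat_trans by blast
    have zc: "z \<in> carrier G" using zy bruhat_closed by blast
    have lz: "len z = len x" using z(3) descent_len[OF True] by simp
    show ?thesis
    proof (cases "descent s z")
      case False
      then have "len (s \<otimes> z) = Suc (len x)" using s zc lz descent_gen_mult descent_len[of s "s \<otimes> z"] by simp
      then show ?thesis using gen_mult_le[OF y zy] ascent_mult_le[OF True z(1) False] by blast
    next
      case zd: True
      have "\<not> descent s (s \<otimes> x)" using True s descent_gen_mult by blast
      then have "(x, z) \<in> bruhat" using lifting(1)[OF zd _ z(1)] s by simp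
      then have "x = z" using lz bruhat_len_less by fastforce
      then have xsy: "(x, s \<otimes> y) \<in> bruhat" using z(2) by simp
      show ?thesis
      proof (cases "x = s \<otimes> y")
        case True
        then show ?thesis using less.prems bruhat_refl s descent_len[OF y] by (intro exI[of _ y]) auto
      next
        case False
        then obtain w where "(x, w) \<in> bruhat" "(w, s \<otimes> y) \<in> bruhat" "len w = Suc (len x)"
          using less.hyps[OF lt xsy] by blast
        then show ?thesis using descent_le[OF y] bruhat_trans by blast
      qed
    qed
  qed
qed

lemma sum_involution_zero:
  fixes A :: "'a set"
  assumes s: "s \<in> S" and A: "\<And>z. z \<in> A \<Longrightarrow> z \<in> carrier G \<and> s \<otimes> z \<in> A"
  shows "(\<Sum>z\<in>A. (- 1) ^ len z) = (0 :: int)"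
proof -
  have "(\<Sum>z\<in>A. (- 1) ^ len z) = (\<Sum>z\<in>A. (- 1) ^ len (s \<otimes> z) :: int)"
    by (rule sum.reindex_bij_witness[of _ "\<lambda>z. s \<otimes> z" "\<lambda>z. s \<otimes> z"]) (use A s in auto)
  also have "\<dots> = - (\<Sum>z\<in>A. (- 1) ^ len z)"
    unfolding sum_negf[symmetric]
  proof (rule sum.cong[OF HOL.refl])
    fix z assume "z \<in> A"
    then have "even (len (s \<otimes> z)) \<longleftrightarrow> odd (len z)" using len_gen_mult[OF s, of z] A by (metis even_Suc)
    then show "(- 1) ^ len (s \<otimes> z) = (- ((- 1) ^ len z) :: int)"
      by (simp add: minus_one_power_iff)
  qed
  finally show ?thesis by simp
qed

text \<open>
  Induction on the length of \<open>y\<close>, with a descent \<open>s\<close> of \<open>y\<close>. Multiplication by \<open>s\<close> changes the sign and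
  preserves \<open>z \<le> y\<close>. If \<open>s\<close> is not a descent of \<open>x\<close>, it maps \<open>[x, y]\<close> to itself. Otherwise it fails to do
  so only on the set \<open>U\<close> of those \<open>z\<close> for which \<open>s z\<close> drops out of the upper set of \<open>x\<close>. It maps \<open>U\<close>
  onto \<open>[s x, s y] - [x, s y]\<close>, and over both of these intervals the alternating sum vanishes by
  induction. The case \<open>x = s y\<close> is separate because \<open>[x, s y]\<close> is then a single element.
\<close>

lemma bruhat_eulerian:
  assumes "(x, y) \<in> bruhat" "x \<noteq> y"
  shows "(\<Sum>z | (x, z) \<in> bruhat \<and> (z, y) \<in> bruhat. (- 1) ^ len z) = (0 :: int)"
  using assms
proof (induction "len y" arbitrary: x y rule: less_induct)
  case less
  let ?I = "\<lambda>x y. {z. (x, z) \<in> bruhat \<and> (z, y) \<in> bruhat}"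
  let ?f = "\<lambda>z. (- 1) ^ len z :: int"
  obtain s where y: "descent s y" using exists_descent less.prems by blast
  have s: "s \<in> S" "x \<in> carrier G" "y \<in> carrier G" using y bruhat_closed less.prems by (auto simp: descent_def)
  have lt: "len (s \<otimes> y) < len y" using y by (simp add: descent_def)
  have carr: "z \<in> carrier G" if "z \<in> ?I x y" for z using that bruhat_closed by blast
  show ?case
  proof (cases "descent s x")
    case False
    show ?thesis
    proof (rule sum_involution_zero[OF s(1)])
      fix z assume z: "z \<in> ?I x y"
      have "(x, s \<otimes> z) \<in> bruhat"
        using z lifting(2)[of s z x] False ascent_le[of s z] s carr[OF z] bruhat_trans by blast
      then show "z \<in> carrier G \<and> s \<otimes> z \<in> ?I x y" using z gen_mult_le[OF y] carr by blast
    qed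
  next
    case x: True
    show ?thesis
    proof (cases "x = s \<otimes> y")
      case True
      then have ly: "len y = Suc (len x)" using descent_len[OF y] by simp
      have "?I x y = {x, y}"
      proof (intro equalityI subsetI)
        fix z assume z: "z \<in> ?I x y"
        then show "z \<in> {x, y}" using bruhat_len_less[of x z] bruhat_len_less[of z y] ly by fastforce
      qed (use less.prems bruhat_refl s in auto)
      then show ?thesis using ly less.prems(2) by simp
    next
      case False
      define U where "U = {z \<in> ?I x y. descent s z \<and> (x, s \<otimes> z) \<notin> bruhat}"
      define V where "V = {v \<in> ?I (s \<otimes> x) (s \<otimes> y). (x, v) \<notin> bruhat}"
      have sxy: "(s \<otimes> x, s \<otimes> y) \<in> bruhat" by (rule lifting_descents[OF y x less.prems(1)])
      have U0: "(\<Sum>z\<in>?I x y - U. ?f z) = 0"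
      proof (rule sum_involution_zero[OF s(1)])
        fix z assume z: "z \<in> ?I x y - U"
        have zc: "z \<in> carrier G" using z carr by blast
        have "(x, s \<otimes> z) \<in> bruhat"
        proof (cases "descent s z")
          case True then show ?thesis using z by (auto simp: U_def)
        next
          case False then show ?thesis using z ascent_le[OF s(1) zc] bruhat_trans by blast
        qed
        moreover have "(s \<otimes> z, y) \<in> bruhat" using z gen_mult_le[OF y] by blast
        moreover have "s \<otimes> z \<notin> U" using z s zc by (auto simp: U_def)
        ultimately show "z \<in> carrier G \<and> s \<otimes> z \<in> ?I x y - U" using zc by blast
      qed
      have VU: "(\<Sum>u\<in>U. ?f u) = (\<Sum>v\<in>V. - ?f v)"
      proof (rule sum.reindex_bij_witness[of _ "\<lambda>z. s \<otimes> z" "\<lambda>z. s \<otimes> z"])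
        fix u assume u: "u \<in> U"
        then have u': "(x, u) \<in> bruhat" "(u, y) \<in> bruhat" "descent s u" "(x, s \<otimes> u) \<notin> bruhat" "u \<in> carrier G"
          using carr by (auto simp: U_def)
        show "s \<otimes> (s \<otimes> u) = u" using u' s by simp
        show "s \<otimes> u \<in> V"
          using lifting_descents[OF u'(3) x u'(1)] lifting_descents[OF y u'(3,2)] u'(4) by (auto simp: V_def)
        show "- ?f (s \<otimes> u) = ?f u" using descent_len[OF u'(3)] by simp
      next
        fix v assume v: "v \<in> V"
        then have v': "(s \<otimes> x, v) \<in> bruhat" "(v, s \<otimes> y) \<in> bruhat" "(x, v) \<notin> bruhat" "v \<in> carrier G"
          using bruhat_closed by (auto simp: V_def)
        show "s \<otimes> (s \<otimes> v) = v" using v' s by simp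
        have "\<not> descent s (s \<otimes> x)" using x s descent_gen_mult by blast
        then have nd: "\<not> descent s v" using lifting(1)[of s v "s \<otimes> x"] v' s by auto
        have "(v, y) \<in> bruhat" using v'(2) descent_le[OF y] bruhat_trans by blast
        then have "(s \<otimes> v, y) \<in> bruhat" by (rule gen_mult_le[OF y])
        then show "s \<otimes> v \<in> U"
          using ascent_mult_le[OF x v'(1) nd] v' s nd descent_gen_mult by (auto simp: U_def)
      qed
      have V: "V = ?I (s \<otimes> x) (s \<otimes> y) - ?I x (s \<otimes> y)" and sub: "?I x (s \<otimes> y) \<subseteq> ?I (s \<otimes> x) (s \<otimes> y)"
        using descent_le[OF x] bruhat_trans by (auto simp: V_def)
      have "(\<Sum>v\<in>V. ?f v) = (\<Sum>v\<in>?I (s \<otimes> x) (s \<otimes> y). ?f v) - (\<Sum>v\<in>?I x (s \<otimes> y). ?f v)"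
        unfolding V by (rule sum_diff[OF finite_bruhat_interval sub])
      also have "(\<Sum>v\<in>?I (s \<otimes> x) (s \<otimes> y). ?f v) = 0"
        by (rule less.hyps[OF lt sxy]) (use less.prems(2) s in simp)
      also have "(\<Sum>v\<in>?I x (s \<otimes> y). ?f v) = 0"
      proof (cases "(x, s \<otimes> y) \<in> bruhat")
        case True
        then show ?thesis using less.hyps[OF lt True] False by blast
      next
        case False
        then have "?I x (s \<otimes> y) = {}" using bruhat_trans by blast
        then show ?thesis by (simp only: sum.empty)
      qed
      finally have "(\<Sum>u\<in>U. ?f u) = 0" using VU by (simp add: sum_negf)
      moreover have "(\<Sum>z\<in>?I x y. ?f z) = (\<Sum>z\<in>?I x y - U. ?f z) + (\<Sum>u\<in>U. ?f u)"
        by (rule sum.subset_diff) (auto simp: U_def finite_bruhat_interval)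
      ultimately show ?thesis using U0 by simp
    qed
  qed
qed

sublocale graded_poset bruhat len
  by standard (rule bruhat_cover)

sublocale eulerian_poset bruhat len
  by standard (rule bruhat_eulerian)

end

lemma coxeter_systemD:
  assumes "coxeter_system G S" obtains m where "coxeter G S m"
  using assms unfolding coxeter_system_def coxeter_def coxeter_axioms_def by blast

lemma cd_index_bruhat_interval:
  assumes "coxeter_system G S" "(x, y) \<in> bruhat_order G S" "x \<noteq> y"
  shows "cd_index (bruhat_interval G S x y) = psi (bruhat_order G S) (coxeter_length G S) x y"
    and "cd_index (bruhat_interval G S x y)
      \<in> monic_cd_polys (coxeter_length G S y - Suc (coxeter_length G S x))"
proof -
  obtain m where "coxeter G S m" using coxeter_systemD assms(1) by blast
  then interpret coxeter G S m .
  show eq: "cd_index (bruhat_interval G S x y) = psi bruhat len x y"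
    unfolding bruhat_interval_def by (rule cd_index_interval[OF assms(2,3)])
  show "cd_index (bruhat_interval G S x y) \<in> monic_cd_polys (len y - Suc (len x))"
    unfolding monic_cd_polys_conv eq
    using psi_in_cd_space[OF assms(2,3)] lead_psi[OF bruhat_len_less[OF assms(2,3)]] by simp
qed

section \<open>The subword order on words without equal neighbours\<close>

text \<open>
  Multiplying \<open>\<Psi>\<close> by \<open>b\<close> accounts for the top of the interval as if it were one more element of the
  chain. With the value \<open>1\<close> on one-element intervals, the recursion \<open>theta_rec\<close> has no exceptional term.
\<close>

definition theta :: "'p rel \<Rightarrow> ('p \<Rightarrow> nat) \<Rightarrow> 'p \<Rightarrow> 'p \<Rightarrow> ab_poly" where
  "theta r rk x y = (if x = y then 1 else psi r rk x y * var_b)"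

abbreviation above :: "'p rel \<Rightarrow> 'p \<Rightarrow> 'p \<Rightarrow> 'p set" where
  "above r x y \<equiv> {z. (x, z) \<in> r \<and> (z, y) \<in> r \<and> z \<noteq> x}"

lemma theta_refl [simp]: "theta r rk x x = 1"
  by (simp add: theta_def)

lemma (in ranked_poset) theta_rec:
  assumes "(x, y) \<in> r" "x \<noteq> y"
  shows "theta r rk x y = (\<Sum>z\<in>above r x y. var_e ^ (rk z - Suc (rk x)) * var_b * theta r rk z y)"
proof -
  have "above r x y = insert y (between r x y)" "y \<notin> between r x y"
    using assms refl_right by (auto simp: between_def)
  moreover have "theta r rk z y = psi r rk z y * var_b" if "z \<in> between r x y" for z
    using that by (auto simp: theta_def between_def)
  ultimately show ?thesis
    using assms psi_rec[of x y] finite_between[of x y]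
    by (simp add: theta_def distrib_right sum_distrib_right mult.assoc)
qed

text \<open>
  The Bruhat order of the universal Coxeter group, in terms of normal forms.
\<close>

definition word_order :: "nat list rel" where
  "word_order = {(u, v). distinct_adj u \<and> distinct_adj v \<and> subseq u v}"

lemma finite_subseq: "finite {u. subseq u w}"
  by (metis List.finite_set set_subseqs_eq)

interpretation word_order: ranked_poset word_order length
proof
  show "trans word_order"
    unfolding word_order_def by (rule transI) (auto intro: subseq_order.order_trans)
  show "length x < length y" if "(x, y) \<in> word_order" "x \<noteq> y" for x y
    using that subseq_same_length[of x y] list_emb_length[of "(=)" x y]
    unfolding word_order_def by fastforce
  show "finite {z. (x, z) \<in> word_order \<and> (z, y) \<in> word_order}" for x y
    by (rule finite_subset[OF _ finite_subseq[of y]]) (auto simp: word_order_def)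
qed (auto simp: word_order_def)

abbreviation Theta :: "nat list \<Rightarrow> nat list \<Rightarrow> ab_poly" where
  "Theta \<equiv> theta word_order length"

lemma Theta_iso:
  assumes vw: "(v, w) \<in> word_order"
    and inj: "inj f"
    and im: "f ` {z. (v, z) \<in> word_order \<and> (z, w) \<in> word_order}
      = {z. (f v, z) \<in> word_order \<and> (z, f w) \<in> word_order}"
    and ord: "\<And>x y. (v, x) \<in> word_order \<Longrightarrow> (x, w) \<in> word_order \<Longrightarrow> (v, y) \<in> word_order \<Longrightarrow> (y, w) \<in> word_order \<Longrightarrow>
      (f x, f y) \<in> word_order \<longleftrightarrow> (x, y) \<in> word_order"
    and len: "\<And>x. length (f x) = length x + k"
  shows "Theta (f v) (f w) = Theta v w"
proof -
  have "psi word_order length v w = psi word_order length (f v) (f w)"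
    by (rule psi_iso[OF word_order.ranked_poset_axioms word_order.ranked_poset_axioms vw
        inj_on_subset[OF inj subset_UNIV] im ord]) (auto simp: len)
  then show ?thesis using inj by (simp add: theta_def inj_eq)
qed

lemma subseq_rev: "subseq (rev u) (rev v) \<longleftrightarrow> subseq u v"
proof -
  have "subseq (rev u) (rev v)" if "subseq u v" for u v :: "'a list"
    using that by induct (auto intro: subseq_rev_drop_many)
  from this[of u v] this[of "rev u" "rev v"] show ?thesis by auto
qed

lemma word_order_rev [simp]: "(rev u, rev v) \<in> word_order \<longleftrightarrow> (u, v) \<in> word_order"
  by (simp add: word_order_def subseq_rev)

lemma Theta_rev:
  assumes "(v, w) \<in> word_order"
  shows "Theta (rev v) (rev w) = Theta v w"
proof (rule Theta_iso[OF assms, where k = 0])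
  show "rev ` {z. (v, z) \<in> word_order \<and> (z, w) \<in> word_order}
      = {z. (rev v, z) \<in> word_order \<and> (z, rev w) \<in> word_order}"
  proof (intro equalityI subsetI)
    fix z assume "z \<in> {z. (rev v, z) \<in> word_order \<and> (z, rev w) \<in> word_order}"
    then show "z \<in> rev ` {z. (v, z) \<in> word_order \<and> (z, w) \<in> word_order}"
      using word_order_rev[of v "rev z"] word_order_rev[of "rev z" w]
      by (intro image_eqI[of _ _ "rev z"]) auto
  qed auto
qed auto

subsection \<open>Adding a letter: pyramids\<close>

text \<open>
  The condition under which prefixing \<open>s\<close> doubles the interval \<open>[v, w]\<close>. It is weaker than \<open>s\<close> being a new
  letter, which matters for words that already end in \<open>s\<close>.
\<close>

definition avoids :: "nat \<Rightarrow> nat list \<Rightarrow> nat list \<Rightarrow> bool" where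
  "avoids s v w \<longleftrightarrow> (v, w) \<in> word_order \<and>
     (\<forall>z. (v, z) \<in> word_order \<longrightarrow> (z, w) \<in> word_order \<longrightarrow> z = [] \<or> hd z \<noteq> s)"

lemma avoids_order: "avoids s v w \<Longrightarrow> (v, w) \<in> word_order"
  by (simp add: avoids_def)

lemma avoidsD: "avoids s v w \<Longrightarrow> (v, z) \<in> word_order \<Longrightarrow> (z, w) \<in> word_order \<Longrightarrow> z = [] \<or> hd z \<noteq> s"
  by (simp add: avoids_def)

lemma avoids_mono:
  "avoids s v w \<Longrightarrow> (v, z) \<in> word_order \<Longrightarrow> (z, w) \<in> word_order \<Longrightarrow> avoids s z w"
  unfolding avoids_def using word_order.r_trans by blast

lemma subseq_Cons_hd_neq: "subseq z (s # w) \<Longrightarrow> z = [] \<or> hd z \<noteq> s \<Longrightarrow> subseq z w"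
  by (cases z) (auto split: if_splits)

lemma word_order_Cons:
  assumes "z = [] \<or> hd z \<noteq> s" "w = [] \<or> hd w \<noteq> s"
  shows "(s # z, s # w) \<in> word_order \<longleftrightarrow> (z, w) \<in> word_order"
    and "(z, s # w) \<in> word_order \<longleftrightarrow> (z, w) \<in> word_order"
  using assms subseq_Cons_hd_neq[of z s w] by (auto simp: word_order_def distinct_adj_Cons)

lemma interval_Cons_Cons:
  assumes av: "avoids s v w" and z: "(v, z) \<in> word_order" "(z, w) \<in> word_order"
  shows "(#) s ` {u. (z, u) \<in> word_order \<and> (u, w) \<in> word_order}
    = {u. (s # z, u) \<in> word_order \<and> (u, s # w) \<in> word_order}"
proof (intro equalityI subsetI)
  fix u assume "u \<in> (#) s ` {u. (z, u) \<in> word_order \<and> (u, w) \<in> word_order}"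
  then obtain u' where u': "u = s # u'" "(z, u') \<in> word_order" "(u', w) \<in> word_order" by blast
  have "(v, u') \<in> word_order" "(w, w) \<in> word_order"
    using z u' word_order.r_trans word_order.refl_right by blast+
  then have "z = [] \<or> hd z \<noteq> s" "u' = [] \<or> hd u' \<noteq> s" "w = [] \<or> hd w \<noteq> s"
    using avoidsD[OF av] z u' avoids_order[OF av] by blast+
  then show "u \<in> {u. (s # z, u) \<in> word_order \<and> (u, s # w) \<in> word_order}"
    using u' word_order_Cons(1) by simp
next
  fix u assume "u \<in> {u. (s # z, u) \<in> word_order \<and> (u, s # w) \<in> word_order}"
  then have u: "distinct_adj u" "distinct_adj (s # z)" "subseq (s # z) u" "subseq u (s # w)"
    by (auto simp: word_order_def)
  have w: "distinct_adj w" using z by (simp add: word_order_def)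
  have "\<not> subseq u w"
  proof
    assume "subseq u w"
    then have "(s # z, w) \<in> word_order" using u w by (auto simp: word_order_def intro: subseq_order.order_trans)
    moreover have "(v, s # z) \<in> word_order" using z u by (auto simp: word_order_def)
    ultimately show False using avoidsD[OF av, of "s # z"] by simp
  qed
  then obtain u' where u': "u = s # u'" "subseq u' w" using subseq_Cons_cases[OF u(4)] by blast
  then have "(z, u') \<in> word_order" "(u', w) \<in> word_order"
    using u w distinct_adj_ConsD by (auto simp: word_order_def)
  then show "u \<in> (#) s ` {u. (z, u) \<in> word_order \<and> (u, w) \<in> word_order}" using u'(1) by blast
qed

lemma Theta_Cons_Cons:
  assumes av: "avoids s v w" and z: "(v, z) \<in> word_order" "(z, w) \<in> word_order"
  shows "Theta (s # z) (s # w) = Theta z w"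
proof (rule Theta_iso[OF z(2), where k = 1])
  show "(#) s ` {u. (z, u) \<in> word_order \<and> (u, w) \<in> word_order}
    = {u. (s # z, u) \<in> word_order \<and> (u, s # w) \<in> word_order}"
    by (rule interval_Cons_Cons[OF assms])
  show "(s # x, s # y) \<in> word_order \<longleftrightarrow> (x, y) \<in> word_order"
    if "(z, x) \<in> word_order" "(x, w) \<in> word_order" "(z, y) \<in> word_order" "(y, w) \<in> word_order" for x y
    using that avoidsD[OF avoids_mono[OF av z]] by (intro word_order_Cons(1)) blast+
qed auto

lemma above_Cons:
  assumes av: "avoids s v w"
  shows "above word_order v (s # w) = above word_order v w
      \<union> (#) s ` {z. (v, z) \<in> word_order \<and> (z, w) \<in> word_order}"
proof (intro equalityI subsetI)
  have vw: "(v, w) \<in> word_order" by (rule avoids_order[OF av])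
  have w: "w = [] \<or> hd w \<noteq> s" using avoidsD[OF av vw] vw word_order.refl_right by blast
  {
    fix z assume "z \<in> above word_order v (s # w)"
    then have z: "(v, z) \<in> word_order" "(z, s # w) \<in> word_order" "z \<noteq> v" by auto
    show "z \<in> above word_order v w \<union> (#) s ` {z. (v, z) \<in> word_order \<and> (z, w) \<in> word_order}"
    proof (cases "subseq z w")
      case True
      then have "(z, w) \<in> word_order" using z vw by (auto simp: word_order_def)
      then show ?thesis using z by blast
    next
      case False
      have "subseq z (s # w)" using z(2) by (simp add: word_order_def)
      then obtain z' where z': "z = s # z'" "subseq z' w"
        using subseq_Cons_cases False by metis
      have hv: "v = [] \<or> hd v \<noteq> s" using avoidsD[OF av] vw word_order.refl_left by blast
      have "subseq v z'" using subseq_Cons_hd_neq[OF _ hv] z(1) z'(1) by (auto simp: word_order_def)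
      then have "(v, z') \<in> word_order" "(z', w) \<in> word_order"
        using z vw z' distinct_adj_ConsD by (auto simp: word_order_def)
      then show ?thesis using z'(1) by blast
    qed
  next
    fix z assume "z \<in> above word_order v w \<union> (#) s ` {z. (v, z) \<in> word_order \<and> (z, w) \<in> word_order}"
    then show "z \<in> above word_order v (s # w)"
    proof
      assume "z \<in> above word_order v w"
      then have z: "(v, z) \<in> word_order" "(z, w) \<in> word_order" "z \<noteq> v" by auto
      then have "z = [] \<or> hd z \<noteq> s" using avoidsD[OF av] by blast
      then show ?thesis using z word_order_Cons(2)[OF _ w] by blast
    next
      assume "z \<in> (#) s ` {z. (v, z) \<in> word_order \<and> (z, w) \<in> word_order}"
      then obtain z' where z': "z = s # z'" "(v, z') \<in> word_order" "(z', w) \<in> word_order" by blast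
      have h: "z' = [] \<or> hd z' \<noteq> s" "v = [] \<or> hd v \<noteq> s"
        using avoidsD[OF av] z' vw word_order.refl_left by blast+
      have "(v, s # z') \<in> word_order" using word_order_Cons(2)[OF h(2,1)] z'(2) by blast
      moreover have "(s # z', s # w) \<in> word_order" using word_order_Cons(1)[OF h(1) w] z'(3) by blast
      moreover have "s # z' \<noteq> v" using h(2) by auto
      ultimately show ?thesis using z'(1) by blast
    qed
  }
qed

lemma pyr_rank_sum:
  "pyr (\<Sum>z\<in>A. var_e ^ k z * var_b * f z)
   = var_a * (\<Sum>z\<in>A. var_e ^ k z * var_b * f z) + (\<Sum>z\<in>A. var_e ^ k z * var_b * pyr (f z))"
  by (simp add: pyr_sum pyr_e_power_b sum.distrib sum_distrib_left)

text \<open>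
  Elements without the new letter contribute \<open>pyr\<close> of their recursion terms by induction; the copies
  with \<open>s\<close> in front contribute \<open>(b + e) \<Theta> = a \<Theta>\<close>, which is the correction term in \<open>pyr_e_power_b\<close>.
\<close>

lemma Theta_Cons:
  "avoids s v w \<Longrightarrow> Theta v (s # w) = pyr (Theta v w)"
proof (induction "length w - length v" arbitrary: v rule: less_induct)
  case less
  note av = less.prems
  have vw: "(v, w) \<in> word_order" by (rule avoids_order[OF av])
  let ?A = "above word_order v w" and ?I = "{z. (v, z) \<in> word_order \<and> (z, w) \<in> word_order}"
  let ?L = "\<lambda>f. \<Sum>z\<in>?A. var_e ^ (length z - Suc (length v)) * var_b * f z"
  have finI: "finite ?I" by (rule word_order.finite_interval)
  have finA: "finite ?A" by (rule finite_subset[OF _ finI]) blast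
  have I: "?I = insert v ?A" "v \<notin> ?A" using vw word_order.refl_left by auto
  have lenA: "length v < length z" if "z \<in> ?A" for z using that word_order.rank_less by blast
  have w: "w = [] \<or> hd w \<noteq> s" and hv: "v = [] \<or> hd v \<noteq> s"
    using avoidsD[OF av] vw word_order.refl_right word_order.refl_left by blast+
  have "(v, s # w) \<in> word_order" "v \<noteq> s # w"
    using word_order_Cons(2)[OF hv w] vw hv by auto
  then have "Theta v (s # w) = (\<Sum>z\<in>above word_order v (s # w).
      var_e ^ (length z - Suc (length v)) * var_b * Theta z (s # w))"
    by (rule word_order.theta_rec)
  also have "\<dots> = ?L (\<lambda>z. Theta z (s # w))
      + (\<Sum>z\<in>?I. var_e ^ (length z - length v) * var_b * Theta (s # z) (s # w))"
  proof -
    have "?A \<inter> (#) s ` ?I = {}" using avoidsD[OF av] by fastforce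
    then show ?thesis
      unfolding above_Cons[OF av] using finA finI by (simp add: sum.union_disjoint sum.reindex)
  qed
  also have "?L (\<lambda>z. Theta z (s # w)) = ?L (\<lambda>z. pyr (Theta z w))"
  proof (intro sum.cong HOL.refl arg_cong2[where f = "(*)"])
    fix z assume z: "z \<in> ?A"
    have "length z \<le> length w" using z word_order.rank_le by blast
    then show "Theta z (s # w) = pyr (Theta z w)"
      using z lenA[OF z] by (intro less.hyps avoids_mono[OF av]) auto
  qed
  also have "(\<Sum>z\<in>?I. var_e ^ (length z - length v) * var_b * Theta (s # z) (s # w))
      = (\<Sum>z\<in>?I. var_e ^ (length z - length v) * var_b * Theta z w)"
    by (intro sum.cong HOL.refl arg_cong2[where f = "(*)"] Theta_Cons_Cons[OF av]) auto
  also have "\<dots> = var_b * Theta v w + var_e * ?L (\<lambda>z. Theta z w)"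
  proof -
    have "var_e ^ (length z - length v) * var_b * p
        = var_e * (var_e ^ (length z - Suc (length v)) * var_b * p)" if "z \<in> ?A" for z p
      using lenA[OF that] by (simp add: Suc_diff_Suc[symmetric] mult.assoc del: Suc_diff_Suc)
    then show ?thesis
      unfolding I(1) using I(2) finA by (simp add: sum_distrib_left)
  qed
  finally have main: "Theta v (s # w) = ?L (\<lambda>z. pyr (Theta z w))
      + (var_b * Theta v w + var_e * ?L (\<lambda>z. Theta z w))" .
  show ?case
  proof (cases "v = w")
    case True
    then have "?A = {}" using word_order.r_antisym by blast
    then show ?thesis using main True by (simp add: pyr_one del: Collect_empty_eq)
  next
    case False
    have "Theta v w = ?L (\<lambda>z. Theta z w)" by (rule word_order.theta_rec[OF vw False])
    then show ?thesis using main pyr_rank_sum[of "\<lambda>z. length z - Suc (length v)" "\<lambda>z. Theta z w" ?A]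
      by (simp add: var_e_def algebra_simps)
  qed
qed

subsection \<open>Adding a letter at both ends\<close>


lemma subseq_fresh: "subseq v w \<Longrightarrow> s \<notin> set w \<Longrightarrow> s \<notin> set v"
  by (meson subseq_order.order_trans subseq_singleton_left)

lemma avoids_fresh:
  assumes "(v, w) \<in> word_order" "s \<notin> set w" shows "avoids s v w"
proof -
  have "z = [] \<or> hd z \<noteq> s" if "(z, w) \<in> word_order" for z
    using subseq_fresh[of z w s] that assms(2) by (cases z) (auto simp: word_order_def)
  then show ?thesis using assms(1) by (auto simp: avoids_def)
qed

lemma subseq_Cons_snoc: "subseq (s # z) (w @ [s]) \<Longrightarrow> s \<notin> set w \<Longrightarrow> z = []"
proof -
  assume sub: "subseq (s # z) (w @ [s])" and fr: "s \<notin> set w"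
  from sub obtain xs ys where xy: "s # z = xs @ ys" "subseq xs w" "subseq ys [s]" by (rule subseq_appendE)
  have "xs = []"
  proof (rule ccontr)
    assume "xs \<noteq> []"
    then have "s \<in> set xs" using xy(1) by (cases xs) auto
    then show False using subseq_fresh[OF xy(2) fr] by blast
  qed
  then have "length (s # z) \<le> length [s]" using xy list_emb_length[of "(=)" ys "[s]"] by simp
  then show ?thesis by simp
qed

context
  fixes s :: nat and w :: "nat list"
  assumes w: "distinct_adj w" "w \<noteq> []" "s \<notin> set w"
begin

lemma avoids_snoc:
  assumes "(v, w) \<in> word_order" "v \<noteq> []" shows "avoids s v (w @ [s])"
proof -
  have ws: "distinct_adj (w @ [s])" using w by (auto simp: distinct_adj_append_iff)
  have vs: "s \<notin> set v" using subseq_fresh[of v w s] assms(1) w(3) by (simp add: word_order_def)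
  have "z = [] \<or> hd z \<noteq> s" if z: "(v, z) \<in> word_order" "(z, w @ [s]) \<in> word_order" for z
  proof (rule ccontr)
    assume "\<not> (z = [] \<or> hd z \<noteq> s)"
    then obtain z' where z': "z = s # z'" by (cases z) auto
    then have "z = [s]" using z(2) subseq_Cons_snoc[OF _ w(3)] by (auto simp: word_order_def)
    then have "set v \<subseteq> {s}" using z(1) subseq_fresh[of v "[s]"] by (auto simp: word_order_def)
    then show False using vs assms(2) by (cases v) auto
  qed
  then show ?thesis
    using assms(1) ws by (auto simp: avoids_def word_order_def intro: subseq_rev_drop_many)
qed

lemma Theta_snoc:
  assumes "(v, w) \<in> word_order" shows "Theta v (w @ [s]) = pyr (Theta v w)"
proof -
  have "(v, w @ [s]) \<in> word_order"
    using assms w by (auto simp: word_order_def distinct_adj_append_iff intro: subseq_rev_drop_many)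
  then have "Theta v (w @ [s]) = Theta (rev v) (s # rev w)" using Theta_rev[of v "w @ [s]"] by simp
  also have "\<dots> = pyr (Theta (rev v) (rev w))"
    by (rule Theta_Cons, rule avoids_fresh) (use assms w in auto)
  finally show ?thesis using Theta_rev[OF assms] by simp
qed

lemma Theta_both_upper:
  assumes "(v, w) \<in> word_order" "v \<noteq> []"
  shows "Theta v (s # w @ [s]) = pyr (pyr (Theta v w))"
  using Theta_Cons[OF avoids_snoc[OF assms]] Theta_snoc[OF assms(1)] by simp

lemma Theta_both_left:
  assumes "(v, w) \<in> word_order" "v \<noteq> []"
  shows "Theta (s # v) (s # w @ [s]) = pyr (Theta v w)"
proof -
  have av: "avoids s v (w @ [s])" by (rule avoids_snoc[OF assms])
  have "Theta (s # v) (s # w @ [s]) = Theta v (w @ [s])"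
    by (rule Theta_Cons_Cons[OF av]) (use avoids_order[OF av] assms word_order.refl_left in auto)
  then show ?thesis using Theta_snoc[OF assms(1)] by simp
qed

lemma Theta_both_both:
  assumes "(v, w) \<in> word_order" "v \<noteq> []"
  shows "Theta (s # v @ [s]) (s # w @ [s]) = Theta v w"
proof -
  have av: "avoids s v (w @ [s])" by (rule avoids_snoc[OF assms])
  have fr: "s \<notin> set v" using subseq_fresh[of v w s] assms(1) w(3) by (simp add: word_order_def)
  have le: "(v, v @ [s]) \<in> word_order" "(v @ [s], w @ [s]) \<in> word_order"
    using assms w fr by (auto simp: word_order_def distinct_adj_append_iff intro: subseq_rev_drop_many)
  have "Theta (s # v @ [s]) (s # w @ [s]) = Theta (v @ [s]) (w @ [s])"
    by (rule Theta_Cons_Cons[OF av le])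
  also have "\<dots> = Theta (s # rev v) (s # rev w)" using Theta_rev[OF le(2)] by simp
  also have "\<dots> = Theta (rev v) (rev w)"
    by (rule Theta_Cons_Cons[OF avoids_fresh[of "rev v" "rev w"]])
      (use assms w word_order.refl_left in auto)
  finally show ?thesis using Theta_rev[OF assms(1)] by simp
qed

end

lemma Theta_both_right:
  assumes w: "distinct_adj w" "w \<noteq> []" "s \<notin> set w" and v: "(v, w) \<in> word_order" "v \<noteq> []"
  shows "Theta (v @ [s]) (s # w @ [s]) = pyr (Theta v w)"
proof -
  have fr: "s \<notin> set v" using subseq_fresh[of v w s] v(1) w(3) by (simp add: word_order_def)
  have "(v @ [s], s # w @ [s]) \<in> word_order"
    using v w fr by (auto simp: word_order_def distinct_adj_append_iff distinct_adj_Cons)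
  then have "Theta (v @ [s]) (s # w @ [s]) = Theta (s # rev v) (s # rev w @ [s])"
    using Theta_rev[of "v @ [s]" "s # w @ [s]"] by simp
  also have "\<dots> = pyr (Theta (rev v) (rev w))"
    by (rule Theta_both_left) (use v w in auto)
  finally show ?thesis using Theta_rev[OF v(1)] by simp
qed

text \<open>
  Besides \<open>s\<close>, the elements above \<open>1\<close> in \<open>[1, s w s]\<close> are \<open>v\<close>, \<open>s v\<close>, \<open>v s\<close> and \<open>s v s\<close> for the
  \<open>v \<noteq> 1\<close> below \<open>w\<close>, and the polynomials of their upper intervals are known from the preceding
  lemmas. In the product of \<open>[1, w]\<close> with a Boolean algebra of rank two, the place of \<open>s\<close> is taken
  by two atoms and their join, and this accounts for the term with \<open>d\<close>.
\<close>

lemma Theta_both_ends: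
  assumes w: "distinct_adj w" "w \<noteq> []" "s \<notin> set w"
  shows "Theta [] (s # w @ [s]) = pyr (pyr (Theta [] w)) - var_d * Theta [] w"
proof -
  let ?y = "s # w @ [s]"
  define P where "P = above word_order [] w"
  let ?L = "\<lambda>f. \<Sum>v\<in>P. var_e ^ (length v - Suc 0) * var_b * f v"
  let ?l = "\<lambda>v. s # v" and ?r = "\<lambda>v. v @ [s]" and ?b = "\<lambda>v. s # v @ [s]"
  have P: "v \<in> P \<longleftrightarrow> v \<noteq> [] \<and> distinct_adj v \<and> subseq v w" for v
    using w by (auto simp: P_def word_order_def)
  have Pw: "(v, w) \<in> word_order" "v \<noteq> []" if "v \<in> P" for v
    using that by (auto simp: P_def)
  have fresh: "s \<notin> set v" if "v \<in> P" for v using that subseq_fresh[OF _ w(3)] by (auto simp: P)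
  have nP: "[] \<notin> P" by (simp add: P_def)
  have notP: "s # v \<notin> P" "v @ [s] \<notin> P" for v
    using fresh[of "s # v"] fresh[of "v @ [s]"] by auto
  have finP: "finite P" by (rule finite_subset[OF _ finite_subseq[of w]]) (auto simp: P)
  have dy: "distinct_adj ?y" using w by (auto simp: distinct_adj_Cons distinct_adj_append_iff)
  have adj: "distinct_adj (?l v)" "distinct_adj (?r v)" "distinct_adj (?b v)" if "v \<in> P" for v
  proof -
    have v: "v \<noteq> []" "distinct_adj v" "s \<notin> set v" using that P fresh by blast+
    then have "hd v \<noteq> s" "last v \<noteq> s" using hd_in_set last_in_set by metis+
    then show "distinct_adj (?l v)" "distinct_adj (?r v)" "distinct_adj (?b v)"
      using v by (simp_all add: distinct_adj_Cons distinct_adj_append_iff eq_commute[of s])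
  qed
  \<comment> \<open>a subword of \<open>s w s\<close> is a subword \<open>v\<close> of \<open>w\<close>, possibly extended by \<open>s\<close> at either end; for \<open>v = 1\<close>
    all admissible extensions coincide with the one-letter word \<open>s\<close>\<close>
  have up_ne: "above word_order [] ?y = {[s]} \<union> P \<union> ?l ` P \<union> ?r ` P \<union> ?b ` P"
  proof (intro equalityI subsetI)
    fix z assume "z \<in> above word_order [] ?y"
    then have z: "z \<noteq> []" "distinct_adj z" "subseq z ?y" by (auto simp: word_order_def)
    have cases: "\<exists>v. subseq v w \<and> (u = v \<or> u = v @ [s])" if sub: "subseq u (w @ [s])" for u
    proof -
      from sub obtain xs ys where xy: "u = xs @ ys" "subseq xs w" "subseq ys [s]"
        by (rule subseq_appendE)
      then have "ys = [] \<or> ys = [s]" using subseq_Cons_cases[of ys s "[]"] by (auto dest: list_emb_Nil2)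
      then show ?thesis using xy by auto
    qed
    have inP: "v \<in> P" if "subseq v w" "v \<noteq> []" "distinct_adj v" for v using that P by blast
    from subseq_Cons_cases[OF z(3)] show "z \<in> {[s]} \<union> P \<union> ?l ` P \<union> ?r ` P \<union> ?b ` P"
    proof (elim disjE exE conjE)
      assume "subseq z (w @ [s])"
      then obtain v where v: "subseq v w" "z = v \<or> z = v @ [s]" using cases by blast
      then have "distinct_adj v" using z(2) by auto
      then show ?thesis using v z(1) inP by (cases "v = []") auto
    next
      fix u assume u: "z = s # u" "subseq u (w @ [s])"
      then obtain v where v: "subseq v w" "u = v \<or> u = v @ [s]" using cases by blast
      moreover have "distinct_adj u" using z(2) unfolding u(1) by (rule distinct_adj_ConsD)
      ultimately have "distinct_adj v" by auto
      then show ?thesis using v z(2) u(1) inP by (cases "v = []") auto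
    qed
  next
    fix z assume z: "z \<in> {[s]} \<union> P \<union> ?l ` P \<union> ?r ` P \<union> ?b ` P"
    then have "z \<noteq> []" using P by auto
    moreover have "distinct_adj z" using z adj P by auto
    moreover have "subseq z ?y" using z P
      by (auto intro: subseq_rev_drop_many list_emb_append_mono)
    ultimately show "z \<in> above word_order [] ?y" using dy by (auto simp: word_order_def)
  qed
  have up_s: "above word_order [s] ?y = ?l ` P \<union> ?r ` P \<union> ?b ` P"
  proof -
    have "above word_order [s] ?y = {z \<in> above word_order [] ?y. s \<in> set z \<and> z \<noteq> [s]}"
      by (auto simp: word_order_def subseq_singleton_left)
    also have "\<dots> = ?l ` P \<union> ?r ` P \<union> ?b ` P"
      unfolding up_ne using fresh nP by auto
    finally show ?thesis .
  qed
  have disj: "?l ` P \<inter> ?r ` P = {}" "(?l ` P \<union> ?r ` P) \<inter> ?b ` P = {}"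
    "{[s]} \<inter> P = {}" "({[s]} \<union> P) \<inter> (?l ` P \<union> ?r ` P \<union> ?b ` P) = {}"
    using nP notP by (auto simp: Cons_eq_append_conv append_eq_Cons_conv)
  have inj: "inj_on ?l P" "inj_on ?r P" "inj_on ?b P" by (auto simp: inj_on_def)
  have T: "Theta v ?y = pyr (pyr (Theta v w))" "Theta (?l v) ?y = pyr (Theta v w)"
    "Theta (?r v) ?y = pyr (Theta v w)" "Theta (?b v) ?y = Theta v w" if "v \<in> P" for v
    using Theta_both_upper[OF w Pw[OF that]] Theta_both_left[OF w Pw[OF that]]
      Theta_both_right[OF w Pw[OF that]] Theta_both_both[OF w Pw[OF that]] by auto
  have e1: "var_e ^ length v * var_b * p = var_e * (var_e ^ (length v - Suc 0) * var_b * p)" if "v \<in> P" for v p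
    using that P by (cases v) (auto simp: mult.assoc)
  have sum3: "(\<Sum>z\<in>?l ` P \<union> ?r ` P \<union> ?b ` P. g z) = (\<Sum>v\<in>P. g (?l v)) + (\<Sum>v\<in>P. g (?r v)) + (\<Sum>v\<in>P. g (?b v))"
    for g :: "nat list \<Rightarrow> ab_poly"
    using disj(1,2) finP inj by (simp add: sum.union_disjoint sum.reindex)
  have sy: "([s], ?y) \<in> word_order" "[s] \<noteq> ?y" and ny: "([], ?y) \<in> word_order" "[] \<noteq> ?y"
    using dy w by (auto simp: word_order_def)
  \<comment> \<open>the exponents of \<open>e\<close> grow with each added letter, hence the factors \<open>e\<close> and \<open>e\<^sup>2\<close> below\<close>
  have Ts: "Theta [s] ?y = ?L (\<lambda>v. pyr (Theta v w)) + ?L (\<lambda>v. pyr (Theta v w)) + var_e * ?L (\<lambda>v. Theta v w)"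
    unfolding word_order.theta_rec[OF sy] up_s sum3 sum_distrib_left
    by (intro arg_cong2[where f = "(+)"] sum.cong HOL.refl) (simp_all add: T e1)
  have Tn: "Theta [] ?y = var_b * Theta [s] ?y + ?L (\<lambda>v. pyr (pyr (Theta v w)))
      + (var_e * ?L (\<lambda>v. pyr (Theta v w)) + var_e * ?L (\<lambda>v. pyr (Theta v w)) + var_e * (var_e * ?L (\<lambda>v. Theta v w)))"
  proof -
    let ?g = "\<lambda>z. var_e ^ (length z - Suc 0) * var_b * Theta z ?y"
    have "above word_order [] ?y = ({[s]} \<union> P) \<union> (?l ` P \<union> ?r ` P \<union> ?b ` P)"
      unfolding up_ne by blast
    then have "Theta [] ?y = (\<Sum>z\<in>({[s]} \<union> P) \<union> (?l ` P \<union> ?r ` P \<union> ?b ` P). ?g z)"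
      using word_order.theta_rec[OF ny] by simp
    also have "\<dots> = (\<Sum>z\<in>{[s]} \<union> P. ?g z) + (\<Sum>z\<in>?l ` P \<union> ?r ` P \<union> ?b ` P. ?g z)"
      by (rule sum.union_disjoint[OF _ _ disj(4)]) (use finP in auto)
    also have "(\<Sum>z\<in>{[s]} \<union> P. ?g z) = ?g [s] + (\<Sum>v\<in>P. ?g v)"
      using disj(3) finP by simp
    also have "(\<Sum>v\<in>P. ?g v) = ?L (\<lambda>v. pyr (pyr (Theta v w)))"
      by (intro sum.cong HOL.refl) (simp add: T)
    also have "(\<Sum>z\<in>?l ` P \<union> ?r ` P \<union> ?b ` P. ?g z)
        = var_e * ?L (\<lambda>v. pyr (Theta v w)) + var_e * ?L (\<lambda>v. pyr (Theta v w)) + var_e * (var_e * ?L (\<lambda>v. Theta v w))"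
      unfolding sum3 sum_distrib_left
      by (intro arg_cong2[where f = "(+)"] sum.cong HOL.refl) (simp_all add: T e1[unfolded mult.assoc] mult.assoc)
    finally show ?thesis by simp
  qed
  have T0: "Theta [] w = ?L (\<lambda>v. Theta v w)"
    using word_order.theta_rec[of "[]" w] w by (simp add: P_def word_order_def)
  let ?X = "?L (\<lambda>v. Theta v w)" and ?Y = "?L (\<lambda>v. pyr (Theta v w))" and ?Z = "?L (\<lambda>v. pyr (pyr (Theta v w)))"
  have p1: "pyr ?X = var_a * ?X + ?Y" and p2: "pyr ?Y = var_a * ?Y + ?Z" by (rule pyr_rank_sum)+
  have "pyr (pyr ?X) - var_d * ?X = var_b * (?Y + ?Y + var_e * ?X) + ?Z
      + (var_e * ?Y + var_e * ?Y + var_e * (var_e * ?X))"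
    unfolding p1 pyr_add pyr_var_a p2 unfolding p1
    by (simp add: var_d_def var_e_def algebra_simps)
  then show ?thesis unfolding T0 Tn Ts by simp
qed

section \<open>The universal Coxeter group of countable rank\<close>

text \<open>
  Left multiplication by a generator on normal forms.
\<close>

fun push :: "'l \<Rightarrow> 'l list \<Rightarrow> 'l list" where
  "push s [] = [s]"
| "push s (t # w) = (if s = t then w else s # t # w)"

lemma distinct_adj_push: "distinct_adj w \<Longrightarrow> distinct_adj (push s w)"
  by (cases w) (auto dest: distinct_adj_ConsD)

lemma push_push: "distinct_adj w \<Longrightarrow> push s (push s w) = w"
proof (cases w)
  case (Cons t v)
  then show "distinct_adj w \<Longrightarrow> push s (push s w) = w" by (cases v) auto
qed simp

lemma push_Cons: "distinct_adj (s # w) \<Longrightarrow> push s w = s # w"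
  by (cases w) auto

lemma distinct_adj_foldr_push: "distinct_adj w \<Longrightarrow> distinct_adj (foldr push u w)"
  by (induction u) (auto intro: distinct_adj_push)

lemma foldr_push_Nil: "distinct_adj w \<Longrightarrow> foldr push w [] = w"
proof (induction w)
  case (Cons s w)
  then show ?case using distinct_adj_ConsD[OF Cons.prems] by (simp add: push_Cons)
qed simp

lemma length_push: "length (push s w) \<le> Suc (length w)"
  by (cases w) auto

lemma length_foldr_push: "length (foldr push u []) \<le> length u"
  by (induction u) (auto intro: order_trans[OF length_push])

lemma foldr_push_same_length: "length (foldr push u []) = length u \<Longrightarrow> foldr push u [] = u"
proof (induction u)
  case (Cons s u)
  have "length (foldr push u []) = length u"
    using Cons.prems length_push[of s "foldr push u []"] length_foldr_push[of u] by simp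
  then have u: "foldr push u [] = u" by (rule Cons.IH)
  have "length (push s u) = Suc (length u)" using Cons.prems by (simp add: u)
  then have "push s u = s # u" by (cases u) (auto split: if_splits)
  then show ?case by (simp add: u)
qed simp

lemma foldr_push_push:
  assumes "distinct_adj w"
  shows "foldr push (push s r) w = push s (foldr push r w)"
proof (cases r)
  case (Cons t r')
  then show ?thesis
    using push_push[OF distinct_adj_foldr_push[OF assms], of s r'] by auto
qed simp

lemma foldr_push_assoc:
  "distinct_adj w \<Longrightarrow> foldr push (foldr push u v) w = foldr push u (foldr push v w)"
  by (induction u) (auto simp: foldr_push_push)

lemma foldr_push_rev: "distinct_adj w \<Longrightarrow> foldr push (rev w) w = []"
proof (induction w)
  case (Cons s w)
  then show ?case by (auto simp: distinct_adj_ConsD)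
qed simp

text \<open>
  The encoding \<open>enc\<close> places the group inside an arbitrary infinite type. Products are normal forms of
  concatenations, computed on decoded words.
\<close>

definition universal_group :: "(nat list \<Rightarrow> 'g) \<Rightarrow> 'g monoid" where
  "universal_group enc = \<lparr>carrier = enc ` {w. distinct_adj w},
     monoid.mult = (\<lambda>x y. enc (foldr push (inv_into UNIV enc x) (inv_into UNIV enc y))),
     one = enc []\<rparr>"

definition universal_gens :: "(nat list \<Rightarrow> 'g) \<Rightarrow> 'g set" where
  "universal_gens enc = range (\<lambda>i. enc [i])"

context
  fixes enc :: "nat list \<Rightarrow> 'g"
  assumes inj: "inj enc"
begin

abbreviation "UG \<equiv> universal_group enc"
abbreviation "US \<equiv> universal_gens enc"
abbreviation gen :: "nat \<Rightarrow> 'g" where "gen i \<equiv> enc [i]"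

lemma universal_simps:
  "enc u \<otimes>\<^bsub>UG\<^esub> enc v = enc (foldr push u v)" "\<one>\<^bsub>UG\<^esub> = enc []"
  "carrier UG = enc ` {w. distinct_adj w}"
  using inj by (simp_all add: universal_group_def)

lemma enc_eq [simp]: "enc u = enc v \<longleftrightarrow> u = v"
  using inj by (simp add: inj_eq)

lemma inj_gen: "inj gen"
  by (rule injI) simp

lemma group_universal: "group UG"
proof (rule groupI)
  fix x y z assume "x \<in> carrier UG" "y \<in> carrier UG" "z \<in> carrier UG"
  then show "x \<otimes>\<^bsub>UG\<^esub> y \<otimes>\<^bsub>UG\<^esub> z = x \<otimes>\<^bsub>UG\<^esub> (y \<otimes>\<^bsub>UG\<^esub> z)"
    by (auto simp: universal_simps foldr_push_assoc)
next
  fix x assume "x \<in> carrier UG"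
  then obtain w where w: "x = enc w" "distinct_adj w" by (auto simp: universal_simps)
  show "\<exists>y\<in>carrier UG. y \<otimes>\<^bsub>UG\<^esub> x = \<one>\<^bsub>UG\<^esub>"
    by (rule bexI[of _ "enc (rev w)"]) (use w in \<open>auto simp: universal_simps foldr_push_rev\<close>)
qed (auto simp: universal_simps distinct_adj_foldr_push)

lemma word_prod_gens: "word_prod UG (map gen u) = enc (foldr push u [])"
  by (induction u) (auto simp: word_prod_def universal_simps)

lemma lists_gens: "ws \<in> lists US \<longleftrightarrow> (\<exists>u. ws = map gen u)"
proof -
  have "lists US = map gen ` lists UNIV" unfolding universal_gens_def by (rule lists_image)
  then show ?thesis by auto
qed

lemma cong_Cons:
  "coxeter_cong S m u v \<Longrightarrow> s \<in> S \<Longrightarrow> coxeter_cong S m (s # u) (s # v)"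
proof (induction rule: coxeter_cong.induct)
  case (relator a b k u v)
  then show ?case
    using coxeter_cong.relator[of a S b m k "s # u" v] by simp
next
  case (refl w)
  then show ?case by (intro coxeter_cong.refl) auto
qed (blast intro: coxeter_cong.sym coxeter_cong.trans)+

text \<open>
  Every word reduces to its normal form by cancelling neighbours, so that words with the same product
  are congruent.
\<close>

lemma cong_normal_form:
  assumes "\<And>i. m (gen i) (gen i) = 1"
  shows "coxeter_cong US m (map gen u) (map gen (foldr push u []))"
proof (induction u)
  case Nil
  show ?case by (simp add: coxeter_cong.refl)
next
  case (Cons i u)
  have mem: "gen i \<in> US" by (auto simp: universal_gens_def)
  let ?r = "foldr push u []"
  have 1: "coxeter_cong US m (map gen (i # u)) (gen i # map gen ?r)"
    using cong_Cons[OF Cons mem] by simp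
  have 2: "coxeter_cong US m (gen i # map gen ?r) (map gen (push i ?r))"
  proof (cases "\<exists>v. ?r = i # v")
    case True
    then obtain v where v: "?r = i # v" by blast
    have l: "map gen v \<in> lists US" using lists_gens by blast
    have "m (gen i) (gen i) = enat 1" using assms by (simp add: one_enat_def)
    from coxeter_cong.relator[of "gen i" US "gen i" m 1 "[]" "map gen v", OF mem mem this _ l]
    show ?thesis using v by simp
  next
    case False
    then have "push i ?r = i # ?r" by (cases ?r) auto
    then show ?thesis using lists_gens[of "gen i # map gen ?r"]
      by (auto intro!: coxeter_cong.refl exI[of _ "i # ?r"])
  qed
  show ?case using coxeter_cong.trans[OF 1 2] by simp
qed

lemma coxeter_system_universal: "coxeter_system UG US"
  unfolding coxeter_system_def
proof (intro conjI exI ballI)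
  interpret group UG by (rule group_universal)
  let ?m = "\<lambda>s t. if s = t then 1 else \<infinity> :: enat"
  show "group UG" by (rule group_universal)
  show sub: "US \<subseteq> carrier UG" by (auto simp: universal_gens_def universal_simps)
  show "generate UG US = carrier UG"
  proof
    show "generate UG US \<subseteq> carrier UG" by (rule generate_incl[OF sub])
    have "enc w \<in> generate UG US" if "distinct_adj w" for w
      using that
    proof (induction w)
      case Nil
      show ?case using generate.one[of UG US] by (simp add: universal_simps)
    next
      case (Cons i w)
      have "gen i \<in> generate UG US" by (rule generate.incl) (auto simp: universal_gens_def)
      then have "gen i \<otimes>\<^bsub>UG\<^esub> enc w \<in> generate UG US"
        using Cons by (intro generate.eng) (auto dest: distinct_adj_ConsD)
      then show ?case using Cons.prems by (simp add: universal_simps push_Cons)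
    qed
    then show "carrier UG \<subseteq> generate UG US" by (auto simp: universal_simps)
  qed
  show "coxeter_matrix US ?m" by (auto simp: coxeter_matrix_def)
  fix v w assume "v \<in> lists US" "w \<in> lists US"
  then obtain p q where pq: "v = map gen p" "w = map gen q" using lists_gens by blast
  show "word_prod UG v = word_prod UG w \<longleftrightarrow> coxeter_cong US ?m v w"
  proof
    assume "word_prod UG v = word_prod UG w"
    then have eq: "foldr push p [] = foldr push q []" by (simp add: pq word_prod_gens)
    have nf: "coxeter_cong US ?m (map gen u) (map gen (foldr push u []))" for u
      by (rule cong_normal_form) simp
    show "coxeter_cong US ?m v w"
      unfolding pq by (rule coxeter_cong.trans[OF nf[of p, unfolded eq] coxeter_cong.sym[OF nf]])
  next
    assume "coxeter_cong US ?m v w"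
    then show "word_prod UG v = word_prod UG w"
    proof (induction rule: coxeter_cong.induct)
      case (relator s t k u v)
      then have st: "s = t" "k = 1" by (auto split: if_splits simp: one_enat_def)
      obtain i where i: "s = gen i" using relator(1) by (auto simp: universal_gens_def)
      obtain p q where pq: "u = map gen p" "v = map gen q" using relator lists_gens by blast
      have "u @ concat (replicate k [s, t]) @ v = map gen (p @ i # i # q)"
        using st i pq by simp
      moreover have "u @ v = map gen (p @ q)" using pq by simp
      moreover have "foldr push (p @ i # i # q) [] = foldr push (p @ q) []"
        by (simp add: push_push distinct_adj_foldr_push)
      ultimately show ?case by (simp only: word_prod_gens)
    qed auto
  qed
qed

lemma universal_length:
  assumes "distinct_adj w" shows "coxeter_length UG US (enc w) = length w"
  unfolding coxeter_length_def
proof (rule Least_equality)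
  show "\<exists>ws\<in>lists US. length ws = length w \<and> word_prod UG ws = enc w"
    using assms by (intro bexI[of _ "map gen w"]) (auto simp: word_prod_gens foldr_push_Nil lists_gens)
  fix k assume "\<exists>ws\<in>lists US. length ws = k \<and> word_prod UG ws = enc w"
  then obtain ws where ws: "ws \<in> lists US" "length ws = k" "word_prod UG ws = enc w" by blast
  then obtain u where "ws = map gen u" using lists_gens by blast
  then have "length u = k" "foldr push u [] = w" using ws by (simp_all add: word_prod_gens)
  then show "length w \<le> k" using length_foldr_push[of u] by simp
qed

lemma universal_reduced_word:
  assumes "distinct_adj w" shows "reduced_word UG US (enc w) ws \<longleftrightarrow> ws = map gen w"
proof
  assume r: "reduced_word UG US (enc w) ws"
  then obtain u where u: "ws = map gen u" by (auto simp: reduced_word_def lists_gens)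
  then have "foldr push u [] = w" "length u = length w"
    using r universal_length[OF assms] by (auto simp: reduced_word_def word_prod_gens)
  then show "ws = map gen w" using u foldr_push_same_length[of u] by simp
next
  assume "ws = map gen w"
  then show "reduced_word UG US (enc w) ws"
    using assms universal_length[OF assms]
    by (auto simp: reduced_word_def word_prod_gens foldr_push_Nil lists_gens)
qed

lemma subseq_map_gen: "subseq (map gen u) (map gen v) \<longleftrightarrow> subseq u v"
proof
  assume "subseq (map gen u) (map gen v)"
  then have "subseq (map (inv_into UNIV gen) (map gen u)) (map (inv_into UNIV gen) (map gen v))"
    by (rule subseq_map)
  then show "subseq u v" by (simp add: o_def inv_f_f[OF inj_gen])
qed (rule subseq_map)

lemma universal_bruhat:
  "bruhat_order UG US = (\<lambda>(u, v). (enc u, enc v)) ` word_order"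
proof (intro equalityI subsetI)
  fix p assume "p \<in> bruhat_order UG US"
  then obtain u v ws vs where p: "p = (enc u, enc v)" "distinct_adj u" "distinct_adj v"
    and w: "reduced_word UG US (enc v) ws" "subseq vs ws" "reduced_word UG US (enc u) vs"
    by (auto simp: bruhat_order_def universal_simps)
  then have "subseq u v" using universal_reduced_word subseq_map_gen by metis
  then show "p \<in> (\<lambda>(u, v). (enc u, enc v)) ` word_order" using p by (auto simp: word_order_def)
next
  fix p assume "p \<in> (\<lambda>(u, v). (enc u, enc v)) ` word_order"
  then obtain u v where p: "p = (enc u, enc v)" "distinct_adj u" "distinct_adj v" "subseq u v"
    by (auto simp: word_order_def)
  then show "p \<in> bruhat_order UG US"
    using universal_reduced_word subseq_map_gen[of u v]
    by (auto simp: bruhat_order_def universal_simps)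
qed

lemma universal_bruhat_iff: "(enc u, enc v) \<in> bruhat_order UG US \<longleftrightarrow> (u, v) \<in> word_order"
  unfolding universal_bruhat by auto

lemma universal_cd_index:
  assumes "(u, v) \<in> word_order" "u \<noteq> v"
  shows "cd_index (bruhat_interval UG US (enc u) (enc v)) = psi word_order length u v"
proof -
  obtain m where "coxeter UG US m" using coxeter_systemD coxeter_system_universal by blast
  then interpret coxeter UG US m .
  have "cd_index (bruhat_interval UG US (enc u) (enc v))
      = psi (bruhat_order UG US) (coxeter_length UG US) (enc u) (enc v)"
    by (rule cd_index_bruhat_interval(1)[OF coxeter_system_universal])
      (use assms universal_bruhat_iff in auto)
  also have "\<dots> = psi word_order length u v"
  proof (rule psi_iso[OF word_order.ranked_poset_axioms ranked_poset_axioms assms(1), symmetric])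
    show "inj_on enc {z. (u, z) \<in> word_order \<and> (z, v) \<in> word_order}"
      using inj by (rule inj_on_subset) simp
    show "enc ` {z. (u, z) \<in> word_order \<and> (z, v) \<in> word_order}
      = {z. (enc u, z) \<in> bruhat_order UG US \<and> (z, enc v) \<in> bruhat_order UG US}"
    proof (intro equalityI subsetI)
      fix z assume "z \<in> {z. (enc u, z) \<in> bruhat_order UG US \<and> (z, enc v) \<in> bruhat_order UG US}"
      moreover from this obtain w where "z = enc w"
        using bruhat_closed by (auto simp: universal_simps)
      ultimately show "z \<in> enc ` {z. (u, z) \<in> word_order \<and> (z, v) \<in> word_order}"
        by (auto simp: universal_bruhat_iff)
    qed (auto simp: universal_bruhat_iff)
    show "coxeter_length UG US (enc z) - coxeter_length UG US (enc u) = length z - length u"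
      if "(u, z) \<in> word_order" for z
      using that by (auto simp: universal_length word_order_def)
  qed (auto simp: universal_bruhat_iff)
  finally show ?thesis .
qed

end

section \<open>The affine span of the cd-indices of Bruhat intervals\<close>

definition word_psis :: "nat \<Rightarrow> ab_poly set" where
  "word_psis m = {psi word_order length [] w | w. distinct_adj w \<and> length w = Suc m}"

lemma Theta_Nil:
  "w \<noteq> [] \<Longrightarrow> Theta [] w = psi word_order length [] w * var_b"
  by (simp add: theta_def)

lemma fresh_letter: obtains s :: nat where "s \<notin> set w"
  using ex_new_if_finite[OF infinite_UNIV_nat finite_set] by blast

text \<open>
  Prefixing a fresh letter realises \<open>pyr\<close> on the spanning sets, and enclosing a word between two copies of a
  fresh letter realises multiplication by \<open>d\<close> up to the image of \<open>pyr\<close>.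
\<close>

lemma cd_space_spanned: "cd_space m \<subseteq> ab.span (word_psis m)"
proof
  fix p assume p: "p \<in> cd_space m"
  define U where "U m = ab.span {Theta [] w | w. distinct_adj w \<and> length w = Suc m}" for m
  have gen: "Theta [] w \<in> U m" if "distinct_adj w" "length w = Suc m" for w m
    unfolding U_def using that by (intro ab.span_base) blast
  have fresh_Cons: "Theta [] (s # w) = pyr (Theta [] w)" "distinct_adj (s # w)"
    if "distinct_adj w" "s \<notin> set w" for s w
  proof -
    show "Theta [] (s # w) = pyr (Theta [] w)"
      by (intro Theta_Cons avoids_fresh) (use that in \<open>auto simp: word_order_def\<close>)
    show "distinct_adj (s # w)" using that by (cases w) auto
  qed
  have pyrU: "pyr q \<in> U (Suc m)" if "q \<in> U m" for q m
    using that unfolding U_def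
  proof (induction rule: ab.span_induct_alt)
    case base
    show ?case by (simp add: ab.span_zero)
  next
    case (step c x y)
    then obtain w where w: "x = Theta [] w" "distinct_adj w" "length w = Suc m" by blast
    obtain s where s: "s \<notin> set w" by (rule fresh_letter)
    have "pyr x \<in> U (Suc m)" using gen[of "s # w" "Suc m"] fresh_Cons[OF w(2) s] w by simp
    then show ?case using step(2) unfolding U_def by (simp add: pyr_add pyr_scale ab.span_add ab.span_scale)
  qed
  have dU: "var_d * q \<in> U (Suc (Suc m))" if "q \<in> U m" for q m
    using that unfolding U_def[of m]
  proof (induction rule: ab.span_induct_alt)
    case base
    show ?case by (simp add: U_def ab.span_zero)
  next
    case (step c x y)
    then obtain w where w: "x = Theta [] w" "distinct_adj w" "length w = Suc m" by blast
    then have ne: "w \<noteq> []" by auto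
    obtain s where s: "s \<notin> set w" by (rule fresh_letter)
    have "distinct_adj (s # w @ [s])"
      using w(2) s ne by (auto simp: distinct_adj_Cons distinct_adj_append_iff)
    then have "Theta [] (s # w @ [s]) \<in> U (Suc (Suc m))" using w(3) by (intro gen) auto
    moreover have "pyr (pyr x) \<in> U (Suc (Suc m))" using gen[OF w(2,3)] w(1) pyrU by simp
    moreover have "var_d * x = pyr (pyr x) - Theta [] (s # w @ [s])"
      using Theta_both_ends[OF w(2) ne s] w(1) by simp
    ultimately have "var_d * x \<in> U (Suc (Suc m))" unfolding U_def by (simp add: ab.span_diff)
    then show ?case using step(2) unfolding U_def
      by (simp add: distrib_left ab.span_add ab.span_scale flip: scale_ab_mult_right)
  qed
  have base: "var_b \<in> U 0"
    using gen[of "[0]" 0] fresh_Cons(1)[of "[]" 0] by (simp add: pyr_one)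
  have "p * var_b \<in> U m"
    by (rule cd_space_absorbed[of U, OF _ base pyrU dU p]) (simp_all add: U_def)
  moreover have "\<exists>r\<in>ab.span (word_psis m). q = r * var_b" if "q \<in> U m" for q
    using that unfolding U_def
  proof (induction rule: ab.span_induct_alt)
    case base
    show ?case by (rule bexI[of _ 0]) (simp_all add: ab.span_zero)
  next
    case (step c x y)
    then obtain w r where w: "x = Theta [] w" "distinct_adj w" "length w = Suc m"
      and r: "r \<in> ab.span (word_psis m)" "y = r * var_b" by blast
    then have "psi word_order length [] w \<in> ab.span (word_psis m)"
      unfolding word_psis_def by (intro ab.span_base) blast
    moreover have "w \<noteq> []" using w(3) by auto
    then have "x = psi word_order length [] w * var_b" using w(1) Theta_Nil[of w] by simp
    ultimately show ?case using r
      by (intro bexI[of _ "scale_ab c (psi word_order length [] w) + r"])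
        (simp_all add: distrib_right scale_ab_mult_left ab.span_add ab.span_scale)
  qed
  ultimately obtain r where "r \<in> ab.span (word_psis m)" "p * var_b = r * var_b" by blast
  then show "p \<in> ab.span (word_psis m)" by (simp add: mult_var_b_cancel)
qed

theorem theorem6p2:
  fixes n :: nat
  assumes "infinite (UNIV :: 'g set)" and "n \<ge> 1"
  shows "rat_affine_span
           {cd_index (bruhat_interval G S x y) | (G :: 'g monoid) S x y.
              coxeter_system G S \<and> (x, y) \<in> bruhat_order G S \<and>
              int (coxeter_length G S y) - int (coxeter_length G S x) = int n}
         = monic_cd_polys (n - 1)"
proof (rule rat_affine_span_eq_monic)
  let ?X = "{cd_index (bruhat_interval G S x y) | (G :: 'g monoid) S x y.
              coxeter_system G S \<and> (x, y) \<in> bruhat_order G S \<and>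
              int (coxeter_length G S y) - int (coxeter_length G S x) = int n}"
  show "?X \<subseteq> monic_cd_polys (n - 1)"
  proof
    fix p assume "p \<in> ?X"
    then obtain G :: "'g monoid" and S x y where p: "p = cd_index (bruhat_interval G S x y)"
      and G: "coxeter_system G S" "(x, y) \<in> bruhat_order G S"
      and len: "int (coxeter_length G S y) - int (coxeter_length G S x) = int n" by blast
    have "x \<noteq> y" using len assms(2) by auto
    moreover have "coxeter_length G S y - Suc (coxeter_length G S x) = n - 1" using len by linarith
    ultimately show "p \<in> monic_cd_polys (n - 1)" using cd_index_bruhat_interval(2)[OF G] p by simp
  qed
  obtain f :: "nat \<Rightarrow> 'g" where f: "inj f"
    using assms(1) infinite_countable_subset by blast
  \<comment> \<open>any infinite type has room for the words of the universal Coxeter group\<close>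
  define enc :: "nat list \<Rightarrow> 'g" where "enc w = f (to_nat w)" for w
  have enc: "inj enc" unfolding enc_def by (rule injI) (simp add: inj_eq[OF f])
  have "word_psis (n - 1) \<subseteq> ?X"
  proof
    fix p assume "p \<in> word_psis (n - 1)"
    then obtain w where w: "p = psi word_order length [] w" "distinct_adj w" "length w = n"
      using assms(2) by (auto simp: word_psis_def)
    have le: "([], w) \<in> word_order" "[] \<noteq> w" using w assms(2) by (auto simp: word_order_def)
    have "p = cd_index (bruhat_interval (universal_group enc) (universal_gens enc) (enc []) (enc w))"
      using universal_cd_index[OF enc le] w(1) by simp
    moreover have "(enc [], enc w) \<in> bruhat_order (universal_group enc) (universal_gens enc)"
      using universal_bruhat_iff[OF enc] le(1) by blast
    moreover have "int (coxeter_length (universal_group enc) (universal_gens enc) (enc w))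
        - int (coxeter_length (universal_group enc) (universal_gens enc) (enc [])) = int n"
      using universal_length[OF enc, of w] universal_length[OF enc, of "[]"] w by simp
    ultimately show "p \<in> ?X" using coxeter_system_universal[OF enc] by blast
  qed
  then show "cd_space (n - 1) \<subseteq> ab.span ?X"
    using cd_space_spanned ab.span_mono by blast
qed

end
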